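(* Let $\omega\in\mathcal W_{\mathrm{Dou}}$ be a Douglas weight such that $\mathcal D(\omega)\subset H^2$, and let $\zeta\in\mathbb T$. Then $$c_\omega(\{\zeta\})=\frac{1}{2k^\omega(\zeta,\zeta)-1}.$$ In particular, $c_\omega(\{\zeta\})=0$ if and only if $k^\omega(\zeta,\zeta)=\infty$.
   Context: $\mathbb D$ is the open unit disk, $\mathbb T$ the unit circle, $dA$ the normalized area measure on $\mathbb D$, $m$ the normalized Lebesgue measure on $\mathbb T$, $L^2(\mathbb T)=L^2(\mathbb T,m)$. A weight is a measurable function $\omega:\mathbb D\to[0,\infty)$ with $\int_{\mathbb D}\omega\,dA<\infty$. For $f\in L^2(\mathbb T)$, $P[f]$ is its Poisson extension to $\mathbb D$. The gradient is normalized by $\nabla u=(\partial u,\bar\partial u)$, so $|\nabla u|^2=|\partial u|^2+|\bar\partial u|^2$. Put $\mathcal E_\omega(f,g)=\int_{\mathbb D}\nabla P[f]\cdot\overline{\nabla P[g]}\,\omega\,dA$ and $\mathcal D^h(\omega)=\{f\in L^2(\mathbb T):\mathcal E_\omega(f,f)<\infty\}$, with norm $\|f\|_{\mathcal D^h(\omega)}^2=\|f\|_{L^2(\mathbb T)}^2+\mathcal E_\omega(f,f)$. A weight $\omega$ belongs to $\mathcal W_{\mathrm{Dou}}$ if there is a positive Borel measure $\mathbf J_\omega$ on $\mathbb T^2\setminus\mathrm{diag}$ with $\int_{\mathbb D}|\nabla P[f]|^2\omega\,dA=\int_{\mathbb T}\int_{\mathbb T}|f(\zeta)-f(\lambda)|^2\,\mathbf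 J_\omega(d\zeta,d\lambda)$ for every $f\in L^2(\mathbb T)$. $\mathcal D(\omega)$ is the space of holomorphic $f$ on $\mathbb D$ with $\mathcal D_\omega(f)=\int_{\mathbb D}|f'|^2\omega\,dA<\infty$. When $\mathcal D(\omega)\subset H^2$ (the Hardy space), $\mathcal D(\omega)$ with norm $\|f\|_\omega^2=\|f\|_{H^2}^2+\mathcal D_\omega(f)$ is a reproducing kernel Hilbert space on $\mathbb D$ with kernel $k^\omega$. For $\zeta\in\mathbb T$, $k^\omega(\zeta,\zeta)\in[1,\infty]$ denotes the radial boundary value $\lim_{r\to1^-}k^\omega(r\zeta,r\zeta)$, and $1/\infty=0$. Capacity: for $O\subset\mathbb T$ open, $c_\omega(O)=\inf\{\|f\|_{\mathcal D^h(\omega)}^2: f\in\mathcal D^h(\omega),\ |f|\ge1\ m\text{-a.e. on }O\}$; for arbitrary $A\subset\mathbb T$, $c_\omega(A)=\inf\{c_\omega(O):A\subset O,\ O\text{ open}\}$. *)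

theory Defs
  imports "HOL-Analysis.Analysis"
begin

abbreviation unit_disk :: "complex set" where
  "unit_disk \<equiv> ball 0 1"

abbreviation unit_circle :: "complex set" where
  "unit_circle \<equiv> sphere 0 1"

text \<open>Normalized area measure \<open>dA\<close> on the disk (on Lebesgue sets) and normalized arc
  length \<open>m\<close> on the circle (on Borel sets).\<close>

definition disk_measure :: "complex measure" where
  "disk_measure = uniform_measure (lebesgue_on unit_disk) unit_disk"

definition circle_measure :: "complex measure" where
  "circle_measure =
     distr (uniform_measure lborel {0..<2 * pi}) (restrict_space borel unit_circle) cis"

definition weight :: "(complex \<Rightarrow> real) \<Rightarrow> bool" where
  "weight \<omega> \<longleftrightarrow>
     \<omega> \<in> borel_measurable disk_measure \<and>
     (\<forall>z\<in>unit_disk. 0 \<le> \<omega> z) \<and>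
     (\<integral>\<^sup>+z. ennreal (\<omega> z) \<partial>disk_measure) < \<infinity>"

text \<open>Elements of \<open>L\<^sup>2(m)\<close> are represented by Borel functions on the circle; their values
  off the circle are irrelevant.\<close>

definition L2_circle :: "(complex \<Rightarrow> complex) set" where
  "L2_circle = {f. f \<in> borel_measurable circle_measure \<and>
     (\<integral>\<^sup>+\<zeta>. ennreal ((cmod (f \<zeta>))\<^sup>2) \<partial>circle_measure) < \<infinity>}"

definition poisson :: "(complex \<Rightarrow> complex) \<Rightarrow> complex \<Rightarrow> complex" where
  "poisson f z =
     (\<integral>\<zeta>. of_real ((1 - (cmod z)\<^sup>2) / (cmod (\<zeta> - z))\<^sup>2) * f \<zeta> \<partial>circle_measure)"

text \<open>The Wirtinger derivatives \<open>(u\<^sub>x - i u\<^sub>y) / 2\<close> and \<open>(u\<^sub>x + i u\<^sub>y) / 2\<close>.\<close>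

definition wirtinger :: "(complex \<Rightarrow> complex) \<Rightarrow> complex \<Rightarrow> complex" where
  "wirtinger u z =
     (frechet_derivative u (at z) 1 - \<i> * frechet_derivative u (at z) \<i>) / 2"

definition wirtinger_bar :: "(complex \<Rightarrow> complex) \<Rightarrow> complex \<Rightarrow> complex" where
  "wirtinger_bar u z =
     (frechet_derivative u (at z) 1 + \<i> * frechet_derivative u (at z) \<i>) / 2"

definition grad_sq :: "(complex \<Rightarrow> complex) \<Rightarrow> complex \<Rightarrow> real" where
  "grad_sq u z = (cmod (wirtinger u z))\<^sup>2 + (cmod (wirtinger_bar u z))\<^sup>2"

text \<open>The quadratic form \<open>\<E>\<^sub>\<omega>(f,f)\<close>, which may be infinite.\<close>

definition energy :: "(complex \<Rightarrow> real) \<Rightarrow> (complex \<Rightarrow> complex) \<Rightarrow> ennreal" where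
  "energy \<omega> f = (\<integral>\<^sup>+z. ennreal (grad_sq (poisson f) z * \<omega> z) \<partial>disk_measure)"

definition harmonic_dirichlet_space ::
    "(complex \<Rightarrow> real) \<Rightarrow> (complex \<Rightarrow> complex) set" where
  "harmonic_dirichlet_space \<omega> = {f \<in> L2_circle. energy \<omega> f < \<infinity>}"

definition harmonic_norm_sq ::
    "(complex \<Rightarrow> real) \<Rightarrow> (complex \<Rightarrow> complex) \<Rightarrow> ennreal" where
  "harmonic_norm_sq \<omega> f =
     (\<integral>\<^sup>+\<zeta>. ennreal ((cmod (f \<zeta>))\<^sup>2) \<partial>circle_measure) + energy \<omega> f"

text \<open>The Douglas formula is required of every Borel representative \<open>f\<close>. For the right-hand side
  to be well defined on \<open>L\<^sup>2(m)\<close>, sets of the form \<open>(N \<times> \<T>) \<union> (\<T> \<times> N)\<close> (off the diagonal)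
  with \<open>m(N) = 0\<close> must be null for \<open>J\<close>; testing with functions that vanish off \<open>N\<close> shows that
  the condition below entails this.\<close>

definition douglas_weight :: "(complex \<Rightarrow> real) \<Rightarrow> bool" where
  "douglas_weight \<omega> \<longleftrightarrow> weight \<omega> \<and>
     (\<exists>J :: (complex \<times> complex) measure.
        sets J = sets (restrict_space borel {(\<zeta>, \<eta>) \<in> unit_circle \<times> unit_circle. \<zeta> \<noteq> \<eta>}) \<and>
        (\<forall>f\<in>L2_circle.
           energy \<omega> f = (\<integral>\<^sup>+(\<zeta>, \<eta>). ennreal ((cmod (f \<zeta> - f \<eta>))\<^sup>2) \<partial>J)))"

definition dirichlet_space :: "(complex \<Rightarrow> real) \<Rightarrow> (complex \<Rightarrow> complex) set" where
  "dirichlet_space \<omega> = {f. f holomorphic_on unit_disk \<and>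
     (\<integral>\<^sup>+z. ennreal ((cmod (deriv f z))\<^sup>2 * \<omega> z) \<partial>disk_measure) < \<infinity>}"

definition hardy_space :: "(complex \<Rightarrow> complex) set" where
  "hardy_space = {f. f holomorphic_on unit_disk \<and>
     (SUP r\<in>{0..<1::real}.
        \<integral>\<^sup>+\<zeta>. ennreal ((cmod (f (of_real r * \<zeta>)))\<^sup>2) \<partial>circle_measure) < \<infinity>}"

definition hardy_inner :: "(complex \<Rightarrow> complex) \<Rightarrow> (complex \<Rightarrow> complex) \<Rightarrow> complex" where
  "hardy_inner f g = Lim (at_left (1::real))
     (\<lambda>r. \<integral>\<zeta>. f (of_real r * \<zeta>) * cnj (g (of_real r * \<zeta>)) \<partial>circle_measure)"

text \<open>The inner product whose norm is \<open>\<parallel>f\<parallel>\<^sup>2 = \<parallel>f\<parallel>\<^sup>2(H\<^sup>2) + \<integral> |f'|\<^sup>2 \<omega> dA\<close>.\<close>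

definition dirichlet_inner ::
    "(complex \<Rightarrow> real) \<Rightarrow> (complex \<Rightarrow> complex) \<Rightarrow> (complex \<Rightarrow> complex) \<Rightarrow> complex" where
  "dirichlet_inner \<omega> f g = hardy_inner f g +
     (\<integral>z. deriv f z * cnj (deriv g z) * of_real (\<omega> z) \<partial>disk_measure)"

definition is_dirichlet_kernel ::
    "(complex \<Rightarrow> real) \<Rightarrow> (complex \<Rightarrow> complex \<Rightarrow> complex) \<Rightarrow> bool" where
  "is_dirichlet_kernel \<omega> k \<longleftrightarrow>
     (\<forall>w\<in>unit_disk. (\<lambda>z. k z w) \<in> dirichlet_space \<omega> \<and>
        (\<forall>f\<in>dirichlet_space \<omega>. dirichlet_inner \<omega> f (\<lambda>z. k z w) = f w))"

text \<open>When \<open>dirichlet_space \<omega> \<subseteq> hardy_space\<close> the reproducing kernel is unique on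
  \<open>unit_disk \<times> unit_disk\<close>; the choice operator is needed only because its values outside
  that set are arbitrary.\<close>

definition dirichlet_kernel :: "(complex \<Rightarrow> real) \<Rightarrow> complex \<Rightarrow> complex \<Rightarrow> complex" where
  "dirichlet_kernel \<omega> = (SOME k. is_dirichlet_kernel \<omega> k)"

definition kernel_boundary_value :: "(complex \<Rightarrow> real) \<Rightarrow> complex \<Rightarrow> ennreal" where
  "kernel_boundary_value \<omega> \<zeta> = Lim (at_left (1::real))
     (\<lambda>r. ennreal (Re (dirichlet_kernel \<omega> (of_real r * \<zeta>) (of_real r * \<zeta>))))"

definition open_capacity :: "(complex \<Rightarrow> real) \<Rightarrow> complex set \<Rightarrow> ennreal" where
  "open_capacity \<omega> U =
     (INF f\<in>{f \<in> harmonic_dirichlet_space \<omega>. AE \<zeta> in circle_measure. \<zeta> \<in> U \<longrightarrow> 1 \<le> cmod (f \<zeta>)}.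
        harmonic_norm_sq \<omega> f)"

definition capacity :: "(complex \<Rightarrow> real) \<Rightarrow> complex set \<Rightarrow> ennreal" where
  "capacity \<omega> A =
     (INF U\<in>{U. openin (top_of_set unit_circle) U \<and> A \<subseteq> U}. open_capacity \<omega> U)"

end

theory Submission
  imports Defs "HOL-Complex_Analysis.Complex_Analysis" "HOL-Real_Asymp.Real_Asymp"
begin

text \<open>For \<open>H \<in> \<D>(\<omega>)\<close> with \<open>Im H(0) = 0\<close>, the squared \<open>\<D>\<^sup>h(\<omega>)\<close>-norm of the boundary values
  of \<open>u = Re H\<close> is \<open>N H = (\<parallel>H\<parallel>\<^sup>2 + H(0)\<^sup>2) / 2\<close>, and \<open>K\<^sub>w = 2 k\<^sub>w - 1\<close> represents \<open>u \<mapsto> u(w)\<close> for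
  the corresponding inner product; hence \<open>N K\<^sub>w = K\<^sub>w(w) = 2 k(w,w) - 1\<close>. The Douglas formula makes
  \<open>u \<mapsto> |u|\<close> and \<open>u \<mapsto> min 1 |u|\<close> contractions, so the capacity of \<open>{\<zeta>}\<close> is the infimum \<open>C\<close> of \<open>N e\<close> over
  those \<open>e\<close> for which \<open>Re e\<close> tends to \<open>1\<close> at \<open>\<zeta>\<close>. Testing such an \<open>e\<close> against \<open>K\<^sub>w\<close> with \<open>w = r \<zeta> \<rightarrow> \<zeta>\<close>
  gives \<open>1 \<le> C liminf K\<^sub>w(w)\<close>.

  For the converse, replace \<open>K\<^sub>w\<close> by a bounded \<open>F\<close> with \<open>Re F \<ge> 0\<close>, \<open>N F \<le> K\<^sub>w(w)\<close> and \<open>Re F(w)\<close> almost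
  \<open>K\<^sub>w(w)\<close>, and pass to the primitive \<open>G\<close> of \<open>(1 - (\<zeta>\<^sup>* z)\<^sup>n)\<^sup>b F'\<close>, where \<open>\<zeta>\<^sup>*\<close> is the conjugate of \<open>\<zeta>\<close>. Since
  \<open>(1 - (\<zeta>\<^sup>* z)\<^sup>n)\<^sup>b F - G\<close> has bounded derivative, \<open>Re G\<close> has a limit \<open>c\<close> at \<open>\<zeta>\<close>; integration by parts along
  the radius makes \<open>c\<close> an average of \<open>Re F\<close>, which for suitable \<open>b\<close> and \<open>n\<close> is concentrated where Harnack's
  inequality compares it with \<open>Re F(w)\<close>. The modification hardly changes the inner product with
  a near-minimiser \<open>e\<close> as \<open>n \<rightarrow> \<infinity>\<close>, and by minimality that product is nearly \<open>c N e\<close>. So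
  \<open>C K\<^sub>w(w)\<close> is at most about \<open>\<surd>C \<surd>(K\<^sub>w(w))\<close>, that is, \<open>limsup K\<^sub>w(w) \<le> 1 / C\<close>.\<close>

text \<open>The function \<open>K\<close> at \<open>w\<close> is the natural competitor for the
  capacity, but nothing says that its real part has a limit at \<zeta>, while the capacity tests
  whole arcs. Multiplying \<open>F\<close> itself by a cutoff \<open>B\<close> adds the term B' F,
  for which no energy bound uniform in n is at hand; multiplying F' by \<open>B\<close> keeps the
  energy under control for any weight. The price is that the boundary value c is only an average of
  Re F along the radius, with density q(s) = -(d/ds) (1 - s^n)^b. In the variable y = s^n this
  density does not depend on n, and for large b nearly all of it sits on a window [y1, y2] with ln
  y2 / ln y1 close to 1. Harnack's constant on a radius is such a ratio of logarithms, which n-th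
  roots leave unchanged, so one b serves for all n. A fixed b costs a factor 2^b in the norm; it is
  beaten by choosing first b, then e nearly minimal, then n large, with r^n inside the window. The
  real parts account for the 2 in 2 k - 1: the normalised gradient of Re H has square |H'|^2 /
  2.\<close>

subsection \<open>Power series on circles\<close>

lemma space_circle_measure [simp]: "space circle_measure = unit_circle"
  by (simp add: circle_measure_def space_restrict_space)

lemma sets_circle_measure [measurable_cong]:
  "sets circle_measure = sets (restrict_space borel unit_circle)"
  by (simp add: circle_measure_def)

lemma cis_measurable_circle: "cis \<in> uniform_measure lborel {0..<2 * pi} \<rightarrow>\<^sub>M restrict_space borel unit_circle"
proof (rule measurable_restrict_space2)
  show "cis \<in> borel_measurable (uniform_measure lborel {0..<2 * pi})"
    using borel_measurable_continuous_onI[OF continuous_on_cis[OF continuous_on_id]]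
    by (simp cong: measurable_cong_sets)
qed auto

lemma prob_circle: "emeasure circle_measure unit_circle = 1"
proof -
  have 1: "cis -` unit_circle = UNIV" by auto
  have "unit_circle \<in> sets (restrict_space borel unit_circle)"
    using sets.top[of "restrict_space borel unit_circle"] by (simp add: space_restrict_space)
  then show ?thesis
    unfolding circle_measure_def
    by (subst emeasure_distr[OF cis_measurable_circle]) (simp_all add: 1 emeasure_uniform_measure)
qed

lemma finite_measure_circle: "finite_measure circle_measure"
  by (rule finite_measureI) (simp add: prob_circle)

interpretation circle: finite_measure circle_measure
  by (rule finite_measure_circle)

lemma measure_circle: "measure circle_measure unit_circle = 1"
  by (simp add: measure_def prob_circle)

lemma borel_measurable_circle_continuous:
  fixes f :: "complex \<Rightarrow> 'b::topological_space"
  assumes "continuous_on unit_circle f"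
  shows "f \<in> borel_measurable circle_measure"
proof -
  have "f \<in> borel_measurable (restrict_space borel unit_circle)"
    by (rule borel_measurable_continuous_on_restrict[OF assms])
  then show ?thesis
    by (simp cong: measurable_cong_sets add: sets_circle_measure)
qed

lemma integrable_circle_bounded:
  fixes f :: "complex \<Rightarrow> 'b::{banach, second_countable_topology}"
  assumes "f \<in> borel_measurable circle_measure" "\<And>x. x \<in> unit_circle \<Longrightarrow> norm (f x) \<le> B"
  shows "integrable circle_measure f"
  by (rule circle.integrable_const_bound[where B = B]) (use assms in auto)

lemma integrable_circle_continuous:
  fixes f :: "complex \<Rightarrow> 'b::{banach, second_countable_topology}"
  assumes "continuous_on unit_circle f"
  shows "integrable circle_measure f"
proof -
  have "compact (f ` unit_circle)"
    by (rule compact_continuous_image[OF assms]) simp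
  then obtain B where "\<And>x. x \<in> unit_circle \<Longrightarrow> norm (f x) \<le> B"
    by (metis bounded_iff compact_imp_bounded imageI)
  then show ?thesis
    by (intro integrable_circle_bounded[where B = B] borel_measurable_circle_continuous assms)
qed

lemma integral_circle_cis:
  fixes f :: "complex \<Rightarrow> complex"
  assumes "continuous_on unit_circle f"
  shows "integral\<^sup>L circle_measure f = (1 / (2 * pi)) *\<^sub>R integral {0..2 * pi} (\<lambda>t. f (cis t))"
proof -
  let ?U = "uniform_measure lborel {0..<2 * pi} :: real measure"
  have m: "f \<in> borel_measurable (restrict_space borel unit_circle)"
    by (rule borel_measurable_continuous_on_restrict[OF assms])
  have c: "continuous_on UNIV (\<lambda>t. f (cis t))"
    by (rule continuous_on_compose2[OF assms]) (auto intro!: continuous_intros)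
  then have cm: "(\<lambda>t. f (cis t)) \<in> borel_measurable borel"
    by (rule borel_measurable_continuous_onI)
  have 1: "integral\<^sup>L circle_measure f = integral\<^sup>L ?U (\<lambda>t. f (cis t))"
    unfolding circle_measure_def by (rule integral_distr[OF cis_measurable_circle m])
  have 2: "?U = density lborel (\<lambda>t. ennreal (indicator {0..<2 * pi} t / (2 * pi)))"
    unfolding uniform_measure_def
    by (rule density_cong) (auto intro!: AE_I2 split: split_indicator simp: divide_ennreal[symmetric])
  have "integral\<^sup>L ?U (\<lambda>t. f (cis t)) =
      (\<integral>t. (indicator {0..<2 * pi} t / (2 * pi)) *\<^sub>R f (cis t) \<partial>lborel)"
    unfolding 2 by (rule integral_density) (use cm in auto)
  also have "\<dots> = (\<integral>t. (1 / (2 * pi)) *\<^sub>R (indicator {0..<2 * pi} t *\<^sub>R f (cis t)) \<partial>lborel)"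
    by (rule Bochner_Integration.integral_cong) auto
  also have "\<dots> = (1 / (2 * pi)) *\<^sub>R (\<integral>t. indicator {0..<2 * pi} t *\<^sub>R f (cis t) \<partial>lborel)"
    by (rule integral_scaleR_right)
  also have "(\<integral>t. indicator {0..<2 * pi} t *\<^sub>R f (cis t) \<partial>lborel) =
             (\<integral>t. indicator {0..2 * pi} t *\<^sub>R f (cis t) \<partial>lborel)"
  proof (rule integral_cong_AE)
    have "AE t in lborel. t \<noteq> 2 * pi"
      by (rule AE_lborel_singleton)
    then show "AE t in lborel. indicator {0..<2 * pi} t *\<^sub>R f (cis t) = indicator {0..2 * pi} t *\<^sub>R f (cis t)"
      by eventually_elim (auto split: split_indicator)
  qed (use cm in auto)
  also have "\<dots> = integral {0..2 * pi} (\<lambda>t. f (cis t))"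
    using set_borel_integral_eq_integral(2)[of "{0..2 * pi}" "\<lambda>t. f (cis t)"]
      borel_integrable_compact[of "{0..2 * pi}" "\<lambda>t. f (cis t)"] continuous_on_subset[OF c]
    by (simp add: set_integrable_def set_lebesgue_integral_def)
  finally show ?thesis using 1 by simp
qed

lemma continuous_on_circle_powi: "continuous_on unit_circle (\<lambda>\<xi>::complex. \<xi> powi k)"
  by (intro continuous_intros) auto

lemma integral_circle_powi:
  "(\<integral>\<xi>. \<xi> powi k \<partial>circle_measure) = (if k = 0 then 1 else 0)"
proof (cases "k = 0")
  case True
  then show ?thesis by (simp add: measure_circle)
next
  case False
  have e: "cis t powi k = cis (of_int k * t)" for t
    by (simp add: cis_power_int)
  have "((\<lambda>t. cis (of_int k * t)) has_integral
        (cis (of_int k * (2 * pi)) / (\<i> * of_int k) - cis (of_int k * 0) / (\<i> * of_int k))) {0..2 * pi}"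
  proof (rule fundamental_theorem_of_calculus)
    fix t :: real assume "t \<in> {0..2 * pi}"
    have "((\<lambda>z. exp (\<i> * (of_int k * z)) / (\<i> * of_int k)) has_field_derivative
        exp (\<i> * (of_int k * of_real t))) (at (of_real t))"
      using False by (auto intro!: derivative_eq_intros simp: mult.left_commute[of \<i>])
    from has_vector_derivative_real_field[OF this]
    show "((\<lambda>t. cis (of_int k * t) / (\<i> * of_int k)) has_vector_derivative cis (of_int k * t))
        (at t within {0..2 * pi})"
      by (simp add: cis_conv_exp)
  qed simp
  moreover have "cis (of_int k * (2 * pi)) = 1" using cis_multiple_2pi[of "of_int k"]
    by (simp add: mult_ac)
  ultimately have "integral {0..2 * pi} (\<lambda>t. cis (of_int k * t)) = 0"
    by (simp add: integral_unique)
  then show ?thesis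
    using False by (subst integral_circle_cis[OF continuous_on_circle_powi]) (simp add: e)
qed

section \<open>Taylor coefficients, dilates and the Hardy norm\<close>

definition taylor_coeff :: "(complex \<Rightarrow> complex) \<Rightarrow> nat \<Rightarrow> complex" where
  "taylor_coeff f n = (deriv ^^ n) f 0 / fact n"

lemma taylor_coeff_0 [simp]: "taylor_coeff f 0 = f 0"
  by (simp add: taylor_coeff_def)

lemma taylor_coeff_deriv: "taylor_coeff (deriv f) n = of_nat (Suc n) * taylor_coeff f (Suc n)"
  by (simp add: taylor_coeff_def funpow_Suc_right del: funpow.simps of_nat_Suc)

lemma taylor_sums:
  assumes "f holomorphic_on unit_disk" "norm z < 1"
  shows "(\<lambda>n. taylor_coeff f n * z ^ n) sums f z"
  using holomorphic_power_series[OF assms(1), of z] assms(2)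
  by (simp add: taylor_coeff_def dist_norm)

lemma taylor_abs_summable:
  assumes "f holomorphic_on unit_disk" "0 \<le> r" "r < 1"
  shows "summable (\<lambda>n. norm (taylor_coeff f n * of_real r ^ n))"
proof -
  \<comment> \<open>Convergence at a radius strictly between \<open>r\<close> and 1 yields absolute
    convergence at \<open>r\<close>.\<close>
  have "summable (\<lambda>n. taylor_coeff f n * (of_real ((1 + r) / 2)) ^ n)"
    using taylor_sums[OF assms(1), of "of_real ((1 + r) / 2)"] assms
    by (auto simp: sums_iff simp del: of_real_add of_real_divide)
  then show ?thesis
    by (rule powser_insidea) (use assms in \<open>auto simp del: of_real_add of_real_divide\<close>)
qed

text \<open>As \<open>g\<close> is merely integrable, this one interchange serves for Fourier
  coefficients, for Parseval's identity and for the Schwarz integral of an L^2 function. The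
  dominating series is \<open>norm (a n)\<close> times the L^1 norm of \<open>g\<close>.\<close>

lemma circle_integral_series:
  fixes g :: "complex \<Rightarrow> complex"
  assumes a: "summable (\<lambda>n. norm (a n))" and g: "integrable circle_measure g"
  shows "(\<lambda>n. a n * (\<integral>\<xi>. \<xi> ^ n * g \<xi> \<partial>circle_measure)) sums
         (\<integral>\<xi>. (\<Sum>n. a n * \<xi> ^ n) * g \<xi> \<partial>circle_measure)"
proof -
  have m: "(\<lambda>\<xi>::complex. \<xi> ^ n) \<in> borel_measurable circle_measure" for n
    by (intro borel_measurable_circle_continuous continuous_intros)
  have i0: "integrable circle_measure (\<lambda>\<xi>. \<xi> ^ n * g \<xi>)" for n
    by (rule Bochner_Integration.integrable_bound[OF g])
       (use m g in \<open>auto intro!: AE_I2 simp: norm_mult norm_power borel_measurable_integrable\<close>)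
  have i: "integrable circle_measure (\<lambda>\<xi>. a n * \<xi> ^ n * g \<xi>)" for n
    using i0[of n] by (simp add: mult.assoc)
  have norm_eq: "norm (a n * \<xi> ^ n * g \<xi>) = norm (a n) * norm (g \<xi>)" if "\<xi> \<in> unit_circle" for n \<xi>
    using that by (simp add: norm_mult norm_power)
  have "(\<integral>\<xi>. norm (a n * \<xi> ^ n * g \<xi>) \<partial>circle_measure) = norm (a n) * (\<integral>\<xi>. norm (g \<xi>) \<partial>circle_measure)" for n
    using norm_eq[of _ n]
    by (subst integral_mult_right_zero[symmetric], intro Bochner_Integration.integral_cong) auto
  then have s: "summable (\<lambda>n. \<integral>\<xi>. norm (a n * \<xi> ^ n * g \<xi>) \<partial>circle_measure)"
    using summable_mult2[OF a] by simp
  have ae: "AE \<xi> in circle_measure. summable (\<lambda>n. norm (a n * \<xi> ^ n * g \<xi>))"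
    by (rule AE_I2) (use norm_eq summable_mult2[OF a] in simp)
  have "(\<lambda>n. integral\<^sup>L circle_measure (\<lambda>\<xi>. a n * \<xi> ^ n * g \<xi>)) sums
        (\<integral>\<xi>. (\<Sum>n. a n * \<xi> ^ n * g \<xi>) \<partial>circle_measure)"
    by (rule sums_integral[OF i ae s])
  moreover have "(\<integral>\<xi>. (\<Sum>n. a n * \<xi> ^ n * g \<xi>) \<partial>circle_measure) =
      (\<integral>\<xi>. (\<Sum>n. a n * \<xi> ^ n) * g \<xi> \<partial>circle_measure)"
  proof (rule Bochner_Integration.integral_cong[OF refl])
    fix \<xi> assume "\<xi> \<in> space circle_measure"
    then have "summable (\<lambda>n. norm (a n * \<xi> ^ n))"
      using a by (simp add: norm_mult norm_power)
    then have "summable (\<lambda>n. a n * \<xi> ^ n)"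
      by (rule summable_norm_cancel)
    then show "(\<Sum>n. a n * \<xi> ^ n * g \<xi>) = (\<Sum>n. a n * \<xi> ^ n) * g \<xi>"
      by (rule suminf_mult2[symmetric])
  qed
  ultimately show ?thesis by (simp add: mult.assoc)
qed

lemma circle_powi_mult:
  assumes "\<xi> \<in> unit_circle"
  shows "\<xi> ^ n * cnj \<xi> ^ m = \<xi> powi (int n - int m)" "\<xi> ^ n * \<xi> ^ m = \<xi> powi (int n + int m)"
proof -
  have nz: "\<xi> \<noteq> 0" using assms by auto
  have "cnj \<xi> = inverse \<xi>"
    using complex_norm_square[of \<xi>] assms by (intro inverse_unique[symmetric]) simp
  then show "\<xi> ^ n * cnj \<xi> ^ m = \<xi> powi (int n - int m)"
    using nz by (simp add: power_int_diff field_simps power_mult_distrib[symmetric])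
  show "\<xi> ^ n * \<xi> ^ m = \<xi> powi (int n + int m)"
    using nz by (simp add: power_int_add)
qed

lemma integral_circle_power:
  "(\<integral>\<xi>. \<xi> ^ n * cnj \<xi> ^ m \<partial>circle_measure) = (if n = m then 1 else 0)"
  "(\<integral>\<xi>. \<xi> ^ n * \<xi> ^ m \<partial>circle_measure) = (if n = 0 \<and> m = 0 then 1 else 0)"
proof -
  have "(\<integral>\<xi>. \<xi> ^ n * cnj \<xi> ^ m \<partial>circle_measure) = (\<integral>\<xi>. \<xi> powi (int n - int m) \<partial>circle_measure)"
    by (rule Bochner_Integration.integral_cong) (auto simp: circle_powi_mult)
  then show "(\<integral>\<xi>. \<xi> ^ n * cnj \<xi> ^ m \<partial>circle_measure) = (if n = m then 1 else 0)"
    by (simp add: integral_circle_powi)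
  have "(\<integral>\<xi>. \<xi> ^ n * \<xi> ^ m \<partial>circle_measure) = (\<integral>\<xi>. \<xi> powi (int n + int m) \<partial>circle_measure)"
    by (rule Bochner_Integration.integral_cong) (auto simp: circle_powi_mult)
  then show "(\<integral>\<xi>. \<xi> ^ n * \<xi> ^ m \<partial>circle_measure) = (if n = 0 \<and> m = 0 then 1 else 0)"
    by (simp add: integral_circle_powi)
qed

lemma circle_series_coeff:
  assumes a: "summable (\<lambda>n. norm (a n))"
  shows "(\<integral>\<xi>. (\<Sum>n. a n * \<xi> ^ n) * cnj \<xi> ^ m \<partial>circle_measure) = a m"
    and "(\<integral>\<xi>. (\<Sum>n. a n * \<xi> ^ n) * \<xi> ^ m \<partial>circle_measure) = (if m = 0 then a 0 else 0)"
proof -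
  have "(\<lambda>n. a n * (if n = m then 1 else 0)) sums (\<integral>\<xi>. (\<Sum>n. a n * \<xi> ^ n) * cnj \<xi> ^ m \<partial>circle_measure)"
    unfolding integral_circle_power(1)[symmetric]
    by (rule circle_integral_series[OF a]) (intro integrable_circle_continuous continuous_intros)
  moreover have "(\<lambda>n. a n * (if n = m then 1 else 0)) sums a m"
    using sums_single[of m a] by (simp add: if_distrib cong: if_cong)
  ultimately show "(\<integral>\<xi>. (\<Sum>n. a n * \<xi> ^ n) * cnj \<xi> ^ m \<partial>circle_measure) = a m"
    by (rule sums_unique2)
  have "(\<lambda>n. a n * (if n = 0 \<and> m = 0 then 1 else 0)) sums (\<integral>\<xi>. (\<Sum>n. a n * \<xi> ^ n) * \<xi> ^ m \<partial>circle_measure)"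
    unfolding integral_circle_power(2)[symmetric]
    by (rule circle_integral_series[OF a]) (intro integrable_circle_continuous continuous_intros)
  moreover have "(\<lambda>n. a n * (if n = 0 \<and> m = 0 then 1 else 0)) sums (if m = 0 then a 0 else 0)"
    using sums_single[of 0 a] by (cases "m = 0") (simp_all add: if_distrib cong: if_cong)
  ultimately show "(\<integral>\<xi>. (\<Sum>n. a n * \<xi> ^ n) * \<xi> ^ m \<partial>circle_measure) = (if m = 0 then a 0 else 0)"
    by (rule sums_unique2)
qed

lemma continuous_on_circle_series:
  assumes a: "summable (\<lambda>n. norm (a n))"
  shows "continuous_on unit_circle (\<lambda>\<xi>::complex. \<Sum>n. a n * \<xi> ^ n)"
proof -
  have "uniform_limit unit_circle (\<lambda>n \<xi>. \<Sum>i<n. a i * \<xi> ^ i) (\<lambda>\<xi>::complex. \<Sum>n. a n * \<xi> ^ n) sequentially"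
    by (rule Weierstrass_m_test[where M = "\<lambda>n. norm (a n)"])
      (use a in \<open>auto simp: norm_mult norm_power\<close>)
  then show ?thesis
    by (rule uniform_limit_theorem[rotated]) (auto intro!: always_eventually continuous_intros)
qed

lemma circle_parseval:
  assumes a: "summable (\<lambda>n. norm (a n))" and b: "summable (\<lambda>n. norm (b n))"
  shows "(\<lambda>n. a n * cnj (b n)) sums
    (\<integral>\<xi>. (\<Sum>n. a n * \<xi> ^ n) * cnj (\<Sum>n. b n * \<xi> ^ n) \<partial>circle_measure)"
proof -
  have "(\<integral>\<xi>. \<xi> ^ n * cnj (\<Sum>n. b n * \<xi> ^ n) \<partial>circle_measure) = cnj (b n)" for n
  proof -
    have "(\<integral>\<xi>. \<xi> ^ n * cnj (\<Sum>n. b n * \<xi> ^ n) \<partial>circle_measure) =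
       (\<integral>\<xi>. cnj ((\<Sum>n. b n * \<xi> ^ n) * cnj \<xi> ^ n) \<partial>circle_measure)"
      by (simp add: mult.commute)
    also have "\<dots> = cnj (\<integral>\<xi>. (\<Sum>n. b n * \<xi> ^ n) * cnj \<xi> ^ n \<partial>circle_measure)"
      by (rule Bochner_Integration.integral_cnj)
    finally show ?thesis
      by (simp add: circle_series_coeff[OF b])
  qed
  then show ?thesis
    using circle_integral_series[OF a, of "\<lambda>\<xi>. cnj (\<Sum>n. b n * \<xi> ^ n)"]
    by (simp add: integrable_circle_continuous continuous_on_cnj continuous_on_circle_series[OF b])
qed

text \<open>Both series converge absolutely on the circle of radius 1/2 and have the same sum there,
  so their Fourier coefficients agree. The radius 3/4 provides the room for absolute
  convergence.\<close>

lemma taylor_coeff_unique: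
  assumes "\<And>z. norm z < 1 \<Longrightarrow> (\<lambda>n. c n * z ^ n) sums f z"
  shows "taylor_coeff f = c" "f holomorphic_on unit_disk"
proof -
  show hol: "f holomorphic_on unit_disk"
    by (rule power_series_holomorphic[of 0 1 c]) (use assms in simp)
  have "summable (\<lambda>n. c n * (of_real (3/4)) ^ n)"
    using assms[of "of_real (3/4)"] by (auto simp: sums_iff)
  then have c: "summable (\<lambda>n. norm (c n * (of_real (1/2)) ^ n))"
    by (rule powser_insidea) simp
  have t: "summable (\<lambda>n. norm (taylor_coeff f n * (of_real (1/2)) ^ n))"
    by (rule taylor_abs_summable[OF hol]) auto
  have "(\<Sum>n. taylor_coeff f n * (of_real (1/2)) ^ n * \<xi> ^ n) = (\<Sum>n. c n * (of_real (1/2)) ^ n * \<xi> ^ n)"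
    if "\<xi> \<in> unit_circle" for \<xi>
  proof -
    have "norm (of_real (1/2) * \<xi>) < 1" using that by (simp add: norm_mult)
    from taylor_sums[OF hol this] assms[OF this]
    show ?thesis by (simp only: sums_iff power_mult_distrib mult.assoc)
  qed
  then have "(\<integral>\<xi>. (\<Sum>n. taylor_coeff f n * (of_real (1/2)) ^ n * \<xi> ^ n) * cnj \<xi> ^ m \<partial>circle_measure) =
    (\<integral>\<xi>. (\<Sum>n. c n * (of_real (1/2)) ^ n * \<xi> ^ n) * cnj \<xi> ^ m \<partial>circle_measure)" for m
    by (intro Bochner_Integration.integral_cong) auto
  then show "taylor_coeff f = c"
    unfolding circle_series_coeff(1)[OF c] circle_series_coeff(1)[OF t] by (auto simp: fun_eq_iff)
qed

lemma dilate_series: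
  assumes "f holomorphic_on unit_disk" "0 \<le> r" "r < 1" "\<xi> \<in> unit_circle"
  shows "f (of_real r * \<xi>) = (\<Sum>n. (taylor_coeff f n * of_real r ^ n) * \<xi> ^ n)"
proof -
  have "norm (of_real r * \<xi>) < 1" using assms by (simp add: norm_mult)
  from taylor_sums[OF assms(1) this] show ?thesis
    by (simp add: sums_iff power_mult_distrib mult.assoc)
qed

lemma continuous_on_dilate:
  assumes "f holomorphic_on unit_disk" "0 \<le> r" "r < 1"
  shows "continuous_on unit_circle (\<lambda>\<xi>. f (of_real r * \<xi>))"
  by (rule continuous_on_eq[OF continuous_on_circle_series[OF taylor_abs_summable[OF assms]]])
    (simp add: dilate_series[OF assms])

lemma dilate_inner:
  assumes f: "f holomorphic_on unit_disk" and g: "g holomorphic_on unit_disk" and r: "0 \<le> r" "r < 1"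
  shows "(\<lambda>n. taylor_coeff f n * cnj (taylor_coeff g n) * of_real r ^ (2 * n)) sums
    (\<integral>\<xi>. f (of_real r * \<xi>) * cnj (g (of_real r * \<xi>)) \<partial>circle_measure)"
proof -
  have "(\<integral>\<xi>. f (of_real r * \<xi>) * cnj (g (of_real r * \<xi>)) \<partial>circle_measure) =
    (\<integral>\<xi>. (\<Sum>n. (taylor_coeff f n * of_real r ^ n) * \<xi> ^ n) *
          cnj (\<Sum>n. (taylor_coeff g n * of_real r ^ n) * \<xi> ^ n) \<partial>circle_measure)"
    by (rule Bochner_Integration.integral_cong) (simp_all add: dilate_series[OF f r] dilate_series[OF g r])
  then show ?thesis
    using circle_parseval[OF taylor_abs_summable[OF f r] taylor_abs_summable[OF g r]]
    by (simp add: mult_ac power_add mult_2_right)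
qed

lemma dilate_norm:
  assumes f: "f holomorphic_on unit_disk" and r: "0 \<le> r" "r < 1"
  shows "(\<lambda>n. (norm (taylor_coeff f n))\<^sup>2 * r ^ (2 * n)) sums
    (\<integral>\<xi>. (norm (f (of_real r * \<xi>)))\<^sup>2 \<partial>circle_measure)"
proof -
  have "(\<lambda>n. taylor_coeff f n * cnj (taylor_coeff f n) * of_real r ^ (2 * n)) sums
    (\<integral>\<xi>. of_real ((norm (f (of_real r * \<xi>)))\<^sup>2) \<partial>circle_measure)"
    using dilate_inner[OF f f r] by (simp add: complex_norm_square[symmetric] del: of_real_power)
  then have "(\<lambda>n. complex_of_real ((norm (taylor_coeff f n))\<^sup>2 * r ^ (2 * n))) sums
    of_real (\<integral>\<xi>. (norm (f (of_real r * \<xi>)))\<^sup>2 \<partial>circle_measure)"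
    by (simp add: complex_norm_square[symmetric] del: of_real_power) (simp add: of_real_power)
  then show ?thesis by (simp only: sums_of_real_iff)
qed

lemma integrable_dilate_norm:
  assumes f: "f holomorphic_on unit_disk" and r: "0 \<le> r" "r < 1"
  shows "integrable circle_measure (\<lambda>\<xi>. (norm (f (of_real r * \<xi>)))\<^sup>2)"
  by (rule integrable_circle_continuous[OF continuous_on_power[OF continuous_on_norm[OF continuous_on_dilate[OF assms]]]])

text \<open>The squared H^2 norm read off from the coefficients, which avoids boundary values of
  \<open>f\<close>. As \<open>suminf\<close> is unspecified for divergent series, summability is
  carried along as a separate fact.\<close>

definition coeff_norm_sq :: "(complex \<Rightarrow> complex) \<Rightarrow> real" where
  "coeff_norm_sq f = (\<Sum>n. (norm (taylor_coeff f n))\<^sup>2)"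

text \<open>A partial sum is the limit, as r tends to 1, of the same sum with factors r^(2n), and
  that one is at most the mean square over the circle of radius r.\<close>

lemma coeff_norm_sq_bound:
  assumes f: "f holomorphic_on unit_disk"
    and S: "\<And>r. 0 \<le> r \<Longrightarrow> r < 1 \<Longrightarrow> (\<integral>\<xi>. (norm (f (of_real r * \<xi>)))\<^sup>2 \<partial>circle_measure) \<le> S"
  shows "summable (\<lambda>n. (norm (taylor_coeff f n))\<^sup>2)" "coeff_norm_sq f \<le> S"
proof -
  have partial: "(\<Sum>n<N. (norm (taylor_coeff f n))\<^sup>2) \<le> S" for N
  proof (rule tendsto_upperbound)
    show "((\<lambda>r. \<Sum>n<N. (norm (taylor_coeff f n))\<^sup>2 * r ^ (2 * n)) \<longlongrightarrow> (\<Sum>n<N. (norm (taylor_coeff f n))\<^sup>2)) (at_left 1)"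
      by (auto intro!: tendsto_eq_intros)
    have "\<forall>\<^sub>F r::real in at_left 1. 0 \<le> r \<and> r < 1"
      by (auto simp: eventually_at_left_field intro!: exI[of _ 0])
    then show "\<forall>\<^sub>F r in at_left 1. (\<Sum>n<N. (norm (taylor_coeff f n))\<^sup>2 * r ^ (2 * n)) \<le> S"
    proof eventually_elim
      case (elim r)
      note s = dilate_norm[OF f, of r]
      have "(\<Sum>n<N. (norm (taylor_coeff f n))\<^sup>2 * r ^ (2 * n)) \<le>
        (\<integral>\<xi>. (norm (f (of_real r * \<xi>)))\<^sup>2 \<partial>circle_measure)"
        using elim s sum_le_suminf[of "\<lambda>n. (norm (taylor_coeff f n))\<^sup>2 * r ^ (2 * n)" "{..<N}"]
        by (auto simp: sums_iff)
      with S elim show ?case by fastforce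
    qed
  qed simp
  show s: "summable (\<lambda>n. (norm (taylor_coeff f n))\<^sup>2)"
    by (rule bounded_imp_summable[where B = S])
      (use partial in \<open>auto simp: lessThan_Suc_atMost[symmetric] simp del: sum.lessThan_Suc\<close>)
  show "coeff_norm_sq f \<le> S"
    unfolding coeff_norm_sq_def by (rule suminf_le_const[OF s partial])
qed

lemma dilate_norm_le:
  assumes f: "f holomorphic_on unit_disk" and s: "summable (\<lambda>n. (norm (taylor_coeff f n))\<^sup>2)"
    and r: "0 \<le> r" "r < 1"
  shows "(\<integral>\<xi>. (norm (f (of_real r * \<xi>)))\<^sup>2 \<partial>circle_measure) \<le> coeff_norm_sq f"
proof -
  have "(norm (taylor_coeff f n))\<^sup>2 * r ^ (2 * n) \<le> (norm (taylor_coeff f n))\<^sup>2" for n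
    using r by (intro mult_left_le power_le_one) auto
  then show ?thesis
    unfolding coeff_norm_sq_def using sums_le[OF _ dilate_norm[OF f r] summable_sums[OF s]] by simp
qed

lemma hardy_spaceD:
  assumes "f \<in> hardy_space"
  shows "f holomorphic_on unit_disk" "summable (\<lambda>n. (norm (taylor_coeff f n))\<^sup>2)"
proof -
  show f: "f holomorphic_on unit_disk" using assms by (simp add: hardy_space_def)
  let ?S = "SUP r\<in>{0..<1::real}. \<integral>\<^sup>+\<xi>. ennreal ((cmod (f (of_real r * \<xi>)))\<^sup>2) \<partial>circle_measure"
  have fin: "?S < \<infinity>" using assms by (simp add: hardy_space_def)
  have "(\<integral>\<xi>. (norm (f (of_real r * \<xi>)))\<^sup>2 \<partial>circle_measure) \<le> enn2real ?S" if r: "0 \<le> r" "r < 1" for r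
  proof -
    have "ennreal (\<integral>\<xi>. (norm (f (of_real r * \<xi>)))\<^sup>2 \<partial>circle_measure) =
       (\<integral>\<^sup>+\<xi>. ennreal ((cmod (f (of_real r * \<xi>)))\<^sup>2) \<partial>circle_measure)"
      by (rule nn_integral_eq_integral[symmetric]) (use integrable_dilate_norm[OF f r] in auto)
    also have "\<dots> \<le> ?S" by (rule SUP_upper) (use r in auto)
    finally have "enn2real (ennreal (\<integral>\<xi>. (norm (f (of_real r * \<xi>)))\<^sup>2 \<partial>circle_measure)) \<le> enn2real ?S"
      by (rule enn2real_mono) (use fin in simp)
    then show ?thesis by simp
  qed
  from coeff_norm_sq_bound(1)[OF f this] show "summable (\<lambda>n. (norm (taylor_coeff f n))\<^sup>2)" .
qed

lemma summable_mult_l2: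
  fixes a b :: "nat \<Rightarrow> complex"
  assumes "summable (\<lambda>n. (norm (a n))\<^sup>2)" "summable (\<lambda>n. (norm (b n))\<^sup>2)"
  shows "summable (\<lambda>n. norm (a n * cnj (b n)))"
proof (rule summable_comparison_test'[OF summable_add[OF assms]])
  show "norm (norm (a n * cnj (b n))) \<le> (norm (a n))\<^sup>2 + (norm (b n))\<^sup>2" for n
  proof -
    have "0 \<le> norm (a n) * norm (b n)" by simp
    with sum_squares_bound[of "norm (a n)" "norm (b n)"] have "norm (a n) * norm (b n) \<le> (norm (a n))\<^sup>2 + (norm (b n))\<^sup>2"
      by linarith
    then show ?thesis by (simp add: norm_mult)
  qed
qed

text \<open>Abel summation: Tannery's theorem, with the absolutely summable products of coefficients
  as majorant, exchanges the sum with the limit of the radii.\<close>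

lemma hardy_inner_eq:
  assumes "f \<in> hardy_space" "g \<in> hardy_space"
  shows "hardy_inner f g = (\<Sum>n. taylor_coeff f n * cnj (taylor_coeff g n))"
proof -
  note f = hardy_spaceD[OF assms(1)] and g = hardy_spaceD[OF assms(2)]
  let ?c = "\<lambda>n. taylor_coeff f n * cnj (taylor_coeff g n)"
  have s: "summable (\<lambda>n. norm (?c n))" by (rule summable_mult_l2[OF f(2) g(2)])
  have ev: "\<forall>\<^sub>F r::real in at_left 1. 0 \<le> r \<and> r < 1"
    by (auto simp: eventually_at_left_field intro!: exI[of _ 0])
  have "eventually (\<lambda>r. summable (\<lambda>n. norm (?c n * of_real r ^ (2 * n)))) (at_left 1) \<and>
      summable (\<lambda>n. norm (?c n)) \<and>
      ((\<lambda>r. \<Sum>n. ?c n * of_real r ^ (2 * n)) \<longlongrightarrow> suminf ?c) (at_left (1::real))"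
  proof (rule tannerys_theorem[where M = "\<lambda>n. norm (?c n)"])
    show "((\<lambda>r. ?c k * of_real r ^ (2 * k)) \<longlongrightarrow> ?c k) (at_left 1)" for k
      by (auto intro!: tendsto_eq_intros)
    have "\<forall>\<^sub>F (k, r) in at_top \<times>\<^sub>F at_left (1::real). 0 \<le> r \<and> r < 1"
      using eventually_prodI[OF always_eventually[of "\<lambda>_. True" at_top] ev] by (simp add: case_prod_unfold)
    then show "\<forall>\<^sub>F (k, r) in at_top \<times>\<^sub>F at_left (1::real). norm (?c k * of_real r ^ (2 * k)) \<le> norm (?c k)"
      by eventually_elim (auto simp: norm_mult norm_power intro!: mult_left_le power_le_one)
  qed (use s in auto)
  then have "((\<lambda>r. \<Sum>n. ?c n * of_real r ^ (2 * n)) \<longlongrightarrow> suminf ?c) (at_left (1::real))"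
    by blast
  moreover have "\<forall>\<^sub>F r in at_left 1. (\<Sum>n. ?c n * of_real r ^ (2 * n)) =
     (\<integral>\<xi>. f (of_real r * \<xi>) * cnj (g (of_real r * \<xi>)) \<partial>circle_measure)"
    using ev by eventually_elim (use dilate_inner[OF f(1) g(1)] in \<open>auto simp: sums_iff\<close>)
  ultimately have "((\<lambda>r. \<integral>\<xi>. f (of_real r * \<xi>) * cnj (g (of_real r * \<xi>)) \<partial>circle_measure) \<longlongrightarrow> suminf ?c) (at_left 1)"
    by (rule Lim_transform_eventually)
  then show ?thesis
    unfolding hardy_inner_def by (intro tendsto_Lim) auto
qed

text \<open>The shape of Cauchy-Schwarz used below. With \<open>c = 0\<close> it expresses
  orthogonality at a minimiser, and with small \<open>c\<close> approximate orthogonality at a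
  near-minimiser.\<close>

lemma nonneg_quadratic_imp_discriminant:
  fixes a b c :: real
  assumes "\<And>t. 0 \<le> c + 2 * t * a + t\<^sup>2 * b" "0 \<le> b"
  shows "a\<^sup>2 \<le> c * b"
proof (cases "b = 0")
  case True
  have "a = 0"
  proof (rule ccontr)
    assume "a \<noteq> 0"
    \<comment> \<open>This \<open>t\<close> makes \<open>c + 2 * t * a\<close> equal to -1.\<close>
    with assms(1)[of "- (c + 1) / (2 * a)"] True show False by (simp add: field_simps)
  qed
  with True show ?thesis by simp
next
  case False
  with assms(2) have b: "b > 0" by simp
  have "0 \<le> c - a\<^sup>2 / b"
    using assms(1)[of "- a / b"] b by (simp add: field_simps power2_eq_square)
  then show ?thesis using b by (simp add: field_simps)
qed

lemma space_disk_measure [simp]: "space disk_measure = unit_disk"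
  by (simp add: disk_measure_def)

lemma borel_measurable_disk_continuous:
  fixes f :: "complex \<Rightarrow> 'b::euclidean_space"
  assumes "continuous_on unit_disk f"
  shows "f \<in> borel_measurable disk_measure"
proof -
  have "f \<in> borel_measurable (lebesgue_on unit_disk)"
    by (rule continuous_imp_measurable_on_sets_lebesgue[OF assms]) simp
  then show ?thesis
    by (simp add: disk_measure_def cong: measurable_cong_sets)
qed

lemma borel_measurable_disk_deriv:
  assumes "f holomorphic_on unit_disk"
  shows "deriv f \<in> borel_measurable disk_measure"
  by (intro borel_measurable_disk_continuous holomorphic_on_imp_continuous_on holomorphic_deriv assms) simp

text \<open>Every coefficient is at most the norm, so a geometric series remains. The bound turns
  convergence in norm into locally uniform convergence.\<close>

lemma eval_bound:
  assumes f: "f holomorphic_on unit_disk" and s: "summable (\<lambda>n. (norm (taylor_coeff f n))\<^sup>2)"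
    and z: "norm z < 1"
  shows "norm (f z) \<le> sqrt (coeff_norm_sq f) / (1 - norm z)"
proof -
  have c: "norm (taylor_coeff f n) \<le> sqrt (coeff_norm_sq f)" for n
    using sum_le_suminf[OF s, of "{n}"] by (intro real_le_rsqrt) (auto simp: coeff_norm_sq_def)
  have g: "(\<lambda>n. sqrt (coeff_norm_sq f) * norm z ^ n) sums (sqrt (coeff_norm_sq f) * (1 / (1 - norm z)))"
    by (intro sums_mult geometric_sums) (use z in simp)
  have "norm (f z) = norm (\<Sum>n. taylor_coeff f n * z ^ n)"
    using taylor_sums[OF f z] by (simp add: sums_iff)
  also have "\<dots> \<le> (\<Sum>n. sqrt (coeff_norm_sq f) * norm z ^ n)"
    by (rule norm_suminf_le) (use c g in \<open>auto simp: norm_mult norm_power sums_iff intro: mult_right_mono\<close>)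
  finally show ?thesis using g by (simp add: sums_iff)
qed

subsection \<open>The reproducing kernel\<close>

locale dirichlet_weight =
  fixes \<omega> :: "complex \<Rightarrow> real"
  assumes weight: "weight \<omega>" and sub_hardy: "dirichlet_space \<omega> \<subseteq> hardy_space"
begin

abbreviation "\<D> \<equiv> dirichlet_space \<omega>"

definition wint :: "(complex \<Rightarrow> complex) \<Rightarrow> real" where
  "wint f = (\<integral>z. (norm (deriv f z))\<^sup>2 * \<omega> z \<partial>disk_measure)"

definition nsq :: "(complex \<Rightarrow> complex) \<Rightarrow> real" where
  "nsq f = coeff_norm_sq f + wint f"

abbreviation ip :: "(complex \<Rightarrow> complex) \<Rightarrow> (complex \<Rightarrow> complex) \<Rightarrow> complex" where
  "ip \<equiv> dirichlet_inner \<omega>"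

lemma weight_measurable [measurable]: "\<omega> \<in> borel_measurable disk_measure"
  and weight_nonneg: "norm z < 1 \<Longrightarrow> 0 \<le> \<omega> z"
  using weight by (auto simp: weight_def)

lemma D_hol: "f \<in> \<D> \<Longrightarrow> f holomorphic_on unit_disk"
  by (simp add: dirichlet_space_def)

lemma D_hardy: "f \<in> \<D> \<Longrightarrow> f \<in> hardy_space"
  using sub_hardy by blast

lemma D_coeff: "f \<in> \<D> \<Longrightarrow> summable (\<lambda>n. (norm (taylor_coeff f n))\<^sup>2)"
  by (rule hardy_spaceD(2)[OF D_hardy])

lemma deriv_measurable [measurable]: "f \<in> \<D> \<Longrightarrow> deriv f \<in> borel_measurable disk_measure"
  by (rule borel_measurable_disk_deriv[OF D_hol])

lemma D_integrable:
  assumes "f \<in> \<D>"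
  shows "integrable disk_measure (\<lambda>z. (norm (deriv f z))\<^sup>2 * \<omega> z)"
proof (rule integrableI_nonneg)
  show "(\<lambda>z. (norm (deriv f z))\<^sup>2 * \<omega> z) \<in> borel_measurable disk_measure"
    using assms by measurable
  show "AE z in disk_measure. 0 \<le> (norm (deriv f z))\<^sup>2 * \<omega> z"
    by (rule AE_I2) (simp add: weight_nonneg)
  show "(\<integral>\<^sup>+z. ennreal ((norm (deriv f z))\<^sup>2 * \<omega> z) \<partial>disk_measure) < \<infinity>"
    using assms by (simp add: dirichlet_space_def)
qed

lemma nn_wint:
  assumes "f \<in> \<D>"
  shows "(\<integral>\<^sup>+z. ennreal ((norm (deriv f z))\<^sup>2 * \<omega> z) \<partial>disk_measure) = ennreal (wint f)"
  unfolding wint_def by (rule nn_integral_eq_integral[OF D_integrable[OF assms]])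
    (rule AE_I2, simp add: weight_nonneg)

lemma D_I:
  assumes f: "f holomorphic_on unit_disk"
    and g: "integrable disk_measure g" "\<And>z. norm z < 1 \<Longrightarrow> (norm (deriv f z))\<^sup>2 * \<omega> z \<le> g z"
  shows "f \<in> \<D>"
proof -
  have "(\<integral>\<^sup>+z. ennreal ((norm (deriv f z))\<^sup>2 * \<omega> z) \<partial>disk_measure) \<le> (\<integral>\<^sup>+z. ennreal (norm (g z)) \<partial>disk_measure)"
    by (rule nn_integral_mono) (use g(2) in \<open>fastforce intro: ennreal_leI\<close>)
  also have "\<dots> < \<infinity>" using g(1) by (simp add: integrable_iff_bounded)
  finally show ?thesis using f by (simp add: dirichlet_space_def)
qed

lemma deriv_add_D:
  assumes "f \<in> \<D>" "g \<in> \<D>" "norm z < 1"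
  shows "deriv (\<lambda>z. f z + g z) z = deriv f z + deriv g z"
  using assms by (intro deriv_add holomorphic_on_imp_differentiable_at[OF D_hol]) auto

lemma deriv_scale_D:
  assumes "f \<in> \<D>" "norm z < 1"
  shows "deriv (\<lambda>z. c * f z) z = c * deriv f z"
  using assms by (intro deriv_cmult holomorphic_on_imp_differentiable_at[OF D_hol]) auto

lemma D_add [intro]:
  assumes "f \<in> \<D>" "g \<in> \<D>"
  shows "(\<lambda>z. f z + g z) \<in> \<D>"
proof (rule D_I)
  show "(\<lambda>z. f z + g z) holomorphic_on unit_disk"
    using assms by (intro holomorphic_on_add D_hol)
  show "integrable disk_measure (\<lambda>z. 2 * ((norm (deriv f z))\<^sup>2 * \<omega> z) + 2 * ((norm (deriv g z))\<^sup>2 * \<omega> z))"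
    using assms by (intro Bochner_Integration.integrable_add integrable_mult_right D_integrable)
  fix z :: complex assume z: "norm z < 1"
  have "(norm (deriv f z + deriv g z))\<^sup>2 \<le> (norm (deriv f z) + norm (deriv g z))\<^sup>2"
    by (intro power_mono norm_triangle_ineq) simp
  also have "\<dots> \<le> 2 * (norm (deriv f z))\<^sup>2 + 2 * (norm (deriv g z))\<^sup>2"
    using sum_squares_bound[of "norm (deriv f z)" "norm (deriv g z)"] by (simp add: power2_sum)
  finally show "(norm (deriv (\<lambda>z. f z + g z) z))\<^sup>2 * \<omega> z
      \<le> 2 * ((norm (deriv f z))\<^sup>2 * \<omega> z) + 2 * ((norm (deriv g z))\<^sup>2 * \<omega> z)"
    using mult_right_mono[OF _ weight_nonneg[OF z]] by (fastforce simp: deriv_add_D[OF assms z] algebra_simps)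
qed

lemma D_scale [intro]:
  assumes "f \<in> \<D>"
  shows "(\<lambda>z. c * f z) \<in> \<D>"
proof (rule D_I)
  show "(\<lambda>z. c * f z) holomorphic_on unit_disk"
    using assms by (intro holomorphic_intros D_hol)
  show "integrable disk_measure (\<lambda>z. (norm c)\<^sup>2 * ((norm (deriv f z))\<^sup>2 * \<omega> z))"
    using assms by (intro integrable_mult_right D_integrable)
qed (simp add: deriv_scale_D[OF assms] norm_mult power_mult_distrib)

lemma D_const [intro]: "(\<lambda>z. c) \<in> \<D>"
  by (rule D_I[where g = "\<lambda>_. 0"]) auto

lemma coeff_add_D:
  assumes "f \<in> \<D>" "g \<in> \<D>"
  shows "taylor_coeff (\<lambda>z. f z + g z) n = taylor_coeff f n + taylor_coeff g n"
proof -
  have "taylor_coeff (\<lambda>z. f z + g z) = (\<lambda>n. taylor_coeff f n + taylor_coeff g n)"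
    by (rule taylor_coeff_unique)
      (use sums_add[OF taylor_sums[OF D_hol[OF assms(1)]] taylor_sums[OF D_hol[OF assms(2)]]] in \<open>simp add: distrib_right\<close>)
  then show ?thesis by simp
qed

lemma coeff_scale_D:
  assumes "f \<in> \<D>"
  shows "taylor_coeff (\<lambda>z. c * f z) n = c * taylor_coeff f n"
proof -
  have "taylor_coeff (\<lambda>z. c * f z) = (\<lambda>n. c * taylor_coeff f n)"
    by (rule taylor_coeff_unique)
      (use sums_mult[OF taylor_sums[OF D_hol[OF assms]]] in \<open>simp add: mult.assoc\<close>)
  then show ?thesis by simp
qed

lemma D_mixed_integrable:
  assumes "f \<in> \<D>" "g \<in> \<D>"
  shows "integrable disk_measure (\<lambda>z. deriv f z * cnj (deriv g z) * of_real (\<omega> z))"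
proof (rule Bochner_Integration.integrable_bound)
  show "integrable disk_measure (\<lambda>z. (norm (deriv f z))\<^sup>2 * \<omega> z + (norm (deriv g z))\<^sup>2 * \<omega> z)"
    using assms by (intro Bochner_Integration.integrable_add D_integrable)
  have "(\<lambda>z. cnj (deriv g z)) \<in> borel_measurable disk_measure"
    by (rule measurable_compose[OF deriv_measurable[OF assms(2)] borel_measurable_continuous_onI])
      (intro continuous_intros)
  moreover have "(\<lambda>z. complex_of_real (\<omega> z)) \<in> borel_measurable disk_measure"
    by (rule measurable_compose[OF weight_measurable borel_measurable_continuous_onI])
      (intro continuous_intros)
  ultimately show "(\<lambda>z. deriv f z * cnj (deriv g z) * of_real (\<omega> z)) \<in> borel_measurable disk_measure"
    using deriv_measurable[OF assms(1)] by simp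
  show "AE z in disk_measure. norm (deriv f z * cnj (deriv g z) * of_real (\<omega> z)) \<le>
      norm ((norm (deriv f z))\<^sup>2 * \<omega> z + (norm (deriv g z))\<^sup>2 * \<omega> z)"
  proof (rule AE_I2)
    fix z assume "z \<in> space disk_measure"
    then have w: "0 \<le> \<omega> z" by (simp add: weight_nonneg)
    have "0 \<le> norm (deriv f z) * norm (deriv g z)" by simp
    with sum_squares_bound[of "norm (deriv f z)" "norm (deriv g z)"]
    have "norm (deriv f z) * norm (deriv g z) \<le> (norm (deriv f z))\<^sup>2 + (norm (deriv g z))\<^sup>2"
      by linarith
    from mult_right_mono[OF this w] show "norm (deriv f z * cnj (deriv g z) * of_real (\<omega> z)) \<le>
      norm ((norm (deriv f z))\<^sup>2 * \<omega> z + (norm (deriv g z))\<^sup>2 * \<omega> z)"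
      using w by (simp add: norm_mult algebra_simps)
  qed
qed

lemma ip_eq:
  assumes "f \<in> \<D>" "g \<in> \<D>"
  shows "ip f g = (\<Sum>n. taylor_coeff f n * cnj (taylor_coeff g n)) +
     (\<integral>z. deriv f z * cnj (deriv g z) * of_real (\<omega> z) \<partial>disk_measure)"
  by (simp add: dirichlet_inner_def hardy_inner_eq[OF D_hardy[OF assms(1)] D_hardy[OF assms(2)]])

lemma D_coeff_mixed:
  assumes "f \<in> \<D>" "g \<in> \<D>"
  shows "summable (\<lambda>n. taylor_coeff f n * cnj (taylor_coeff g n))"
  by (rule summable_norm_cancel[OF summable_mult_l2[OF D_coeff[OF assms(1)] D_coeff[OF assms(2)]]])

lemma ip_add_left:
  assumes "f \<in> \<D>" "g \<in> \<D>" "h \<in> \<D>"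
  shows "ip (\<lambda>z. f z + g z) h = ip f h + ip g h"
proof -
  have "(\<integral>z. deriv (\<lambda>z. f z + g z) z * cnj (deriv h z) * of_real (\<omega> z) \<partial>disk_measure) =
    (\<integral>z. deriv f z * cnj (deriv h z) * of_real (\<omega> z) + deriv g z * cnj (deriv h z) * of_real (\<omega> z) \<partial>disk_measure)"
    by (rule Bochner_Integration.integral_cong) (simp_all add: deriv_add_D assms algebra_simps)
  also have "\<dots> = (\<integral>z. deriv f z * cnj (deriv h z) * of_real (\<omega> z) \<partial>disk_measure) +
     (\<integral>z. deriv g z * cnj (deriv h z) * of_real (\<omega> z) \<partial>disk_measure)"
    by (intro Bochner_Integration.integral_add D_mixed_integrable assms)
  finally show ?thesis
    using suminf_add[OF D_coeff_mixed[OF assms(1,3)] D_coeff_mixed[OF assms(2,3)]]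
    by (simp add: ip_eq assms D_add coeff_add_D distrib_right)
qed

lemma ip_scale_left:
  assumes "f \<in> \<D>" "h \<in> \<D>"
  shows "ip (\<lambda>z. c * f z) h = c * ip f h"
proof -
  have "(\<integral>z. deriv (\<lambda>z. c * f z) z * cnj (deriv h z) * of_real (\<omega> z) \<partial>disk_measure) =
    (\<integral>z. c * (deriv f z * cnj (deriv h z) * of_real (\<omega> z)) \<partial>disk_measure)"
    by (rule Bochner_Integration.integral_cong) (simp_all add: deriv_scale_D assms)
  also have "\<dots> = c * (\<integral>z. deriv f z * cnj (deriv h z) * of_real (\<omega> z) \<partial>disk_measure)"
    by (rule integral_mult_right_zero)
  finally show ?thesis
    using suminf_mult[OF D_coeff_mixed[OF assms], of c]
    by (simp add: ip_eq assms D_scale coeff_scale_D distrib_left mult.assoc)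
qed

lemma ip_cnj:
  assumes "f \<in> \<D>" "g \<in> \<D>"
  shows "ip g f = cnj (ip f g)"
proof -
  have "(\<integral>z. deriv g z * cnj (deriv f z) * of_real (\<omega> z) \<partial>disk_measure) =
    (\<integral>z. cnj (deriv f z * cnj (deriv g z) * of_real (\<omega> z)) \<partial>disk_measure)"
    by (simp add: mult.commute)
  also have "\<dots> = cnj (\<integral>z. deriv f z * cnj (deriv g z) * of_real (\<omega> z) \<partial>disk_measure)"
    by (rule Bochner_Integration.integral_cnj)
  finally have 1: "(\<integral>z. deriv g z * cnj (deriv f z) * of_real (\<omega> z) \<partial>disk_measure) =
     cnj (\<integral>z. deriv f z * cnj (deriv g z) * of_real (\<omega> z) \<partial>disk_measure)" .
  have "(\<lambda>n. cnj (taylor_coeff f n * cnj (taylor_coeff g n))) sums cnj (\<Sum>n. taylor_coeff f n * cnj (taylor_coeff g n))"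
    by (rule sums_cnj[THEN iffD2]) (rule summable_sums[OF D_coeff_mixed[OF assms]])
  then have "(\<Sum>n. taylor_coeff g n * cnj (taylor_coeff f n)) = cnj (\<Sum>n. taylor_coeff f n * cnj (taylor_coeff g n))"
    by (simp add: sums_iff mult.commute)
  with 1 show ?thesis by (simp add: ip_eq assms)
qed

lemma wint_nonneg: "0 \<le> wint f"
  unfolding wint_def by (rule integral_nonneg_AE) (rule AE_I2, simp add: weight_nonneg)

lemma coeff_norm_sq_nonneg: "f \<in> \<D> \<Longrightarrow> 0 \<le> coeff_norm_sq f"
  unfolding coeff_norm_sq_def by (rule suminf_nonneg[OF D_coeff]) auto

lemma nsq_nonneg: "f \<in> \<D> \<Longrightarrow> 0 \<le> nsq f"
  by (simp add: nsq_def wint_nonneg coeff_norm_sq_nonneg)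

lemma ip_self:
  assumes "f \<in> \<D>"
  shows "ip f f = of_real (nsq f)"
proof -
  have "(\<Sum>n. taylor_coeff f n * cnj (taylor_coeff f n)) = of_real (coeff_norm_sq f)"
    using D_coeff[OF assms] unfolding coeff_norm_sq_def
    by (simp add: complex_norm_square[symmetric] suminf_of_real[symmetric] del: of_real_power)
  moreover have "(\<integral>z. deriv f z * cnj (deriv f z) * of_real (\<omega> z) \<partial>disk_measure) = of_real (wint f)"
    unfolding wint_def
    by (simp add: complex_norm_square[symmetric] integral_complex_of_real[symmetric] del: of_real_power)
  ultimately show ?thesis by (simp add: ip_eq assms nsq_def)
qed

lemma nsq_add_scale:
  assumes "f \<in> \<D>" "h \<in> \<D>"
  shows "nsq (\<lambda>z. f z + of_real t * h z) = nsq f + 2 * t * Re (ip h f) + t\<^sup>2 * nsq h"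
proof -
  let ?g = "\<lambda>z. of_real t * h z"
  have g: "?g \<in> \<D>" and s: "(\<lambda>z. f z + ?g z) \<in> \<D>" using assms by auto
  have 1: "ip (\<lambda>z. f z + ?g z) h' = ip f h' + of_real t * ip h h'" if "h' \<in> \<D>" for h'
    using assms g that by (simp add: ip_add_left ip_scale_left)
  have "ip (\<lambda>z. f z + ?g z) (\<lambda>z. f z + ?g z) = cnj (ip (\<lambda>z. f z + ?g z) f) + of_real t * cnj (ip (\<lambda>z. f z + ?g z) h)"
    using 1[OF s] ip_cnj[OF s assms(1)] ip_cnj[OF s assms(2)] by simp
  also have "\<dots> = cnj (ip f f + of_real t * ip h f) + of_real t * cnj (cnj (ip h f) + of_real t * ip h h)"
    using 1[OF assms(1)] 1[OF assms(2)] ip_cnj[OF assms(2,1)] by simp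
  finally have "Re (ip (\<lambda>z. f z + ?g z) (\<lambda>z. f z + ?g z)) =
     Re (ip f f) + 2 * t * Re (ip h f) + t\<^sup>2 * Re (ip h h)"
    by (simp add: algebra_simps power2_eq_square)
  then show ?thesis by (simp add: ip_self s assms)
qed

lemma coeff_norm_sq_le_nsq: "coeff_norm_sq f \<le> nsq f"
  by (simp add: nsq_def wint_nonneg)

lemma eval_bound_D:
  assumes "f \<in> \<D>" "norm z < 1"
  shows "norm (f z) \<le> sqrt (nsq f) / (1 - norm z)"
  using eval_bound[OF D_hol[OF assms(1)] D_coeff[OF assms(1)] assms(2)]
    divide_right_mono[OF real_sqrt_le_mono[OF coeff_norm_sq_le_nsq[of f]], of "1 - norm z"] assms(2)
  by simp


text \<open>The Riesz representation of \<open>f \<mapsto> f w\<close> is obtained by minimising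
  \<open>\<parallel>f\<parallel>\<^sup>2 - 2 Re (f w)\<close>: the parallelogram law makes a minimising sequence converge locally
  uniformly, and Fatou's lemma puts the limit into the space.\<close>

lemma ex_minimizer:
  assumes w: "norm w < 1"
  shows "\<exists>F\<in>\<D>. \<forall>h\<in>\<D>. nsq F - 2 * Re (F w) \<le> nsq h - 2 * Re (h w)"
proof -
  define \<Phi> where "\<Phi> f = nsq f - 2 * Re (f w)" for f :: "complex \<Rightarrow> complex"
  define M where "M = 1 / (1 - norm w)"
  \<comment> \<open>The square of \<open>sqrt (nsq f) - M\<close> is nonnegative, where
    \<open>M\<close> bounds evaluation at \<open>w\<close> relative to the norm.\<close>
  have lower: "- (M\<^sup>2) \<le> \<Phi> f" if "f \<in> \<D>" for f
  proof -
    have "Re (f w) \<le> sqrt (nsq f) * M"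
      using eval_bound_D[OF that w] complex_Re_le_cmod[of "f w"] by (simp add: M_def)
    moreover have "0 \<le> (sqrt (nsq f) - M)\<^sup>2" by simp
    then have "2 * (sqrt (nsq f) * M) \<le> nsq f + M\<^sup>2"
      using nsq_nonneg[OF that] by (simp add: power2_diff)
    ultimately show ?thesis by (simp add: \<Phi>_def)
  qed
  define I where "I = Inf (\<Phi> ` \<D>)"
  have bdd: "bdd_below (\<Phi> ` \<D>)" using lower by (auto intro!: bdd_belowI2[where m = "- (M\<^sup>2)"])
  have ne: "\<D> \<noteq> {}" using D_const by blast
  have I: "I \<le> \<Phi> f" if "f \<in> \<D>" for f
    unfolding I_def using that bdd by (simp add: cInf_lower)
  define e :: "nat \<Rightarrow> real" where "e n = inverse (of_nat (Suc n))" for n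
  have "\<exists>f\<in>\<D>. \<Phi> f < I + e n" for n
  proof -
    have "Inf (\<Phi> ` \<D>) < I + e n"
      by (simp add: I_def e_def)
    from cInf_lessD[OF _ this] ne show ?thesis by auto
  qed
  then obtain f where f: "\<And>n. f n \<in> \<D>" and fI: "\<And>n. \<Phi> (f n) < I + e n"
    by metis
  \<comment> \<open>The value of \<Phi> at the midpoint of \<open>f n\<close> and \<open>f m\<close>
    is at least \<open>I\<close>; the parallelogram law then bounds the squared distance by twice
    the sum of the two excesses.\<close>
  have diff: "nsq (\<lambda>z. f n z + of_real (-1) * f m z) \<le> 2 * (e n + e m)" for n m
  proof -
    let ?s = "\<lambda>z. of_real (1/2) * (f n z + of_real 1 * f m z)"
    have s0: "(\<lambda>z. f n z + of_real 1 * f m z) \<in> \<D>" using f by auto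
    have s: "?s \<in> \<D>" by (rule D_scale[OF s0])
    have "nsq (\<lambda>z. 0 + of_real (1/2) * (f n z + of_real 1 * f m z)) = (1/4) * nsq (\<lambda>z. f n z + of_real 1 * f m z)"
    proof -
      have 0: "(\<lambda>z. 0) \<in> \<D>" by (rule D_const)
      have "ip (\<lambda>z. f n z + of_real 1 * f m z) (\<lambda>z. 0) = cnj (ip (\<lambda>z. 0 * 0) (\<lambda>z. f n z + of_real 1 * f m z))"
        using ip_cnj[OF 0 s0] by simp
      also have "\<dots> = 0"
        using ip_scale_left[OF 0 s0, of 0] by simp
      finally have "ip (\<lambda>z. f n z + of_real 1 * f m z) (\<lambda>z. 0) = 0" .
      moreover have "complex_of_real (nsq (\<lambda>z. 0)) = 0"
        using ip_self[OF 0] ip_scale_left[OF 0 0, of 0] by simp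
      ultimately show ?thesis
        using nsq_add_scale[OF 0 s0, of "1/2"] by (simp add: power2_eq_square)
    qed
    then have "\<Phi> ?s = (1/4) * nsq (\<lambda>z. f n z + of_real 1 * f m z) - Re (f n w) - Re (f m w)"
      by (simp add: \<Phi>_def algebra_simps)
    with I[OF s] have "I \<le> (1/4) * nsq (\<lambda>z. f n z + of_real 1 * f m z) - Re (f n w) - Re (f m w)" by simp
    then have "4 * I \<le> nsq (f n) + 2 * Re (ip (f m) (f n)) + nsq (f m) - 4 * Re (f n w) - 4 * Re (f m w)"
      using nsq_add_scale[OF f[of n] f[of m], of 1] by (simp add: field_simps)
    moreover have "nsq (f n) < I + e n + 2 * Re (f n w)" "nsq (f m) < I + e m + 2 * Re (f m w)"
      using fI[of n] fI[of m] by (simp_all add: \<Phi>_def)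
    ultimately show ?thesis
      using nsq_add_scale[OF f[of n] f[of m], of "-1"] by simp
  qed
  have cauchy: "norm (f n z - f m z) \<le> sqrt (2 * (e n + e m)) / (1 - norm z)" if "norm z < 1" for n m z
  proof -
    have "(\<lambda>z. f n z + of_real (-1) * f m z) \<in> \<D>" by (intro D_add D_scale f)
    from eval_bound_D[OF this that]
    have "norm (f n z - f m z) \<le> sqrt (nsq (\<lambda>z. f n z + of_real (-1) * f m z)) / (1 - norm z)" by simp
    also have "\<dots> \<le> sqrt (2 * (e n + e m)) / (1 - norm z)"
      by (intro divide_right_mono real_sqrt_le_mono diff) (use that in simp)
    finally show ?thesis .
  qed
  have e0: "e \<longlonglongrightarrow> 0" unfolding e_def by (rule LIMSEQ_inverse_real_of_nat)
  have conv: "\<exists>l. (\<lambda>n. f n z) \<longlonglongrightarrow> l" if z: "norm z < 1" for z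
  proof -
    have "Cauchy (\<lambda>n. f n z)"
    proof (rule CauchyI)
      fix \<epsilon> :: real assume \<epsilon>: "0 < \<epsilon>"
      have "(\<lambda>n. sqrt (2 * (e n + e n)) / (1 - norm z)) \<longlonglongrightarrow> sqrt (2 * (0 + 0)) / (1 - norm z)"
        using z by (intro tendsto_intros e0) auto
      then have "\<forall>\<^sub>F n in sequentially. sqrt (2 * (e n + e n)) / (1 - norm z) < \<epsilon>"
        using \<epsilon> by (intro order_tendstoD(2)) auto
      then obtain N where N: "sqrt (2 * (e N + e N)) / (1 - norm z) < \<epsilon>"
        by (auto simp: eventually_sequentially)
      have "norm (f m z - f n z) < \<epsilon>" if "m \<ge> N" "n \<ge> N" for m n
      proof -
        have "e m \<le> e N" "e n \<le> e N" using that by (auto simp: e_def intro!: le_imp_inverse_le)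
        then have "sqrt (2 * (e m + e n)) / (1 - norm z) \<le> sqrt (2 * (e N + e N)) / (1 - norm z)"
          using z by (intro divide_right_mono real_sqrt_le_mono mult_left_mono add_mono) auto
        with cauchy[OF z, of m n] N show ?thesis by linarith
      qed
      then show "\<exists>M. \<forall>m\<ge>M. \<forall>n\<ge>M. norm (f m z - f n z) < \<epsilon>" by blast
    qed
    then show ?thesis by (simp add: Cauchy_convergent_iff convergent_def)
  qed
  define F where "F z = lim (\<lambda>n. f n z)" for z
  have F: "(\<lambda>n. f n z) \<longlonglongrightarrow> F z" if "norm z < 1" for z
    using conv[OF that] by (auto simp: F_def convergent_LIMSEQ_iff[symmetric] convergent_def)
  have rate: "norm (f n z - F z) \<le> sqrt (2 * e n) / (1 - norm z)" if z: "norm z < 1" for n z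
  proof (rule tendsto_le)
    show "(\<lambda>m. norm (f n z - f m z)) \<longlonglongrightarrow> norm (f n z - F z)"
      by (intro tendsto_intros F z)
    show "(\<lambda>m. sqrt (2 * (e n + e m)) / (1 - norm z)) \<longlonglongrightarrow> sqrt (2 * e n) / (1 - norm z)"
    proof -
      have "(\<lambda>m. sqrt (2 * (e n + e m)) / (1 - norm z)) \<longlonglongrightarrow> sqrt (2 * (e n + 0)) / (1 - norm z)"
        using z by (intro tendsto_intros e0) auto
      then show ?thesis by simp
    qed
  qed (use cauchy[OF z] in auto)
  have ulim: "uniform_limit (ball 0 \<rho>) f F sequentially" if \<rho>: "0 < \<rho>" "\<rho> < 1" for \<rho>
  proof (rule uniform_limitI)
    fix \<epsilon> :: real assume \<epsilon>: "0 < \<epsilon>"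
    have "(\<lambda>n. sqrt (2 * e n) / (1 - \<rho>)) \<longlonglongrightarrow> sqrt (2 * 0) / (1 - \<rho>)"
      using \<rho> by (intro tendsto_intros e0) auto
    then have "\<forall>\<^sub>F n in sequentially. sqrt (2 * e n) / (1 - \<rho>) < \<epsilon>"
      using \<epsilon> by (intro order_tendstoD(2)) auto
    then show "\<forall>\<^sub>F n in sequentially. \<forall>z\<in>ball 0 \<rho>. dist (f n z) (F z) < \<epsilon>"
    proof eventually_elim
      case (elim n)
      show ?case
      proof
        fix z :: complex assume z: "z \<in> ball 0 \<rho>"
        then have "norm z < 1" using \<rho> by simp
        from rate[OF this, of n]
        have "norm (f n z - F z) \<le> sqrt (2 * e n) / (1 - norm z)" .
        also have "\<dots> \<le> sqrt (2 * e n) / (1 - \<rho>)"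
          using z \<rho> by (intro divide_left_mono) (auto simp: e_def)
        finally show "dist (f n z) (F z) < \<epsilon>" using elim by (simp add: dist_norm)
      qed
    qed
  qed
  have derivs: "(\<lambda>n. (deriv ^^ j) (f n) z) \<longlonglongrightarrow> (deriv ^^ j) F z" if z: "norm z < 1" for j z
  proof -
    have "(norm z + 1) / 2 < 1" "0 < (norm z + 1) / 2" "norm z < (norm z + 1) / 2" using z by (auto intro: add_nonneg_pos)
    moreover have "f n holomorphic_on ball 0 ((norm z + 1) / 2)" for n
      by (rule holomorphic_on_subset[OF D_hol[OF f] subset_ball]) (use z in simp)
    ultimately show ?thesis
      by (intro higher_deriv_complex_uniform_limit[OF ulim[of "(norm z + 1) / 2"]] always_eventually allI)
        auto
  qed
  have F_hol: "F holomorphic_on unit_disk"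
  proof (rule holomorphic_uniform_sequence[where f = f])
    fix z :: complex assume "z \<in> unit_disk"
    then have z: "norm z < 1" by simp
    let ?d = "(1 - norm z) / 2"
    \<comment> \<open>Points within (1 - |z|) / 2 of z have modulus at most (1 + |z|) / 2, which is
      less than (|z| + 3) / 4 < 1; \<open>ulim\<close> speaks of balls about 0.\<close>
    have sub: "cball z ?d \<subseteq> ball 0 ((norm z + 3) / 4 )"
    proof
      fix y assume "y \<in> cball z ?d"
      then have "norm (y - z) \<le> ?d" by (simp add: dist_norm norm_minus_commute)
      with norm_triangle_ineq[of "y - z" z] z show "y \<in> ball 0 ((norm z + 3) / 4)"
        by (simp add: field_simps)
    qed
    have sub1: "ball (0::complex) ((norm z + 3) / 4 ) \<subseteq> unit_disk" using z by (intro subset_ball) simp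
    have "uniform_limit (cball z ?d) f F sequentially"
      by (rule uniform_limit_on_subset[OF ulim sub]) (use z in \<open>auto intro: add_nonneg_pos\<close>)
    then show "\<exists>d>0. cball z d \<subseteq> unit_disk \<and> uniform_limit (cball z d) f F sequentially"
      using z sub sub1 by (intro exI[of _ ?d]) auto
  qed (use D_hol[OF f] in auto)
  have coeffs: "(\<lambda>n. taylor_coeff (f n) j) \<longlonglongrightarrow> taylor_coeff F j" for j
    unfolding taylor_coeff_def by (intro tendsto_divide derivs tendsto_const) auto
  define L where "L = I + 2 * Re (F w)"
  have nsqL: "(\<lambda>n. nsq (f n)) \<longlonglongrightarrow> L"
  proof (rule tendsto_sandwich)
    show "\<forall>\<^sub>F n in sequentially. I + 2 * Re (f n w) \<le> nsq (f n)"
      using I[OF f] by (auto simp: \<Phi>_def algebra_simps)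
    show "\<forall>\<^sub>F n in sequentially. nsq (f n) \<le> I + e n + 2 * Re (f n w)"
      using fI by (auto simp: \<Phi>_def algebra_simps intro!: always_eventually less_imp_le)
    show "(\<lambda>n. I + 2 * Re (f n w)) \<longlonglongrightarrow> L"
      unfolding L_def by (intro tendsto_intros F w)
    have "(\<lambda>n. I + e n + 2 * Re (f n w)) \<longlonglongrightarrow> I + 0 + 2 * Re (F w)"
      by (intro tendsto_intros F w e0)
    then show "(\<lambda>n. I + e n + 2 * Re (f n w)) \<longlonglongrightarrow> L" by (simp add: L_def)
  qed
  \<comment> \<open>A finite partial sum of the coefficient norm is split off before Fatou's lemma
    is applied to the energy, so that both parts of the norm pass to the limit together. Only
    afterwards does N tend to infinity.\<close>
  define S where "S N g = (\<Sum>j<N. (norm (taylor_coeff g j))\<^sup>2)" for N and g :: "complex \<Rightarrow> complex"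
  have S_le: "S N (f n) \<le> coeff_norm_sq (f n)" for N n
    unfolding S_def coeff_norm_sq_def by (rule sum_le_suminf[OF D_coeff[OF f]]) auto
  have S_lim: "(\<lambda>n. nsq (f n) - S N (f n)) \<longlonglongrightarrow> L - S N F" for N
    unfolding S_def by (intro tendsto_intros nsqL coeffs)
  have wint_le: "wint (f n) \<le> nsq (f n) - S N (f n)" for N n
    using S_le[of N n] by (simp add: nsq_def)
  have LS: "0 \<le> L - S N F" for N
    by (rule tendsto_lowerbound[OF S_lim]) (use order_trans[OF S_le coeff_norm_sq_le_nsq] in auto)
  have fatou: "(\<integral>\<^sup>+z. ennreal ((norm (deriv F z))\<^sup>2 * \<omega> z) \<partial>disk_measure) \<le> ennreal (L - S N F)" for N
  proof -
    have "(\<integral>\<^sup>+z. ennreal ((norm (deriv F z))\<^sup>2 * \<omega> z) \<partial>disk_measure) =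
      (\<integral>\<^sup>+z. liminf (\<lambda>n. ennreal ((norm (deriv (f n) z))\<^sup>2 * \<omega> z)) \<partial>disk_measure)"
    proof (rule nn_integral_cong)
      fix z assume "z \<in> space disk_measure"
      then have z: "norm z < 1" by simp
      have "(\<lambda>n. ennreal ((norm (deriv (f n) z))\<^sup>2 * \<omega> z)) \<longlonglongrightarrow> ennreal ((norm (deriv F z))\<^sup>2 * \<omega> z)"
        using derivs[OF z, of 1] by (intro tendsto_ennrealI tendsto_intros) auto
      then show "ennreal ((norm (deriv F z))\<^sup>2 * \<omega> z) = liminf (\<lambda>n. ennreal ((norm (deriv (f n) z))\<^sup>2 * \<omega> z))"
        by (intro lim_imp_Liminf[symmetric]) auto
    qed
    also have "\<dots> \<le> liminf (\<lambda>n. \<integral>\<^sup>+z. ennreal ((norm (deriv (f n) z))\<^sup>2 * \<omega> z) \<partial>disk_measure)"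
      by (rule nn_integral_liminf) (use f in measurable)
    also have "\<dots> = liminf (\<lambda>n. ennreal (wint (f n)))"
      by (simp add: nn_wint[OF f])
    also have "\<dots> \<le> liminf (\<lambda>n. ennreal (nsq (f n) - S N (f n)))"
      by (rule Liminf_mono) (auto intro!: always_eventually ennreal_leI wint_le)
    also have "\<dots> = ennreal (L - S N F)"
      by (rule lim_imp_Liminf) (auto intro!: tendsto_ennrealI S_lim)
    finally show ?thesis .
  qed
  have FD: "F \<in> \<D>"
    using F_hol fatou[of 0] by (auto simp: dirichlet_space_def intro: le_less_trans)
  have W: "ennreal (wint F) \<le> ennreal (L - S N F)" for N
    using fatou[of N] by (simp add: nn_wint[OF FD])
  have "wint F \<le> L - S N F" for N
    using LS[of N] W[of N] by simp
  then have "S N F \<le> L - wint F" for N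
    by (simp add: algebra_simps)
  then have "coeff_norm_sq F \<le> L - wint F"
    unfolding coeff_norm_sq_def S_def by (intro suminf_le_const[OF D_coeff[OF FD]])
  then have "\<Phi> F \<le> I" by (simp add: \<Phi>_def nsq_def L_def)
  with I FD show ?thesis by (force simp: \<Phi>_def)
qed

text \<open>At the minimiser the linear term of the expansion in each direction \<open>h\<close>
  vanishes, by the discriminant lemma with constant term 0. This gives real parts; the direction
  \<open>- \<i> * h\<close> gives imaginary parts.\<close>

lemma ex_representer:
  assumes w: "norm w < 1"
  shows "\<exists>F\<in>\<D>. \<forall>h\<in>\<D>. ip h F = h w"
proof -
  obtain F where F: "F \<in> \<D>" and min: "\<And>h. h \<in> \<D> \<Longrightarrow> nsq F - 2 * Re (F w) \<le> nsq h - 2 * Re (h w)"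
    using ex_minimizer[OF w] by blast
  have re: "Re (ip h F) = Re (h w)" if h: "h \<in> \<D>" for h
  proof -
    have "(Re (ip h F) - Re (h w))\<^sup>2 \<le> 0 * nsq h"
    proof (rule nonneg_quadratic_imp_discriminant)
      fix t :: real
      have "(\<lambda>z. F z + of_real t * h z) \<in> \<D>" using F h by auto
      from min[OF this] show "0 \<le> 0 + 2 * t * (Re (ip h F) - Re (h w)) + t\<^sup>2 * nsq h"
        by (simp add: nsq_add_scale[OF F h] algebra_simps)
    qed (rule nsq_nonneg[OF h])
    then show ?thesis by simp
  qed
  have "ip h F = h w" if h: "h \<in> \<D>" for h
  proof -
    have "(\<lambda>z. - \<i> * h z) \<in> \<D>" by (rule D_scale[OF h])
    from re[OF this] have "Im (ip h F) = Im (h w)"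
      by (simp add: ip_scale_left[OF h F, of "-\<i>", simplified])
    with re[OF h] show ?thesis by (simp add: complex_eq_iff)
  qed
  with F show ?thesis by blast
qed

lemma is_dirichlet_kernel: "is_dirichlet_kernel \<omega> (dirichlet_kernel \<omega>)"
proof -
  have "\<forall>w. \<exists>F. norm w < 1 \<longrightarrow> F \<in> \<D> \<and> (\<forall>h\<in>\<D>. ip h F = h w)"
    using ex_representer by blast
  then obtain k where "\<And>w. norm w < 1 \<Longrightarrow> k w \<in> \<D> \<and> (\<forall>h\<in>\<D>. ip h (k w) = h w)"
    by metis
  then have "is_dirichlet_kernel \<omega> (\<lambda>z w. k w z)"
    by (simp add: is_dirichlet_kernel_def)
  then show ?thesis
    unfolding dirichlet_kernel_def by (rule someI[of "is_dirichlet_kernel \<omega>"])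
qed

end

subsection \<open>Harmonic functions as real parts\<close>

lemma integrable_circle_of_square:
  fixes g :: "complex \<Rightarrow> real"
  assumes "g \<in> borel_measurable circle_measure" "integrable circle_measure (\<lambda>\<xi>. (g \<xi>)\<^sup>2)"
  shows "integrable circle_measure g"
proof (rule Bochner_Integration.integrable_bound)
  show "integrable circle_measure (\<lambda>\<xi>. 1 + (g \<xi>)\<^sup>2)"
    using assms by (intro Bochner_Integration.integrable_add) auto
  show "AE \<xi> in circle_measure. norm (g \<xi>) \<le> norm (1 + (g \<xi>)\<^sup>2)"
  proof (rule AE_I2)
    fix \<xi>
    have "0 \<le> (\<bar>g \<xi>\<bar> - 1)\<^sup>2" by simp
    then show "norm (g \<xi>) \<le> norm (1 + (g \<xi>)\<^sup>2)" by (simp add: power2_diff)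
  qed
qed (rule assms)

text \<open>Mean value property of the square at the origin. It reduces integrals of (Re P)^2 to
  integrals of |P|^2.\<close>

lemma circle_series_sq:
  assumes a: "summable (\<lambda>n. norm (a n))"
  shows "(\<integral>\<xi>. (\<Sum>n. a n * \<xi> ^ n) * (\<Sum>n. a n * \<xi> ^ n) \<partial>circle_measure) = a 0 * a 0"
proof -
  have "(\<integral>\<xi>. \<xi> ^ n * (\<Sum>n. a n * \<xi> ^ n) \<partial>circle_measure) = (if n = 0 then a 0 else 0)" for n
    using circle_series_coeff(2)[OF a, of n] by (simp add: mult.commute)
  then have "(\<integral>\<xi>. (\<Sum>n. a n * \<xi> ^ n) * (\<Sum>n. a n * \<xi> ^ n) \<partial>circle_measure) =
      (\<Sum>n. a n * (if n = 0 then a 0 else 0))"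
    using circle_integral_series[OF a integrable_circle_continuous[OF continuous_on_circle_series[OF a]]]
    by (simp add: sums_iff)
  also have "\<dots> = a 0 * a 0"
    by (subst suminf_finite[of "{0}"]) auto
  finally show ?thesis .
qed

text \<open>Coefficients of (1 + w) / (1 - w), whose real part at w = conj(z) \<xi> is the Poisson
  kernel.\<close>

definition schwarz_weight :: "nat \<Rightarrow> complex" where
  "schwarz_weight n = (if n = 0 then 1 else 2)"

text \<open>Since \<open>g\<close> is real, this is its n-th Fourier coefficient, doubled for n > 0.
  The conjugate stays outside the integral so that powers of \<xi> appear as in
  \<open>circle_integral_series\<close>.\<close>

definition schwarz_coeff :: "(complex \<Rightarrow> real) \<Rightarrow> nat \<Rightarrow> complex" where
  "schwarz_coeff g n = schwarz_weight n * cnj (\<integral>\<xi>. \<xi> ^ n * of_real (g \<xi>) \<partial>circle_measure)"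

text \<open>The holomorphic function on the disk whose real part is the Poisson extension of
  \<open>g\<close> and whose value at 0 is real.\<close>

definition schwarz :: "(complex \<Rightarrow> real) \<Rightarrow> complex \<Rightarrow> complex" where
  "schwarz g z = (\<Sum>n. schwarz_coeff g n * z ^ n)"

lemma schwarz_weight_sums:
  assumes "norm (w::complex) < 1"
  shows "(\<lambda>n. schwarz_weight n * w ^ n) sums ((1 + w) / (1 - w))" (is ?A)
    and "summable (\<lambda>n. norm (schwarz_weight n * w ^ n))" (is ?B)
proof -
  have nz: "1 - w \<noteq> 0" using assms by auto
  have "(\<lambda>n. 2 * w ^ n - (if n = 0 then 1 else 0)) sums (2 * (1 / (1 - w)) - 1)"
    using sums_single[of 0 "\<lambda>_. 1::complex"]
    by (intro sums_diff sums_mult geometric_sums assms) simp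
  moreover have "2 * (1 / (1 - w)) - 1 = (1 + w) / (1 - w)" using nz by (simp add: field_simps)
  moreover have "(\<lambda>n. 2 * w ^ n - (if n = 0 then 1 else 0)) = (\<lambda>n. schwarz_weight n * w ^ n)"
    by (auto simp: schwarz_weight_def fun_eq_iff)
  ultimately show ?A by simp
  show ?B
  proof (rule summable_comparison_test')
    show "summable (\<lambda>n. 2 * norm w ^ n)" using assms by (intro summable_mult summable_geometric) simp
    show "norm (norm (schwarz_weight n * w ^ n)) \<le> 2 * norm w ^ n" for n
      by (simp add: schwarz_weight_def norm_mult norm_power)
  qed
qed

lemma poisson_kernel_eq:
  assumes "norm \<xi> = 1" "norm z < 1"
  shows "(1 - (norm z)\<^sup>2) / (norm (\<xi> - z))\<^sup>2 = Re ((1 + cnj z * \<xi>) / (1 - cnj z * \<xi>))"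
proof -
  let ?w = "cnj z * \<xi>"
  have w: "norm ?w = norm z" using assms by (simp add: norm_mult)
  have "\<xi> * cnj (1 - ?w) = \<xi> - z * (\<xi> * cnj \<xi>)" by (simp add: algebra_simps)
  also have "\<xi> * cnj \<xi> = 1" using complex_norm_square[of \<xi>] assms by simp
  finally have "norm (\<xi> - z) = norm (\<xi> * cnj (1 - ?w))" by simp
  also have "\<dots> = norm (1 - ?w)" using assms by (simp only: norm_mult complex_mod_cnj mult_1_left)
  finally have n: "norm (\<xi> - z) = norm (1 - ?w)" .
  have "Re ((1 + ?w) / (1 - ?w)) = Re ((1 + ?w) * cnj (1 - ?w)) / (norm (1 - ?w))\<^sup>2"
    by (subst complex_div_cnj) (simp add: Re_divide_of_real[symmetric] del: of_real_power)
  also have "Re ((1 + ?w) * cnj (1 - ?w)) = 1 - (norm ?w)\<^sup>2"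
  proof -
    have "Re ((1 + w) * cnj (1 - w)) = 1 - (norm w)\<^sup>2" for w
      unfolding cmod_power2 by (simp add: algebra_simps power2_eq_square)
    then show ?thesis .
  qed
  finally show ?thesis using n w by simp
qed

context
  fixes g :: "complex \<Rightarrow> real"
  assumes gm: "g \<in> borel_measurable circle_measure"
    and g2: "integrable circle_measure (\<lambda>\<xi>. (g \<xi>)\<^sup>2)"
begin

lemma integrable_of_real_g: "integrable circle_measure (\<lambda>\<xi>. complex_of_real (g \<xi>))"
  by (rule integrable_of_real[OF integrable_circle_of_square[OF gm g2]])

lemma schwarz_integral:
  assumes z: "norm z < 1"
  shows "(\<lambda>n. schwarz_coeff g n * z ^ n) sums schwarz g z"
    and "poisson (\<lambda>\<xi>. of_real (g \<xi>)) z = of_real (Re (schwarz g z))"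
proof -
  let ?c = "\<lambda>n. \<integral>\<xi>. \<xi> ^ n * of_real (g \<xi>) \<partial>circle_measure"
  let ?I = "\<integral>\<xi>. (\<Sum>n. schwarz_weight n * cnj z ^ n * \<xi> ^ n) * of_real (g \<xi>) \<partial>circle_measure"
  have s: "(\<lambda>n. schwarz_weight n * cnj z ^ n * ?c n) sums ?I"
    by (rule circle_integral_series[OF schwarz_weight_sums(2) integrable_of_real_g]) (use z in simp)
  then have "(\<lambda>n. cnj (schwarz_weight n * cnj z ^ n * ?c n)) sums cnj ?I"
    by (simp add: sums_cnj del: complex_cnj_mult)
  moreover have "(\<lambda>n. cnj (schwarz_weight n * cnj z ^ n * ?c n)) = (\<lambda>n. schwarz_coeff g n * z ^ n)"
    by (auto simp: schwarz_coeff_def schwarz_weight_def fun_eq_iff)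
  ultimately have sums: "(\<lambda>n. schwarz_coeff g n * z ^ n) sums cnj ?I" by simp
  then show "(\<lambda>n. schwarz_coeff g n * z ^ n) sums schwarz g z"
    by (simp add: schwarz_def sums_iff)
  have S: "schwarz g z = cnj ?I" using sums by (simp add: schwarz_def sums_iff)
  have I: "?I = (\<integral>\<xi>. (1 + cnj z * \<xi>) / (1 - cnj z * \<xi>) * of_real (g \<xi>) \<partial>circle_measure)"
  proof (rule Bochner_Integration.integral_cong[OF refl])
    fix \<xi> assume "\<xi> \<in> space circle_measure"
    then have "norm (cnj z * \<xi>) < 1" using z by (simp add: norm_mult)
    from schwarz_weight_sums(1)[OF this]
    show "(\<Sum>n. schwarz_weight n * cnj z ^ n * \<xi> ^ n) * of_real (g \<xi>) =
      (1 + cnj z * \<xi>) / (1 - cnj z * \<xi>) * of_real (g \<xi>)"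
      by (simp add: sums_iff power_mult_distrib mult.assoc)
  qed
  have cont: "continuous_on unit_circle (\<lambda>\<xi>. (1 + cnj z * \<xi>) / (1 - cnj z * \<xi>))"
  proof (intro continuous_intros ballI)
    fix \<xi> :: complex assume "\<xi> \<in> unit_circle"
    then have "norm (cnj z * \<xi>) < 1" using z by (simp add: norm_mult)
    then show "1 - cnj z * \<xi> \<noteq> 0" by auto
  qed
  have "\<exists>B. \<forall>\<xi>\<in>unit_circle. norm ((1 + cnj z * \<xi>) / (1 - cnj z * \<xi>)) \<le> B"
    using compact_imp_bounded[OF compact_continuous_image[OF cont compact_sphere]]
    by (auto simp: bounded_iff)
  then obtain B where B: "\<And>\<xi>. \<xi> \<in> unit_circle \<Longrightarrow> norm ((1 + cnj z * \<xi>) / (1 - cnj z * \<xi>)) \<le> B" by blast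
  have int: "integrable circle_measure (\<lambda>\<xi>. (1 + cnj z * \<xi>) / (1 - cnj z * \<xi>) * of_real (g \<xi>))"
  proof (rule Bochner_Integration.integrable_bound)
    show "integrable circle_measure (\<lambda>\<xi>. B * g \<xi>)"
      by (rule integrable_mult_right[OF integrable_circle_of_square[OF gm g2]])
    show "(\<lambda>\<xi>. (1 + cnj z * \<xi>) / (1 - cnj z * \<xi>) * of_real (g \<xi>)) \<in> borel_measurable circle_measure"
      by (intro borel_measurable_times borel_measurable_circle_continuous cont
          borel_measurable_integrable integrable_of_real_g)
    show "AE \<xi> in circle_measure. norm ((1 + cnj z * \<xi>) / (1 - cnj z * \<xi>) * of_real (g \<xi>)) \<le> norm (B * g \<xi>)"
    proof (rule AE_I2)
      fix \<xi> assume "\<xi> \<in> space circle_measure"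
      then have "norm ((1 + cnj z * \<xi>) / (1 - cnj z * \<xi>)) \<le> \<bar>B\<bar>" using B by fastforce
      then show "norm ((1 + cnj z * \<xi>) / (1 - cnj z * \<xi>) * of_real (g \<xi>)) \<le> norm (B * g \<xi>)"
        unfolding norm_mult real_norm_def abs_mult by (intro mult_mono) auto
    qed
  qed
  have "Re (schwarz g z) = (\<integral>\<xi>. Re ((1 + cnj z * \<xi>) / (1 - cnj z * \<xi>) * of_real (g \<xi>)) \<partial>circle_measure)"
    unfolding S I using integral_Re[OF int] by simp
  also have "\<dots> = (\<integral>\<xi>. ((1 - (cmod z)\<^sup>2) / (cmod (\<xi> - z))\<^sup>2) * g \<xi> \<partial>circle_measure)"
    by (rule Bochner_Integration.integral_cong) (use z in \<open>auto simp: poisson_kernel_eq simp del: times_divide_eq_left\<close>)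
  finally have "of_real (Re (schwarz g z)) =
     (\<integral>\<xi>. complex_of_real (((1 - (cmod z)\<^sup>2) / (cmod (\<xi> - z))\<^sup>2) * g \<xi>) \<partial>circle_measure)"
    by (simp only: integral_complex_of_real)
  then show "poisson (\<lambda>\<xi>. of_real (g \<xi>)) z = of_real (Re (schwarz g z))"
    unfolding poisson_def by simp
qed

lemma schwarz_hol: "schwarz g holomorphic_on unit_disk"
  and taylor_coeff_schwarz: "taylor_coeff (schwarz g) = schwarz_coeff g"
  using taylor_coeff_unique[of "schwarz_coeff g" "schwarz g"] schwarz_integral(1) by auto

lemma schwarz_0: "schwarz g 0 = of_real (\<integral>\<xi>. g \<xi> \<partial>circle_measure)"
  using fun_cong[OF taylor_coeff_schwarz, of 0] by (simp add: schwarz_coeff_def schwarz_weight_def)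

text \<open>Bessel's inequality for the real part of the truncated series \<open>P\<close>: the
  integrals of (Re P)^2 and of g Re P coincide, so expanding the nonnegative integral of (g - Re
  P)^2 gives the bound.\<close>

lemma schwarz_bessel:
  "summable (\<lambda>n. (norm (taylor_coeff (schwarz g) n))\<^sup>2)"
  "coeff_norm_sq (schwarz g) + (Re (schwarz g 0))\<^sup>2 \<le> 2 * (\<integral>\<xi>. (g \<xi>)\<^sup>2 \<partial>circle_measure)"
proof -
  define c where "c n = (\<integral>\<xi>. \<xi> ^ n * of_real (g \<xi>) \<partial>circle_measure)" for n
  define d where "d n = schwarz_coeff g n" for n
  have dc: "d n = schwarz_weight n * cnj (c n)" for n by (simp add: d_def c_def schwarz_coeff_def)
  let ?G = "\<integral>\<xi>. (g \<xi>)\<^sup>2 \<partial>circle_measure"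
  have d0: "d 0 = of_real (\<integral>\<xi>. g \<xi> \<partial>circle_measure)"
    using schwarz_0 taylor_coeff_schwarz by (metis d_def taylor_coeff_0)
  \<comment> \<open>The truncation must contain the constant term, which contributes
    \<open>(Re (d 0))\<^sup>2\<close> to both integrals.\<close>
  have partial: "(\<Sum>n<N. (norm (d n))\<^sup>2) \<le> 2 * ?G - (Re (d 0))\<^sup>2" if N: "N > 0" for N
  proof -
    define a where "a n = (if n < N then d n else 0)" for n
    have a: "summable (\<lambda>n. norm (a n))"
      by (rule summable_finite[of "{..<N}"]) (auto simp: a_def)
    define P where "P \<xi> = (\<Sum>n. a n * \<xi> ^ n)" for \<xi> :: complex
    have Pc: "continuous_on unit_circle P" unfolding P_def by (rule continuous_on_circle_series[OF a])
    have fin: "(\<Sum>n. h (a n) n) = (\<Sum>n<N. h (d n) n)" if "\<And>n. h 0 n = 0" for h :: "complex \<Rightarrow> nat \<Rightarrow> complex"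
      using that by (subst suminf_finite[of "{..<N}"]) (auto simp: a_def)
    have PP: "(\<integral>\<xi>. P \<xi> * cnj (P \<xi>) \<partial>circle_measure) = of_real (\<Sum>n<N. (norm (d n))\<^sup>2)"
      using circle_parseval[OF a a] fin[of "\<lambda>x n. x * cnj x"]
      by (simp add: sums_iff P_def complex_norm_square[symmetric] del: of_real_power)
    have P2: "(\<integral>\<xi>. P \<xi> * P \<xi> \<partial>circle_measure) = d 0 ^ 2"
      using circle_series_sq[OF a] N by (simp add: P_def a_def power2_eq_square)
    have Pg: "(\<integral>\<xi>. P \<xi> * of_real (g \<xi>) \<partial>circle_measure) = (\<Sum>n<N. d n * c n)"
      using circle_integral_series[OF a integrable_of_real_g] fin[of "\<lambda>x n. x * c n"]
      by (simp add: sums_iff P_def c_def)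
    have iP: "integrable circle_measure (\<lambda>\<xi>. (Re (P \<xi>))\<^sup>2)"
      by (intro integrable_circle_continuous continuous_intros Pc)
    obtain B where B: "\<And>\<xi>. \<xi> \<in> unit_circle \<Longrightarrow> norm (P \<xi>) \<le> B"
      using compact_imp_bounded[OF compact_continuous_image[OF Pc compact_sphere]]
      unfolding bounded_iff by blast
    have iPg': "integrable circle_measure (\<lambda>\<xi>. P \<xi> * of_real (g \<xi>))"
    proof (rule Bochner_Integration.integrable_bound)
      show "integrable circle_measure (\<lambda>\<xi>. B * g \<xi>)"
        by (rule integrable_mult_right[OF integrable_circle_of_square[OF gm g2]])
      show "(\<lambda>\<xi>. P \<xi> * of_real (g \<xi>)) \<in> borel_measurable circle_measure"
        by (intro borel_measurable_times borel_measurable_circle_continuous Pc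
            borel_measurable_integrable integrable_of_real_g)
      show "AE \<xi> in circle_measure. norm (P \<xi> * of_real (g \<xi>)) \<le> norm (B * g \<xi>)"
      proof (rule AE_I2)
        fix \<xi> assume "\<xi> \<in> space circle_measure"
        then have "norm (P \<xi>) \<le> \<bar>B\<bar>" using B by fastforce
        then show "norm (P \<xi> * of_real (g \<xi>)) \<le> norm (B * g \<xi>)"
          unfolding norm_mult real_norm_def abs_mult by (intro mult_mono) auto
      qed
    qed
    have iPg: "integrable circle_measure (\<lambda>\<xi>. Re (P \<xi>) * g \<xi>)"
      using integrable_Re[OF iPg'] by simp
    have T2: "(\<integral>\<xi>. (Re (P \<xi>))\<^sup>2 \<partial>circle_measure) = ((\<Sum>n<N. (norm (d n))\<^sup>2) + (Re (d 0))\<^sup>2) / 2"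
    proof -
      have i1: "integrable circle_measure (\<lambda>\<xi>. P \<xi> * cnj (P \<xi>))" "integrable circle_measure (\<lambda>\<xi>. P \<xi> * P \<xi>)"
        by (intro integrable_circle_continuous continuous_intros Pc)+
      have "(\<integral>\<xi>. (Re (P \<xi>))\<^sup>2 \<partial>circle_measure) = (\<integral>\<xi>. Re (P \<xi> * cnj (P \<xi>) + P \<xi> * P \<xi>) / 2 \<partial>circle_measure)"
        by (rule Bochner_Integration.integral_cong) (auto simp: power2_eq_square)
      also have "\<dots> = (\<integral>\<xi>. Re (P \<xi> * cnj (P \<xi>) + P \<xi> * P \<xi>) \<partial>circle_measure) / 2"
        by (rule integral_divide_zero)
      also have "(\<integral>\<xi>. Re (P \<xi> * cnj (P \<xi>) + P \<xi> * P \<xi>) \<partial>circle_measure) =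
         Re ((\<integral>\<xi>. P \<xi> * cnj (P \<xi>) \<partial>circle_measure) + (\<integral>\<xi>. P \<xi> * P \<xi> \<partial>circle_measure))"
        using integral_Re[OF Bochner_Integration.integrable_add[OF i1]] Bochner_Integration.integral_add[OF i1] by simp
      finally show ?thesis by (simp add: PP P2 d0 power2_eq_square)
    qed
    have Tg: "(\<integral>\<xi>. Re (P \<xi>) * g \<xi> \<partial>circle_measure) = ((\<Sum>n<N. (norm (d n))\<^sup>2) + (Re (d 0))\<^sup>2) / 2"
    proof -
      have "(\<integral>\<xi>. Re (P \<xi>) * g \<xi> \<partial>circle_measure) = Re (\<Sum>n<N. d n * c n)"
        using integral_Re[OF iPg'] Pg by simp
      also have "\<dots> = (\<Sum>n<N. ((norm (d n))\<^sup>2 + (if n = 0 then (Re (d 0))\<^sup>2 else 0)) / 2)"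
        unfolding Re_sum
      proof (rule sum.cong[OF refl])
        fix n
        have "Re (cnj (c n) * c n) = (norm (c n))\<^sup>2"
          unfolding cmod_power2 by (simp add: power2_eq_square)
        moreover have "norm (d 0) ^ 2 = (Re (d 0))\<^sup>2" using d0 by simp
        ultimately show "Re (d n * c n) = ((norm (d n))\<^sup>2 + (if n = 0 then (Re (d 0))\<^sup>2 else 0)) / 2"
          by (cases "n = 0") (auto simp: dc schwarz_weight_def norm_mult power2_eq_square)
      qed
      also have "\<dots> = ((\<Sum>n<N. (norm (d n))\<^sup>2) + (Re (d 0))\<^sup>2) / 2"
        using N by (simp add: sum_divide_distrib[symmetric] sum.distrib)
      finally show ?thesis .
    qed
    have "0 \<le> (\<integral>\<xi>. (g \<xi> - Re (P \<xi>))\<^sup>2 \<partial>circle_measure)" by simp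
    also have "\<dots> = (\<integral>\<xi>. (g \<xi>)\<^sup>2 - 2 * (Re (P \<xi>) * g \<xi>) + (Re (P \<xi>))\<^sup>2 \<partial>circle_measure)"
      by (rule Bochner_Integration.integral_cong) (auto simp: power2_diff)
    also have "\<dots> = ?G - 2 * (\<integral>\<xi>. Re (P \<xi>) * g \<xi> \<partial>circle_measure) + (\<integral>\<xi>. (Re (P \<xi>))\<^sup>2 \<partial>circle_measure)"
      using g2 iP iPg by simp
    finally show ?thesis unfolding T2 Tg by (simp add: field_simps)
  qed
  have partial': "(\<Sum>n<N. (norm (d n))\<^sup>2) \<le> 2 * ?G - (Re (d 0))\<^sup>2" for N
  proof -
    have "(\<Sum>n<N. (norm (d n))\<^sup>2) \<le> (\<Sum>n<Suc N. (norm (d n))\<^sup>2)" by simp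
    with partial[of "Suc N"] show ?thesis by linarith
  qed
  show s: "summable (\<lambda>n. (norm (taylor_coeff (schwarz g) n))\<^sup>2)"
    unfolding taylor_coeff_schwarz d_def[symmetric]
    by (rule bounded_imp_summable[where B = "2 * ?G - (Re (d 0))\<^sup>2"])
      (use partial' in \<open>auto simp: lessThan_Suc_atMost[symmetric] simp del: sum.lessThan_Suc\<close>)
  have "coeff_norm_sq (schwarz g) \<le> 2 * ?G - (Re (d 0))\<^sup>2"
    unfolding coeff_norm_sq_def
    by (rule suminf_le_const[OF s]) (use partial' in \<open>simp add: taylor_coeff_schwarz d_def\<close>)
  then show "coeff_norm_sq (schwarz g) + (Re (schwarz g 0))\<^sup>2 \<le> 2 * ?G"
    by (simp add: schwarz_0 d0)
qed

end

text \<open>Both Wirtinger derivatives of Re F have modulus |F'| / 2. This is the source of the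
  factor 1/2 in the energy part of \<open>N\<close>.\<close>

lemma grad_sq_Re:
  assumes F: "F holomorphic_on unit_disk" and u: "\<And>z. norm z < 1 \<Longrightarrow> u z = of_real (Re (F z))"
    and z: "norm z < 1"
  shows "grad_sq u z = (norm (deriv F z))\<^sup>2 / 2"
proof -
  have "(F has_field_derivative deriv F z) (at z)"
    using F z by (auto intro: holomorphic_derivI)
  then have "(F has_derivative (\<lambda>h. deriv F z * h)) (at z)"
    by (simp add: has_field_derivative_def)
  then have "((\<lambda>z. complex_of_real (Re (F z))) has_derivative (\<lambda>h. complex_of_real (Re (deriv F z * h)))) (at z)"
    by (intro derivative_intros)
  then have "(u has_derivative (\<lambda>h. complex_of_real (Re (deriv F z * h)))) (at z)"
    by (rule has_derivative_transform_within_open[of _ _ _ _ unit_disk]) (use z u in auto)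
  then have D: "frechet_derivative u (at z) = (\<lambda>h. complex_of_real (Re (deriv F z * h)))"
    by (rule frechet_derivative_at[symmetric])
  have "wirtinger u z = deriv F z / 2" "wirtinger_bar u z = cnj (deriv F z) / 2"
    by (simp_all add: wirtinger_def wirtinger_bar_def D complex_eq_iff)
  then show ?thesis by (simp only: grad_sq_def norm_divide power_divide complex_mod_cnj) simp
qed

lemma energy_eq:
  assumes "F holomorphic_on unit_disk" "\<And>z. norm z < 1 \<Longrightarrow> poisson f z = of_real (Re (F z))"
  shows "energy \<omega> f = (\<integral>\<^sup>+z. ennreal ((norm (deriv F z))\<^sup>2 / 2 * \<omega> z) \<partial>disk_measure)"
  unfolding energy_def by (rule nn_integral_cong) (subst grad_sq_Re[OF assms], auto)

text \<open>From (Re w)^2 = (|w|^2 + Re (w^2)) / 2 and the mean value property of H^2, whose value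
  at 0 is (Re H(0))^2 because H(0) is real.\<close>

lemma dilate_Re_sq:
  assumes H: "H holomorphic_on unit_disk" and H0: "Im (H 0) = 0" and r: "0 \<le> r" "r < 1"
  shows "(\<integral>\<xi>. (Re (H (of_real r * \<xi>)))\<^sup>2 \<partial>circle_measure) =
    ((\<integral>\<xi>. (norm (H (of_real r * \<xi>)))\<^sup>2 \<partial>circle_measure) + (Re (H 0))\<^sup>2) / 2"
proof -
  let ?h = "\<lambda>\<xi>. H (of_real r * \<xi>)"
  have c: "continuous_on unit_circle ?h" by (rule continuous_on_dilate[OF H r])
  have i: "integrable circle_measure (\<lambda>\<xi>. ?h \<xi> * ?h \<xi>)"
    by (intro integrable_circle_continuous continuous_intros c)
  have "(\<integral>\<xi>. ?h \<xi> * ?h \<xi> \<partial>circle_measure) = H 0 * H 0"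
    using circle_series_sq[OF taylor_abs_summable[OF H r]] dilate_series[OF H r]
    by (subst Bochner_Integration.integral_cong[OF refl]) (auto simp: )
  then have "(\<integral>\<xi>. Re (?h \<xi> * ?h \<xi>) \<partial>circle_measure) = (Re (H 0))\<^sup>2"
    using integral_Re[OF i] H0 by (simp add: power2_eq_square)
  moreover have "(\<integral>\<xi>. (Re (?h \<xi>))\<^sup>2 \<partial>circle_measure) =
     (\<integral>\<xi>. ((norm (?h \<xi>))\<^sup>2 + Re (?h \<xi> * ?h \<xi>)) / 2 \<partial>circle_measure)"
  proof (rule Bochner_Integration.integral_cong[OF refl])
    have "(Re w)\<^sup>2 = ((norm w)\<^sup>2 + Re (w * w)) / 2" for w
      unfolding cmod_power2 by (simp add: power2_eq_square)
    then show "(Re (?h \<xi>))\<^sup>2 = ((norm (?h \<xi>))\<^sup>2 + Re (?h \<xi> * ?h \<xi>)) / 2" for \<xi> .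
  qed
  ultimately show ?thesis
    using integrable_dilate_norm[OF H r] integrable_Re[OF i] by simp
qed

lemma schwarz_dilate:
  assumes H: "H holomorphic_on unit_disk" and H0: "Im (H 0) = 0" and r: "0 \<le> r" "r < 1"
    and z: "norm z < 1"
  shows "schwarz (\<lambda>\<xi>. Re (H (of_real r * \<xi>))) z = H (of_real r * z)"
proof -
  let ?h = "\<lambda>\<xi>. H (of_real r * \<xi>)"
  let ?a = "\<lambda>n. taylor_coeff H n * of_real r ^ n"
  have c: "continuous_on unit_circle ?h" by (rule continuous_on_dilate[OF H r])
  note a = taylor_abs_summable[OF H r]
  have "schwarz_coeff (\<lambda>\<xi>. Re (?h \<xi>)) n = ?a n" for n
  proof -
    have 1: "(\<integral>\<xi>. ?h \<xi> * \<xi> ^ n \<partial>circle_measure) = (if n = 0 then H 0 else 0)"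
      using circle_series_coeff(2)[OF a, of n] dilate_series[OF H r]
      by (subst Bochner_Integration.integral_cong[OF refl]) auto
    have "(\<integral>\<xi>. ?h \<xi> * cnj \<xi> ^ n \<partial>circle_measure) = ?a n"
      using circle_series_coeff(1)[OF a, of n] dilate_series[OF H r]
      by (subst Bochner_Integration.integral_cong[OF refl]) auto
    then have "cnj (\<integral>\<xi>. ?h \<xi> * cnj \<xi> ^ n \<partial>circle_measure) = cnj (?a n)" by simp
    then have 2: "(\<integral>\<xi>. cnj (?h \<xi>) * \<xi> ^ n \<partial>circle_measure) = cnj (?a n)"
      unfolding Bochner_Integration.integral_cnj[symmetric] by simp
    have "(\<integral>\<xi>. \<xi> ^ n * of_real (Re (?h \<xi>)) \<partial>circle_measure) =
      (\<integral>\<xi>. (?h \<xi> * \<xi> ^ n + cnj (?h \<xi>) * \<xi> ^ n) / 2 \<partial>circle_measure)"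
      by (rule Bochner_Integration.integral_cong) (simp_all add: complex_eq_iff)
    also have "\<dots> = ((if n = 0 then H 0 else 0) + cnj (?a n)) / 2"
      unfolding 1[symmetric] 2[symmetric] integral_divide_zero
      by (subst Bochner_Integration.integral_add)
        (intro integrable_circle_continuous continuous_intros c | rule refl)+
    finally show ?thesis
      using H0 by (auto simp: schwarz_coeff_def schwarz_weight_def complex_eq_iff)
  qed
  then have "schwarz (\<lambda>\<xi>. Re (?h \<xi>)) z = (\<Sum>n. taylor_coeff H n * (of_real r * z) ^ n)"
    by (simp add: schwarz_def power_mult_distrib mult.assoc)
  moreover have "norm (of_real r * z) < 1"
    using r z by (simp add: norm_mult) (metis abs_of_nonneg less_eq_real_def mult_le_one mult_less_le_imp_less norm_ge_zero mult_strict_mono' mult.right_neutral)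
  ultimately show ?thesis
    using taylor_sums[OF H] by (simp add: sums_iff)
qed

text \<open>Each dilate is compared with the undilated coefficients; (x - y)^2 \<le> 2 x^2 + 2 y^2
  then produces 4 A.\<close>

lemma dilate_diff_norm:
  assumes H: "H holomorphic_on unit_disk" and s: "summable (\<lambda>n. (norm (taylor_coeff H n))\<^sup>2)"
    and r: "0 \<le> r" "r < 1" and t: "0 \<le> t" "t < 1"
    and rb: "(\<Sum>n. (norm (taylor_coeff H n))\<^sup>2 * (1 - r ^ n)\<^sup>2) \<le> A"
    and tb: "(\<Sum>n. (norm (taylor_coeff H n))\<^sup>2 * (1 - t ^ n)\<^sup>2) \<le> A"
  shows "(\<integral>\<xi>. (norm (H (of_real r * \<xi>) - H (of_real t * \<xi>)))\<^sup>2 \<partial>circle_measure) \<le> 4 * A"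
proof -
  let ?a = "\<lambda>n. taylor_coeff H n * of_real r ^ n - taylor_coeff H n * of_real t ^ n"
  let ?u = "\<lambda>q::real. \<lambda>n. (norm (taylor_coeff H n))\<^sup>2 * (1 - q ^ n)\<^sup>2"
  note ar = taylor_abs_summable[OF H r] and at = taylor_abs_summable[OF H t]
  have a: "summable (\<lambda>n. norm (?a n))"
    by (rule summable_comparison_test'[OF summable_add[OF ar at]]) (auto intro: norm_triangle_ineq4)
  have us: "summable (?u q)" if "0 \<le> q" "q < 1" for q
  proof (rule summable_comparison_test'[OF s])
    fix n
    have "0 \<le> 1 - q ^ n" "1 - q ^ n \<le> 1" using that by (auto intro: power_le_one)
    then have "(1 - q ^ n)\<^sup>2 \<le> 1" by (simp add: power_le_one)
    then show "norm (?u q n) \<le> (norm (taylor_coeff H n))\<^sup>2" by (simp add: mult_left_le)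
  qed
  have "(\<Sum>n. ?a n * \<xi> ^ n) = H (of_real r * \<xi>) - H (of_real t * \<xi>)" if "\<xi> \<in> unit_circle" for \<xi>
  proof -
    have "summable (\<lambda>n. taylor_coeff H n * of_real q ^ n * \<xi> ^ n)" if "0 \<le> q" "q < 1" for q
    proof -
      have "norm (of_real q * \<xi>) < 1" using that \<open>\<xi> \<in> unit_circle\<close> by (simp add: norm_mult)
      from taylor_sums[OF H this] show ?thesis by (simp only: sums_iff power_mult_distrib mult.assoc)
    qed
    from suminf_diff[OF this[OF r] this[OF t]] show ?thesis
      by (simp add: dilate_series[OF H r that] dilate_series[OF H t that] left_diff_distrib)
  qed
  then have "(\<integral>\<xi>. of_real ((norm (H (of_real r * \<xi>) - H (of_real t * \<xi>)))\<^sup>2) \<partial>circle_measure) =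
    (\<integral>\<xi>. (\<Sum>n. ?a n * \<xi> ^ n) * cnj (\<Sum>n. ?a n * \<xi> ^ n) \<partial>circle_measure)"
    by (intro Bochner_Integration.integral_cong refl) (simp only: complex_norm_square space_circle_measure)
  with circle_parseval[OF a a]
  have "(\<lambda>n. ?a n * cnj (?a n)) sums
      complex_of_real (\<integral>\<xi>. (norm (H (of_real r * \<xi>) - H (of_real t * \<xi>)))\<^sup>2 \<partial>circle_measure)"
    by (simp only: integral_complex_of_real)
  then have sums: "(\<lambda>n. (norm (?a n))\<^sup>2) sums (\<integral>\<xi>. (norm (H (of_real r * \<xi>) - H (of_real t * \<xi>)))\<^sup>2 \<partial>circle_measure)"
    by (simp only: complex_norm_square[symmetric] sums_of_real_iff)
  have le: "(norm (?a n))\<^sup>2 \<le> 2 * ?u r n + 2 * ?u t n" for n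
  proof -
    have "norm (?a n) = norm (taylor_coeff H n) * \<bar>(1 - t ^ n) - (1 - r ^ n)\<bar>"
    proof -
      have "?a n = taylor_coeff H n * of_real ((1 - t ^ n) - (1 - r ^ n))"
        by (simp add: algebra_simps)
      then show ?thesis by (simp only: norm_mult norm_of_real)
    qed
    then have "(norm (?a n))\<^sup>2 = (norm (taylor_coeff H n))\<^sup>2 * ((1 - t ^ n) - (1 - r ^ n))\<^sup>2"
      by (simp only: power_mult_distrib power2_abs)
    also have "\<dots> \<le> (norm (taylor_coeff H n))\<^sup>2 * (2 * (1 - r ^ n)\<^sup>2 + 2 * (1 - t ^ n)\<^sup>2)"
    proof (rule mult_left_mono)
      have "((x::real) - y)\<^sup>2 \<le> 2 * y\<^sup>2 + 2 * x\<^sup>2" for x y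
        using zero_le_power2[of "x + y"] by (simp add: power2_sum power2_diff)
      then show "((1 - t ^ n) - (1 - r ^ n))\<^sup>2 \<le> 2 * (1 - r ^ n)\<^sup>2 + 2 * (1 - t ^ n)\<^sup>2" .
    qed simp
    finally show ?thesis by (simp add: algebra_simps)
  qed
  have "(\<integral>\<xi>. (norm (H (of_real r * \<xi>) - H (of_real t * \<xi>)))\<^sup>2 \<partial>circle_measure) \<le>
      2 * (\<Sum>n. ?u r n) + 2 * (\<Sum>n. ?u t n)"
    by (rule sums_le[OF le sums]) (intro sums_add sums_mult summable_sums us r t)
  with rb tb show ?thesis by linarith
qed

text \<open>Tannery's theorem with majorant |c_j|^2 sends the sum to 0. The condition on
  \<open>1 - r n\<close> is imposed separately because for a constant \<open>H\<close> the sum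
  vanishes at every radius.\<close>

lemma ex_radii:
  assumes H: "H holomorphic_on unit_disk" and s: "summable (\<lambda>n. (norm (taylor_coeff H n))\<^sup>2)"
  shows "\<exists>r. \<forall>n. 0 \<le> r n \<and> r n < 1 \<and> 1 - r n \<le> inverse (Suc n) \<and>
     (\<Sum>j. (norm (taylor_coeff H j))\<^sup>2 * (1 - r n ^ j)\<^sup>2) \<le> (1/4) ^ n"
proof -
  let ?u = "\<lambda>q::real. \<lambda>n. (norm (taylor_coeff H n))\<^sup>2 * (1 - q ^ n)\<^sup>2"
  have ev: "\<forall>\<^sub>F r::real in at_left 1. 0 \<le> r \<and> r < 1"
    by (auto simp: eventually_at_left_field intro!: exI[of _ 0])
  have "eventually (\<lambda>q. summable (\<lambda>n. norm (?u q n))) (at_left 1) \<and>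
      summable (\<lambda>n. norm (0::real)) \<and>
      ((\<lambda>q. \<Sum>n. ?u q n) \<longlongrightarrow> (\<Sum>n. 0)) (at_left (1::real))"
  proof (rule tannerys_theorem[where M = "\<lambda>n. (norm (taylor_coeff H n))\<^sup>2"])
    show "((\<lambda>q. ?u q k) \<longlongrightarrow> 0) (at_left 1)" for k
      by (auto intro!: tendsto_eq_intros)
    have "\<forall>\<^sub>F (k, r) in at_top \<times>\<^sub>F at_left (1::real). 0 \<le> r \<and> r < 1"
      using eventually_prodI[OF always_eventually[of "\<lambda>_. True" at_top] ev] by (simp add: case_prod_unfold)
    then show "\<forall>\<^sub>F (k, q) in at_top \<times>\<^sub>F at_left (1::real). norm (?u q k) \<le> (norm (taylor_coeff H k))\<^sup>2"
    proof eventually_elim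
      case (elim p)
      obtain k q where p: "p = (k, q)" by fastforce
      have "0 \<le> 1 - q ^ k" "1 - q ^ k \<le> 1" using elim p by (auto intro: power_le_one)
      then have "(1 - q ^ k)\<^sup>2 \<le> 1" by (simp add: power_le_one)
      then show ?case by (simp add: p mult_left_le)
    qed
  qed (use s in auto)
  then have lim: "((\<lambda>q. \<Sum>n. ?u q n) \<longlongrightarrow> 0) (at_left (1::real))" by simp
  have "\<exists>r. 0 \<le> r \<and> r < 1 \<and> 1 - r \<le> inverse (Suc n) \<and> (\<Sum>j. ?u r j) \<le> (1/4) ^ n" for n
  proof -
    have "\<forall>\<^sub>F q in at_left 1. (\<Sum>n. ?u q n) < (1/4) ^ n"
      by (rule order_tendstoD(2)[OF lim]) simp
    moreover have "\<forall>\<^sub>F r::real in at_left 1. 1 - r \<le> inverse (Suc n)"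
      using eventually_at_left_real[of "1 - inverse (Suc n)" 1] by (auto elim: eventually_mono)
    ultimately have "\<forall>\<^sub>F r in at_left 1. 0 \<le> r \<and> r < 1 \<and> 1 - r \<le> inverse (Suc n) \<and> (\<Sum>j. ?u r j) \<le> (1/4) ^ n"
      using ev by eventually_elim auto
    then show ?thesis
      by (rule eventually_happens'[rotated]) simp
  qed
  then show ?thesis by (intro choice allI)
qed

text \<open>Along radii with \<open>\<Sum>j. |c\<^sub>j|\<^sup>2 (1 - r\<^sub>n\<^sup>j)\<^sup>2 \<le> 4\<^sup>-\<^sup>n\<close> the increments of the dilates are summable
  almost everywhere, so Fatou's theorem on radial limits is not needed.\<close>

lemma ex_boundary_function:
  assumes H: "H holomorphic_on unit_disk" and s: "summable (\<lambda>n. (norm (taylor_coeff H n))\<^sup>2)"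
    and H0: "Im (H 0) = 0"
  obtains u :: "complex \<Rightarrow> real" and r :: "nat \<Rightarrow> real"
  where "u \<in> borel_measurable circle_measure" "integrable circle_measure (\<lambda>\<xi>. (u \<xi>)\<^sup>2)"
    "(\<integral>\<xi>. (u \<xi>)\<^sup>2 \<partial>circle_measure) \<le> (coeff_norm_sq H + (Re (H 0))\<^sup>2) / 2"
    "\<And>z. norm z < 1 \<Longrightarrow> poisson (\<lambda>\<xi>. of_real (u \<xi>)) z = of_real (Re (H z))"
    "\<And>n. 0 \<le> r n" "\<And>n. r n < 1" "r \<longlonglongrightarrow> 1"
    "AE \<xi> in circle_measure. (\<lambda>n. Re (H (of_real (r n) * \<xi>))) \<longlonglongrightarrow> u \<xi>"
proof -
  obtain r where r: "\<And>n. 0 \<le> r n" "\<And>n. r n < 1" "\<And>n. 1 - r n \<le> inverse (Suc n)"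
    and rs: "\<And>n. (\<Sum>j. (norm (taylor_coeff H j))\<^sup>2 * (1 - r n ^ j)\<^sup>2) \<le> (1/4) ^ n"
    using ex_radii[OF H s] by blast
  have r1: "r \<longlonglongrightarrow> 1"
  proof (rule tendsto_sandwich[of "\<lambda>n. 1 - inverse (of_nat (Suc n))" r _ "\<lambda>_. 1"])
    show "(\<lambda>n. 1 - inverse (of_nat (Suc n))) \<longlonglongrightarrow> (1::real)"
      using tendsto_diff[OF tendsto_const LIMSEQ_inverse_real_of_nat, of 1] by simp
  qed (use r in \<open>auto intro!: always_eventually less_imp_le simp: algebra_simps\<close>)
  define v where "v n \<xi> = Re (H (of_real (r n) * \<xi>))" for n \<xi>
  have vc: "continuous_on unit_circle (v n)" for n
    unfolding v_def by (intro continuous_intros continuous_on_dilate[OF H r(1,2)])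
  have vm [measurable]: "v n \<in> borel_measurable circle_measure" for n
    by (rule borel_measurable_circle_continuous[OF vc])
  define w where "w n \<xi> = \<bar>v (Suc n) \<xi> - v n \<xi>\<bar>" for n \<xi>
  have wc: "continuous_on unit_circle (w n)" for n
    unfolding w_def by (intro continuous_intros vc)
  have wi: "integrable circle_measure (w n)" for n
    by (rule integrable_circle_continuous[OF wc])
  have w_int: "(\<integral>\<xi>. w n \<xi> \<partial>circle_measure) \<le> 3 * (1/2) ^ n" for n
  proof -
    let ?D = "\<lambda>\<xi>. norm (H (of_real (r (Suc n)) * \<xi>) - H (of_real (r n) * \<xi>))"
    have Dc: "continuous_on unit_circle ?D"
      by (intro continuous_intros continuous_on_dilate[OF H r(1,2)])
    have D2: "(\<integral>\<xi>. (?D \<xi>)\<^sup>2 \<partial>circle_measure) \<le> 4 * (1/4) ^ n"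
    proof (rule dilate_diff_norm[OF H s r(1,2) r(1,2) _ rs])
      have "(1/4::real) ^ Suc n \<le> (1/4) ^ n" by simp
      with rs[of "Suc n"] show "(\<Sum>j. (norm (taylor_coeff H j))\<^sup>2 * (1 - r (Suc n) ^ j)\<^sup>2) \<le> (1/4) ^ n"
        by linarith
    qed
    have iD: "integrable circle_measure (\<lambda>\<xi>. (?D \<xi>)\<^sup>2)"
      by (intro integrable_circle_continuous continuous_intros Dc)
    \<comment> \<open>Inequality of the means with weight 2^n, balanced against the mean square
      bound 4 / 4^n: the integral of \<open>w n\<close> becomes at most (5/2) / 2^n.\<close>
    have "w n \<xi> \<le> (2 ^ n * (?D \<xi>)\<^sup>2 + (1/2) ^ n) / 2" for \<xi>
    proof -
      have "w n \<xi> \<le> ?D \<xi>"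
        unfolding w_def v_def minus_complex.sel(1)[symmetric] by (rule abs_Re_le_cmod)
      moreover have "?D \<xi> \<le> (2 ^ n * (?D \<xi>)\<^sup>2 + (1/2) ^ n) / 2"
      proof -
        have "0 \<le> (1/2) ^ n * (2 ^ n * ?D \<xi> - 1)\<^sup>2" by simp
        also have "\<dots> = ((1/2) ^ n * 2 ^ n) * (2 ^ n * (?D \<xi>)\<^sup>2) - 2 * (((1/2) ^ n * 2 ^ n) * ?D \<xi>) + (1/2) ^ n"
          by (simp only: power2_diff power2_eq_square) algebra
        also have "(1/2::real) ^ n * 2 ^ n = 1"
          by (simp add: power_mult_distrib[symmetric])
        finally show ?thesis by simp
      qed
      ultimately show ?thesis by linarith
    qed
    then have "(\<integral>\<xi>. w n \<xi> \<partial>circle_measure) \<le> (\<integral>\<xi>. (2 ^ n * (?D \<xi>)\<^sup>2 + (1/2) ^ n) / 2 \<partial>circle_measure)"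
      by (intro integral_mono wi) (use iD in auto)
    also have "\<dots> = (2 ^ n * (\<integral>\<xi>. (?D \<xi>)\<^sup>2 \<partial>circle_measure) + (1/2) ^ n) / 2"
      using iD by (simp add: measure_circle)
    also have "\<dots> \<le> (2 ^ n * (4 * (1/4) ^ n) + (1/2) ^ n) / 2"
      using D2 by (intro divide_right_mono add_right_mono mult_left_mono) auto
    also have "\<dots> \<le> 3 * (1/2) ^ n"
    proof -
      have "(2::real) ^ n * (1/4) ^ n = (1/2) ^ n" by (simp add: power_mult_distrib[symmetric])
      then show ?thesis by (simp add: field_simps)
    qed
    finally show ?thesis .
  qed
  have w0: "0 \<le> w n \<xi>" for n \<xi> by (simp add: w_def)
  have sum_int: "summable (\<lambda>n. \<integral>\<xi>. norm (w n \<xi>) \<partial>circle_measure)"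
  proof (rule summable_comparison_test')
    show "summable (\<lambda>n. 3 * (1/2::real) ^ n)" by (intro summable_mult summable_geometric) simp
    show "norm (\<integral>\<xi>. norm (w n \<xi>) \<partial>circle_measure) \<le> 3 * (1/2) ^ n" for n
    proof -
      have "0 \<le> (\<integral>\<xi>. w n \<xi> \<partial>circle_measure)"
        by (rule integral_nonneg_AE) (simp add: w0)
      with w_int[of n] show ?thesis by (simp add: w0)
    qed
  qed
  have "(\<integral>\<^sup>+\<xi>. (\<Sum>n. ennreal (w n \<xi>)) \<partial>circle_measure) = (\<Sum>n. \<integral>\<^sup>+\<xi>. ennreal (w n \<xi>) \<partial>circle_measure)"
    by (rule nn_integral_suminf) (use borel_measurable_circle_continuous[OF wc] in measurable)
  also have "\<dots> = (\<Sum>n. ennreal (\<integral>\<xi>. w n \<xi> \<partial>circle_measure))"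
    by (intro suminf_cong nn_integral_eq_integral wi) (use w0 in auto)
  also have "\<dots> = ennreal (\<Sum>n. \<integral>\<xi>. w n \<xi> \<partial>circle_measure)"
    by (rule suminf_ennreal_eq[OF _ summable_sums]) (use w0 sum_int in auto)
  finally have fin: "(\<integral>\<^sup>+\<xi>. (\<Sum>n. ennreal (w n \<xi>)) \<partial>circle_measure) \<noteq> \<infinity>" by simp
  have "AE \<xi> in circle_measure. (\<Sum>n. ennreal (w n \<xi>)) \<noteq> \<infinity>"
    by (rule nn_integral_PInf_AE[OF _ fin]) (use borel_measurable_circle_continuous[OF wc] in measurable)
  then have ae: "AE \<xi> in circle_measure. summable (\<lambda>n. w n \<xi>)"
    by eventually_elim (rule summable_suminf_not_top, use w0 in auto)
  \<comment> \<open>Where the limit fails to exist, \<open>lim\<close> has an unspecified value; by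
    \<open>vu\<close> this concerns a null set only.\<close>
  define u where "u \<xi> = lim (\<lambda>n. v n \<xi>)" for \<xi>
  have um [measurable]: "u \<in> borel_measurable circle_measure"
    unfolding u_def by measurable
  have v_tele: "v n \<xi> = v 0 \<xi> + (\<Sum>i<n. v (Suc i) \<xi> - v i \<xi>)" for n \<xi>
    using sum_lessThan_telescope[of "\<lambda>i. v i \<xi>" n] by simp
  have vu: "AE \<xi> in circle_measure. (\<lambda>n. v n \<xi>) \<longlonglongrightarrow> u \<xi>"
    using ae
  proof eventually_elim
    case (elim \<xi>)
    then have "summable (\<lambda>i. \<bar>v (Suc i) \<xi> - v i \<xi>\<bar>)"
      by (simp add: w_def)
    then have "summable (\<lambda>i. v (Suc i) \<xi> - v i \<xi>)"
      by (rule summable_rabs_cancel)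
    then have "(\<lambda>n. v 0 \<xi> + (\<Sum>i<n. v (Suc i) \<xi> - v i \<xi>)) \<longlonglongrightarrow> v 0 \<xi> + (\<Sum>i. v (Suc i) \<xi> - v i \<xi>)"
      by (intro tendsto_intros summable_LIMSEQ)
    then have "convergent (\<lambda>n. v n \<xi>)"
      unfolding v_tele[of _ \<xi>, symmetric] by (auto simp: convergent_def)
    then show ?case by (simp add: u_def convergent_LIMSEQ_iff)
  qed
  have W_int: "integrable circle_measure (\<lambda>\<xi>. \<Sum>n. w n \<xi>)"
    by (rule integrable_suminf[OF wi _ sum_int]) (use ae w0 in simp)
  have vW: "AE \<xi> in circle_measure. \<forall>n. \<bar>v n \<xi>\<bar> \<le> \<bar>v 0 \<xi>\<bar> + (\<Sum>n. w n \<xi>)"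
    using ae
  proof eventually_elim
    case (elim \<xi>)
    show ?case
    proof
      fix n
      have "\<bar>v n \<xi>\<bar> \<le> \<bar>v 0 \<xi>\<bar> + \<bar>\<Sum>i<n. v (Suc i) \<xi> - v i \<xi>\<bar>"
        by (subst v_tele) (rule abs_triangle_ineq)
      also have "\<bar>\<Sum>i<n. v (Suc i) \<xi> - v i \<xi>\<bar> \<le> (\<Sum>i<n. w i \<xi>)"
        unfolding w_def by (rule sum_abs)
      also have "(\<Sum>i<n. w i \<xi>) \<le> (\<Sum>n. w n \<xi>)"
        by (rule sum_le_suminf[OF elim]) (use w0 in auto)
      finally show "\<bar>v n \<xi>\<bar> \<le> \<bar>v 0 \<xi>\<bar> + (\<Sum>n. w n \<xi>)" by simp
    qed
  qed
  have v_sq: "(\<integral>\<xi>. (v n \<xi>)\<^sup>2 \<partial>circle_measure) \<le> (coeff_norm_sq H + (Re (H 0))\<^sup>2) / 2" for n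
    using dilate_norm_le[OF H s r(1,2), of n] dilate_Re_sq[OF H H0 r(1,2), of n] by (simp add: v_def)
  have cns0: "0 \<le> coeff_norm_sq H" unfolding coeff_norm_sq_def by (rule suminf_nonneg[OF s]) auto
  have "(\<integral>\<^sup>+\<xi>. ennreal ((u \<xi>)\<^sup>2) \<partial>circle_measure) =
      (\<integral>\<^sup>+\<xi>. liminf (\<lambda>n. ennreal ((v n \<xi>)\<^sup>2)) \<partial>circle_measure)"
  proof (rule nn_integral_cong_AE)
    show "AE \<xi> in circle_measure. ennreal ((u \<xi>)\<^sup>2) = liminf (\<lambda>n. ennreal ((v n \<xi>)\<^sup>2))"
      using vu by eventually_elim (rule lim_imp_Liminf[symmetric], auto intro!: tendsto_intros)
  qed
  also have "\<dots> \<le> liminf (\<lambda>n. \<integral>\<^sup>+\<xi>. ennreal ((v n \<xi>)\<^sup>2) \<partial>circle_measure)"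
    by (rule nn_integral_liminf) measurable
  also have "\<dots> \<le> liminf (\<lambda>n. ennreal ((coeff_norm_sq H + (Re (H 0))\<^sup>2) / 2))"
  proof (rule Liminf_mono, rule always_eventually, rule allI)
    fix n
    have "(\<integral>\<^sup>+\<xi>. ennreal ((v n \<xi>)\<^sup>2) \<partial>circle_measure) = ennreal (\<integral>\<xi>. (v n \<xi>)\<^sup>2 \<partial>circle_measure)"
      by (rule nn_integral_eq_integral) (auto intro!: integrable_circle_continuous continuous_intros vc)
    with v_sq[of n] show "(\<integral>\<^sup>+\<xi>. ennreal ((v n \<xi>)\<^sup>2) \<partial>circle_measure) \<le> ennreal ((coeff_norm_sq H + (Re (H 0))\<^sup>2) / 2)"
      by (simp add: ennreal_leI)
  qed
  finally have u2: "(\<integral>\<^sup>+\<xi>. ennreal ((u \<xi>)\<^sup>2) \<partial>circle_measure) \<le> ennreal ((coeff_norm_sq H + (Re (H 0))\<^sup>2) / 2)"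
    by (simp add: Liminf_const)
  have u2i: "integrable circle_measure (\<lambda>\<xi>. (u \<xi>)\<^sup>2)"
    by (rule integrableI_nonneg) (use u2 in \<open>auto intro: le_less_trans\<close>)
  have u2b: "(\<integral>\<xi>. (u \<xi>)\<^sup>2 \<partial>circle_measure) \<le> (coeff_norm_sq H + (Re (H 0))\<^sup>2) / 2"
    using u2 nn_integral_eq_integral[OF u2i] cns0 by simp
  \<comment> \<open>The Poisson integral of \<open>v n\<close> at z is Re H(r_n z), by
    \<open>schwarz_dilate\<close>. Dominated convergence, with the summed increments in the
    majorant, passes to the limit.\<close>
  have pu: "poisson (\<lambda>\<xi>. of_real (u \<xi>)) z = of_real (Re (H z))" if z: "norm z < 1" for z
  proof -
    let ?P = "\<lambda>\<xi>. (1 - (norm z)\<^sup>2) / (norm (\<xi> - z))\<^sup>2"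
    have Pc: "continuous_on unit_circle ?P" using z by (intro continuous_intros) auto
    obtain B where B: "\<And>\<xi>. \<xi> \<in> unit_circle \<Longrightarrow> norm (?P \<xi>) \<le> B"
      using compact_imp_bounded[OF compact_continuous_image[OF Pc compact_sphere]]
      unfolding bounded_iff by blast
    have Pm [measurable]: "?P \<in> borel_measurable circle_measure"
      by (rule borel_measurable_circle_continuous[OF Pc])
    have "(\<lambda>n. \<integral>\<xi>. ?P \<xi> * v n \<xi> \<partial>circle_measure) \<longlonglongrightarrow> (\<integral>\<xi>. ?P \<xi> * u \<xi> \<partial>circle_measure)"
    proof (rule integral_dominated_convergence[where w = "\<lambda>\<xi>. B * (\<bar>v 0 \<xi>\<bar> + (\<Sum>n. w n \<xi>))"])
      show "integrable circle_measure (\<lambda>\<xi>. B * (\<bar>v 0 \<xi>\<bar> + (\<Sum>n. w n \<xi>)))"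
        using W_int integrable_circle_continuous[OF vc, of 0] by auto
      show "AE \<xi> in circle_measure. (\<lambda>n. ?P \<xi> * v n \<xi>) \<longlonglongrightarrow> ?P \<xi> * u \<xi>"
        using vu by eventually_elim (intro tendsto_intros)
      show "AE \<xi> in circle_measure. norm (?P \<xi> * v n \<xi>) \<le> B * (\<bar>v 0 \<xi>\<bar> + (\<Sum>n. w n \<xi>))" for n
      proof -
        have "AE \<xi> in circle_measure. \<xi> \<in> unit_circle"
          using AE_space[of circle_measure] by simp
        then show ?thesis using vW
        proof eventually_elim
          case (elim \<xi>)
          have "norm (?P \<xi> * v n \<xi>) = norm (?P \<xi>) * \<bar>v n \<xi>\<bar>" by (simp only: real_norm_def abs_mult)
          also have "\<dots> \<le> B * (\<bar>v 0 \<xi>\<bar> + (\<Sum>n. w n \<xi>))"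
            using elim(1) elim(2) order_trans[OF norm_ge_zero B[OF elim(1)]]
            by (intro mult_mono B) auto
          finally show ?case .
        qed
      qed
    qed measurable
    then have 1: "(\<lambda>n. of_real (\<integral>\<xi>. ?P \<xi> * v n \<xi> \<partial>circle_measure)) \<longlonglongrightarrow> complex_of_real (\<integral>\<xi>. ?P \<xi> * u \<xi> \<partial>circle_measure)"
      by (rule tendsto_of_real)
    have poi: "poisson (\<lambda>\<xi>. of_real (g \<xi>)) z = complex_of_real (\<integral>\<xi>. ?P \<xi> * g \<xi> \<partial>circle_measure)" for g
      unfolding poisson_def by (simp only: of_real_mult[symmetric] integral_complex_of_real)
    have "poisson (\<lambda>\<xi>. of_real (v n \<xi>)) z = of_real (Re (H (of_real (r n) * z)))" for n
      unfolding v_def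
      by (subst schwarz_integral(2)[OF _ _ z])
        (use schwarz_dilate[OF H H0 r(1,2) z] vm[unfolded v_def] in
          \<open>auto intro!: integrable_circle_continuous continuous_intros vc[unfolded v_def]\<close>)
    then have 2: "(\<lambda>n. of_real (Re (H (of_real (r n) * z)))) \<longlonglongrightarrow> complex_of_real (\<integral>\<xi>. ?P \<xi> * u \<xi> \<partial>circle_measure)"
      using 1 poi by simp
    have "isCont H z" using continuous_on_interior[OF holomorphic_on_imp_continuous_on[OF H], of z] z by (simp add: interior_open)
    moreover have "(\<lambda>n. of_real (r n) * z) \<longlonglongrightarrow> of_real 1 * z"
      by (intro tendsto_intros r1)
    ultimately have "(\<lambda>n. H (of_real (r n) * z)) \<longlonglongrightarrow> H z"
      by (intro isCont_tendsto_compose[of _ H]) auto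
    then have "(\<lambda>n. complex_of_real (Re (H (of_real (r n) * z)))) \<longlonglongrightarrow> of_real (Re (H z))"
      by (intro tendsto_intros)
    from LIMSEQ_unique[OF 2 this] show ?thesis using poi by simp
  qed
  show thesis
    by (rule that[OF um u2i u2b pu r(1,2) r1]) (use vu in \<open>auto simp: v_def\<close>)
qed

section \<open>Order properties of the Poisson integral and the Douglas contraction\<close>

lemma poisson_of_real:
  "poisson (\<lambda>\<xi>. of_real (g \<xi>)) z =
    complex_of_real (\<integral>\<xi>. ((1 - (norm z)\<^sup>2) / (norm (\<xi> - z))\<^sup>2) * g \<xi> \<partial>circle_measure)"
  unfolding poisson_def by (simp only: of_real_mult[symmetric] integral_complex_of_real)

lemma Re_schwarz:
  assumes "g \<in> borel_measurable circle_measure" "integrable circle_measure (\<lambda>\<xi>. (g \<xi>)\<^sup>2)" "norm z < 1"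
  shows "Re (schwarz g z) = (\<integral>\<xi>. ((1 - (norm z)\<^sup>2) / (norm (\<xi> - z))\<^sup>2) * g \<xi> \<partial>circle_measure)"
  using schwarz_integral(2)[OF assms] by (simp only: poisson_of_real of_real_eq_iff)

lemma poisson_kernel_nonneg:
  assumes "norm (z::complex) < 1"
  shows "0 \<le> (1 - (norm z)\<^sup>2) / (norm (\<xi> - z))\<^sup>2"
  using assms by (simp add: power_le_one)

lemma poisson_kernel_integral:
  assumes "norm z < 1"
  shows "(\<integral>\<xi>. (1 - (norm z)\<^sup>2) / (norm (\<xi> - z))\<^sup>2 \<partial>circle_measure) = 1"
proof -
  have "schwarz (\<lambda>\<xi>. Re 1) z = 1"
    using schwarz_dilate[of "\<lambda>_. 1" 0 z] assms by simp
  with Re_schwarz[of "\<lambda>_. 1" z] assms show ?thesis by simp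
qed

lemma poisson_kernel_integrable:
  assumes "norm z < 1" "g \<in> borel_measurable circle_measure" "integrable circle_measure (\<lambda>\<xi>. (g \<xi>)\<^sup>2)"
  shows "integrable circle_measure (\<lambda>\<xi>. ((1 - (norm z)\<^sup>2) / (norm (\<xi> - z))\<^sup>2) * g \<xi>)"
proof -
  let ?P = "\<lambda>\<xi>. (1 - (norm z)\<^sup>2) / (norm (\<xi> - z))\<^sup>2"
  have Pc: "continuous_on unit_circle ?P" using assms(1) by (intro continuous_intros) auto
  obtain B where B: "\<And>\<xi>. \<xi> \<in> unit_circle \<Longrightarrow> norm (?P \<xi>) \<le> B"
    using compact_imp_bounded[OF compact_continuous_image[OF Pc compact_sphere]]
    unfolding bounded_iff by blast
  show ?thesis
  proof (rule Bochner_Integration.integrable_bound)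
    show "integrable circle_measure (\<lambda>\<xi>. B * g \<xi>)"
      by (rule integrable_mult_right[OF integrable_circle_of_square[OF assms(2,3)]])
    show "(\<lambda>\<xi>. ?P \<xi> * g \<xi>) \<in> borel_measurable circle_measure"
      using borel_measurable_circle_continuous[OF Pc] assms(2) by measurable
    show "AE \<xi> in circle_measure. norm (?P \<xi> * g \<xi>) \<le> norm (B * g \<xi>)"
    proof (rule AE_I2)
      fix \<xi> assume "\<xi> \<in> space circle_measure"
      then have "norm (?P \<xi>) \<le> \<bar>B\<bar>" using B[of \<xi>] by auto
      then show "norm (?P \<xi> * g \<xi>) \<le> norm (B * g \<xi>)"
        unfolding real_norm_def abs_mult by (intro mult_right_mono) auto
    qed
  qed
qed

lemma Re_schwarz_mono:
  assumes "g \<in> borel_measurable circle_measure" "integrable circle_measure (\<lambda>\<xi>. (g \<xi>)\<^sup>2)"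
    "h \<in> borel_measurable circle_measure" "integrable circle_measure (\<lambda>\<xi>. (h \<xi>)\<^sup>2)"
    "norm z < 1" "\<And>\<xi>. g \<xi> \<le> h \<xi>"
  shows "Re (schwarz g z) \<le> Re (schwarz h z)"
  unfolding Re_schwarz[OF assms(1,2,5)] Re_schwarz[OF assms(3,4,5)]
  by (intro integral_mono poisson_kernel_integrable assms mult_left_mono poisson_kernel_nonneg)

lemma Re_schwarz_nonneg:
  assumes "g \<in> borel_measurable circle_measure" "integrable circle_measure (\<lambda>\<xi>. (g \<xi>)\<^sup>2)"
    "norm z < 1" "\<And>\<xi>. 0 \<le> g \<xi>"
  shows "0 \<le> Re (schwarz g z)"
  unfolding Re_schwarz[OF assms(1-3)]
  by (intro integral_nonneg_AE AE_I2 mult_nonneg_nonneg poisson_kernel_nonneg assms)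

text \<open>The Douglas formula writes the energy in terms of differences of boundary values, so
  shrinking all differences lowers it. It is applied to \<open>\<bar>u \<xi>\<bar>\<close> and to
  \<open>min (cmod (f \<xi>)) 1\<close>.\<close>

lemma douglas_contraction:
  assumes "douglas_weight \<omega>" "f \<in> L2_circle" "h \<in> L2_circle"
    and "\<And>\<xi> \<eta>. norm (h \<xi> - h \<eta>) \<le> norm (f \<xi> - f \<eta>)"
  shows "energy \<omega> h \<le> energy \<omega> f"
proof -
  obtain J :: "(complex \<times> complex) measure"
    where J: "\<forall>f\<in>L2_circle. energy \<omega> f = (\<integral>\<^sup>+(\<zeta>, \<eta>). ennreal ((cmod (f \<zeta> - f \<eta>))\<^sup>2) \<partial>J)"
    using assms(1) by (auto simp: douglas_weight_def)
  show ?thesis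
    unfolding J[rule_format, OF assms(2)] J[rule_format, OF assms(3)]
    by (rule nn_integral_mono) (auto intro!: ennreal_leI power_mono assms(4))
qed

lemma L2_circle_of_real:
  assumes "g \<in> borel_measurable circle_measure" "integrable circle_measure (\<lambda>\<xi>. (g \<xi>)\<^sup>2)"
  shows "(\<lambda>\<xi>. complex_of_real (g \<xi>)) \<in> L2_circle"
    and "(\<integral>\<^sup>+\<xi>. ennreal ((cmod (complex_of_real (g \<xi>)))\<^sup>2) \<partial>circle_measure) =
      ennreal (\<integral>\<xi>. (g \<xi>)\<^sup>2 \<partial>circle_measure)"
proof -
  show 1: "(\<integral>\<^sup>+\<xi>. ennreal ((cmod (complex_of_real (g \<xi>)))\<^sup>2) \<partial>circle_measure) =
      ennreal (\<integral>\<xi>. (g \<xi>)\<^sup>2 \<partial>circle_measure)"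
    using nn_integral_eq_integral[OF assms(2)] by simp
  have "(\<lambda>\<xi>. complex_of_real (g \<xi>)) \<in> borel_measurable circle_measure"
    by (rule borel_measurable_integrable[OF integrable_of_real[OF integrable_circle_of_square[OF assms]]])
  with 1 show "(\<lambda>\<xi>. complex_of_real (g \<xi>)) \<in> L2_circle" by (simp add: L2_circle_def)
qed

subsection \<open>Capacity in terms of holomorphic functions\<close>

context dirichlet_weight
begin

text \<open>For real \<open>f 0\<close> the term \<open>(Re (f 0))\<^sup>2\<close> raises the weight
  of the constant mode from 1/2 to 1; all other modes count half, as the mean square of a cosine
  does.\<close>

definition N :: "(complex \<Rightarrow> complex) \<Rightarrow> real" where
  "N f = (nsq f + (Re (f 0))\<^sup>2) / 2"

definition br :: "(complex \<Rightarrow> complex) \<Rightarrow> (complex \<Rightarrow> complex) \<Rightarrow> real" where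
  "br f g = (Re (ip f g) + Re (f 0) * Re (g 0)) / 2"

lemma N_nonneg: "f \<in> \<D> \<Longrightarrow> 0 \<le> N f"
  by (simp add: N_def nsq_nonneg)

lemma br_self: "f \<in> \<D> \<Longrightarrow> br f f = N f"
  by (simp add: br_def N_def ip_self power2_eq_square)

lemma br_commute: "f \<in> \<D> \<Longrightarrow> g \<in> \<D> \<Longrightarrow> br f g = br g f"
  by (simp add: br_def ip_cnj[of f g] mult.commute)

lemma br_add_left: "f \<in> \<D> \<Longrightarrow> g \<in> \<D> \<Longrightarrow> h \<in> \<D> \<Longrightarrow> br (\<lambda>z. f z + g z) h = br f h + br g h"
  by (simp add: br_def ip_add_left algebra_simps add_divide_distrib)

lemma br_scale_left: "f \<in> \<D> \<Longrightarrow> h \<in> \<D> \<Longrightarrow> br (\<lambda>z. of_real t * f z) h = t * br f h"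
  by (simp add: br_def ip_scale_left algebra_simps add_divide_distrib)

lemma N_add_scale:
  assumes "f \<in> \<D>" "h \<in> \<D>"
  shows "N (\<lambda>z. f z + of_real t * h z) = N f + 2 * t * br h f + t\<^sup>2 * N h"
  by (simp add: N_def br_def nsq_add_scale[OF assms] power2_eq_square field_simps)

lemma br_cauchy_schwarz:
  assumes "f \<in> \<D>" "h \<in> \<D>"
  shows "\<bar>br f h\<bar> \<le> sqrt (N f) * sqrt (N h)"
proof -
  have "(br h f)\<^sup>2 \<le> N f * N h"
  proof (rule nonneg_quadratic_imp_discriminant)
    have "(\<lambda>z. f z + of_real t * h z) \<in> \<D>" for t using assms by auto
    then show "0 \<le> N f + 2 * t * br h f + t\<^sup>2 * N h" for t
      using N_nonneg by (simp flip: N_add_scale[OF assms])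
  qed (rule N_nonneg[OF assms(2)])
  then show ?thesis
    unfolding br_commute[OF assms] real_sqrt_mult[symmetric] by (rule real_le_rsqrt[of "\<bar>_\<bar>", simplified])
qed

lemma sqrt_N_triangle:
  assumes "f \<in> \<D>" "h \<in> \<D>"
  shows "sqrt (N (\<lambda>z. f z + of_real t * h z)) \<le> sqrt (N f) + \<bar>t\<bar> * sqrt (N h)"
proof (rule real_le_lsqrt)
  have "t * br h f \<le> \<bar>t\<bar> * (sqrt (N h) * sqrt (N f))"
    using br_cauchy_schwarz[OF assms(2,1)] mult_left_mono[of "\<bar>br h f\<bar>" _ "\<bar>t\<bar>"]
    by (metis abs_ge_self abs_ge_zero abs_mult order_trans)
  then show "N (\<lambda>z. f z + of_real t * h z) \<le> (sqrt (N f) + \<bar>t\<bar> * sqrt (N h))\<^sup>2"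
    using N_nonneg[OF assms(1)] N_nonneg[OF assms(2)]
    by (simp add: N_add_scale[OF assms] power2_sum power_mult_distrib algebra_simps)
qed (use N_nonneg assms in auto)

lemma half_wint:
  assumes "f \<in> \<D>"
  shows "(\<integral>\<^sup>+z. ennreal ((norm (deriv f z))\<^sup>2 / 2 * \<omega> z) \<partial>disk_measure) = ennreal (wint f / 2)"
proof -
  have "(\<integral>\<^sup>+z. ennreal ((norm (deriv f z))\<^sup>2 / 2 * \<omega> z) \<partial>disk_measure) =
    (\<integral>\<^sup>+z. ennreal ((norm (deriv f z))\<^sup>2 * \<omega> z / 2) \<partial>disk_measure)" by simp
  also have "\<dots> = ennreal (\<integral>z. (norm (deriv f z))\<^sup>2 * \<omega> z / 2 \<partial>disk_measure)"
    by (rule nn_integral_eq_integral) (use D_integrable[OF assms] weight_nonneg in auto)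
  finally show ?thesis by (simp add: wint_def)
qed

text \<open>From real functions on the circle to \<open>\<D>\<close>: the two energies agree, and
  Bessel's inequality handles the L^2 part. \<open>ex_boundary_D\<close> leads back.\<close>

lemma schwarz_in_D:
  assumes g: "g \<in> borel_measurable circle_measure" "integrable circle_measure (\<lambda>\<xi>. (g \<xi>)\<^sup>2)"
    and fin: "energy \<omega> (\<lambda>\<xi>. of_real (g \<xi>)) < \<infinity>"
  shows "schwarz g \<in> \<D>" "Im (schwarz g 0) = 0"
    "ennreal (N (schwarz g)) \<le> harmonic_norm_sq \<omega> (\<lambda>\<xi>. of_real (g \<xi>))"
proof -
  note hol = schwarz_hol[OF g]
  have e: "energy \<omega> (\<lambda>\<xi>. of_real (g \<xi>)) = (\<integral>\<^sup>+z. ennreal ((norm (deriv (schwarz g) z))\<^sup>2 / 2 * \<omega> z) \<partial>disk_measure)"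
    by (rule energy_eq[OF hol schwarz_integral(2)[OF g]])
  have [measurable]: "deriv (schwarz g) \<in> borel_measurable disk_measure"
    by (rule borel_measurable_disk_deriv[OF hol])
  have "(\<integral>\<^sup>+z. ennreal ((norm (deriv (schwarz g) z))\<^sup>2 * \<omega> z) \<partial>disk_measure) =
     (\<integral>\<^sup>+z. 2 * ennreal ((norm (deriv (schwarz g) z))\<^sup>2 / 2 * \<omega> z) \<partial>disk_measure)"
    by (rule nn_integral_cong) (simp add: weight_nonneg ennreal_mult''[symmetric] flip: ennreal_numeral)
  also have "\<dots> = 2 * energy \<omega> (\<lambda>\<xi>. of_real (g \<xi>))"
    unfolding e by (rule nn_integral_cmult) measurable
  also have "\<dots> < \<infinity>" using fin by (simp add: ennreal_mult_less_top)
  finally show D: "schwarz g \<in> \<D>" using hol by (simp add: dirichlet_space_def)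
  show "Im (schwarz g 0) = 0" by (simp add: schwarz_0[OF g])
  have "N (schwarz g) \<le> (\<integral>\<xi>. (g \<xi>)\<^sup>2 \<partial>circle_measure) + wint (schwarz g) / 2"
    using schwarz_bessel(2)[OF g] by (simp add: N_def nsq_def field_simps)
  then have "ennreal (N (schwarz g)) \<le> ennreal (\<integral>\<xi>. (g \<xi>)\<^sup>2 \<partial>circle_measure) + ennreal (wint (schwarz g) / 2)"
    by (simp add: ennreal_plus[symmetric] wint_nonneg ennreal_leI del: ennreal_plus)
  then show "ennreal (N (schwarz g)) \<le> harmonic_norm_sq \<omega> (\<lambda>\<xi>. of_real (g \<xi>))"
    unfolding harmonic_norm_sq_def L2_circle_of_real(2)[OF g] e half_wint[OF D] .
qed

text \<open>The radii are handed on together with \<open>u\<close> because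
  \<open>capacity_le\<close> derives lower bounds for \<open>u\<close> from the values of
  \<open>H\<close> along them.\<close>

lemma ex_boundary_D:
  assumes H: "H \<in> \<D>" and H0: "Im (H 0) = 0"
  obtains u :: "complex \<Rightarrow> real" and r :: "nat \<Rightarrow> real"
  where "u \<in> borel_measurable circle_measure" "integrable circle_measure (\<lambda>\<xi>. (u \<xi>)\<^sup>2)"
    "(\<lambda>\<xi>. of_real (u \<xi>)) \<in> harmonic_dirichlet_space \<omega>"
    "harmonic_norm_sq \<omega> (\<lambda>\<xi>. of_real (u \<xi>)) \<le> ennreal (N H)"
    "\<And>z. norm z < 1 \<Longrightarrow> poisson (\<lambda>\<xi>. of_real (u \<xi>)) z = of_real (Re (H z))"
    "\<And>n. 0 \<le> r n" "\<And>n. r n < 1" "r \<longlonglongrightarrow> 1"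
    "AE \<xi> in circle_measure. (\<lambda>n. Re (H (of_real (r n) * \<xi>))) \<longlonglongrightarrow> u \<xi>"
proof -
  obtain u r where u: "u \<in> borel_measurable circle_measure" "integrable circle_measure (\<lambda>\<xi>. (u \<xi>)\<^sup>2)"
    and ub: "(\<integral>\<xi>. (u \<xi>)\<^sup>2 \<partial>circle_measure) \<le> (coeff_norm_sq H + (Re (H 0))\<^sup>2) / 2"
    and up: "\<And>z. norm z < 1 \<Longrightarrow> poisson (\<lambda>\<xi>. of_real (u \<xi>)) z = of_real (Re (H z))"
    and r: "\<And>n. 0 \<le> r n" "\<And>n. r n < 1" "r \<longlonglongrightarrow> 1"
      "AE \<xi> in circle_measure. (\<lambda>n. Re (H (of_real (r n) * \<xi>))) \<longlonglongrightarrow> u \<xi>"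
    by (rule ex_boundary_function[OF D_hol[OF H] D_coeff[OF H] H0]) (rule that)
  have e: "energy \<omega> (\<lambda>\<xi>. of_real (u \<xi>)) = ennreal (wint H / 2)"
    using energy_eq[OF D_hol[OF H] up] half_wint[OF H] by simp
  have 1: "(\<lambda>\<xi>. of_real (u \<xi>)) \<in> harmonic_dirichlet_space \<omega>"
    using L2_circle_of_real(1)[OF u] e by (simp add: harmonic_dirichlet_space_def)
  have "harmonic_norm_sq \<omega> (\<lambda>\<xi>. of_real (u \<xi>)) = ennreal ((\<integral>\<xi>. (u \<xi>)\<^sup>2 \<partial>circle_measure) + wint H / 2)"
    unfolding harmonic_norm_sq_def L2_circle_of_real(2)[OF u] e by (simp add: wint_nonneg)
  also have "\<dots> \<le> ennreal (N H)"
    using ub by (intro ennreal_leI) (simp add: N_def nsq_def field_simps)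
  finally show thesis using that[OF u 1 _ up r] by blast
qed

lemma N_one: "N (\<lambda>z. 1) = 1"
proof -
  have "taylor_coeff (\<lambda>z. 1) = (\<lambda>n. if n = 0 then 1 else 0)"
    by (rule taylor_coeff_unique) (use sums_single[of 0 "\<lambda>_. 1::complex"] in \<open>simp add: if_distrib[of "\<lambda>x. x * _"] cong: if_cong\<close>)
  then have "coeff_norm_sq (\<lambda>z. 1) = (\<Sum>n. if n = 0 then 1 else 0)"
    unfolding coeff_norm_sq_def by (intro suminf_cong) simp
  also have "\<dots> = 1" by (subst suminf_finite[of "{0}"]) auto
  finally have "coeff_norm_sq (\<lambda>z. 1) = 1" .
  moreover have "wint (\<lambda>z. 1) = 0" by (simp add: wint_def)
  ultimately show ?thesis by (simp add: N_def nsq_def)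
qed

text \<open>Near \<zeta> only \<open>Re (H z) > 1 / s\<close> is known, so the competitor is
  \<open>s\<close> times \<open>H\<close> for each s > 1, and s tends to 1 at the end. The limit
  runs over the whole disk since it has to control the boundary values on an arc.\<close>

lemma capacity_le:
  assumes \<zeta>: "norm \<zeta> = 1" and H: "H \<in> \<D>" and H0: "Im (H 0) = 0"
    and lim: "((\<lambda>z. Re (H z)) \<longlongrightarrow> 1) (at \<zeta> within unit_disk)"
  shows "capacity \<omega> {\<zeta>} \<le> ennreal (N H)"
proof -
  have le: "capacity \<omega> {\<zeta>} \<le> ennreal (s\<^sup>2 * N H)" if s: "s > 1" for s
  proof -
    have "eventually (\<lambda>z. Re (H z) > 1 / s) (at \<zeta> within unit_disk)"
      by (rule order_tendstoD(1)[OF lim]) (use s in simp)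
    then obtain \<delta> where \<delta>: "\<delta> > 0" "\<And>z. z \<in> unit_disk \<Longrightarrow> dist z \<zeta> < \<delta> \<Longrightarrow> z \<noteq> \<zeta> \<Longrightarrow> 1 / s < Re (H z)"
      unfolding eventually_at by blast
    let ?H = "\<lambda>z. of_real s * H z"
    have HD: "?H \<in> \<D>" using H by auto
    have Im0: "Im (?H 0) = 0" using H0 by simp
    have HN: "N ?H = s\<^sup>2 * N H"
      using br_self[OF HD] br_scale_left[OF H HD] br_commute[OF H HD] br_scale_left[OF H H] br_self[OF H]
      by (simp add: power2_eq_square)
    obtain u r where "u \<in> borel_measurable circle_measure" "integrable circle_measure (\<lambda>\<xi>. (u \<xi>)\<^sup>2)"
      and u: "(\<lambda>\<xi>. of_real (u \<xi>)) \<in> harmonic_dirichlet_space \<omega>"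
        "harmonic_norm_sq \<omega> (\<lambda>\<xi>. of_real (u \<xi>)) \<le> ennreal (N ?H)"
      and "\<And>z. norm z < 1 \<Longrightarrow> poisson (\<lambda>\<xi>. of_real (u \<xi>)) z = of_real (Re (?H z))"
      and r: "\<And>n. 0 \<le> r n" "\<And>n. r n < 1" "r \<longlonglongrightarrow> 1"
        "AE \<xi> in circle_measure. (\<lambda>n. Re (?H (of_real (r n) * \<xi>))) \<longlonglongrightarrow> u \<xi>"
      by (rule ex_boundary_D[OF HD Im0]) (rule that)
    define U where "U = unit_circle \<inter> ball \<zeta> \<delta>"
    have "AE \<xi> in circle_measure. \<xi> \<in> U \<longrightarrow> 1 \<le> cmod (of_real (u \<xi>))"
      using r(4)
    proof eventually_elim
      case (elim \<xi>)
      show ?case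
      proof
        assume \<xi>: "\<xi> \<in> U"
        have "(\<lambda>n. of_real (r n) * \<xi>) \<longlonglongrightarrow> of_real 1 * \<xi>" by (intro tendsto_intros r)
        moreover have "open (ball \<zeta> \<delta>)" "of_real 1 * \<xi> \<in> ball \<zeta> \<delta>" using \<xi> by (auto simp: U_def)
        ultimately have "\<forall>\<^sub>F n in sequentially. of_real (r n) * \<xi> \<in> ball \<zeta> \<delta>"
          by (rule topological_tendstoD)
        then have "\<forall>\<^sub>F n in sequentially. 1 \<le> Re (?H (of_real (r n) * \<xi>))"
        proof eventually_elim
          case (elim n)
          have n1: "norm (of_real (r n) * \<xi>) < 1" using \<xi> r(1,2)[of n] by (simp add: U_def norm_mult)
          then have "of_real (r n) * \<xi> \<noteq> \<zeta>" using \<zeta> by auto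
          then have "1 / s < Re (H (of_real (r n) * \<xi>))"
            using \<delta>(2)[of "of_real (r n) * \<xi>"] n1 elim by (simp add: dist_commute)
          then show ?case using s by (simp add: field_simps)
        qed
        then have "1 \<le> u \<xi>" by (rule tendsto_lowerbound[OF elim]) simp
        then show "1 \<le> cmod (of_real (u \<xi>))" by simp
      qed
    qed
    then have "open_capacity \<omega> U \<le> harmonic_norm_sq \<omega> (\<lambda>\<xi>. of_real (u \<xi>))"
      unfolding open_capacity_def using u(1) by (intro INF_lower) auto
    moreover have "capacity \<omega> {\<zeta>} \<le> open_capacity \<omega> U"
      unfolding capacity_def
      by (intro INF_lower) (use \<zeta> \<delta>(1) in \<open>auto simp: U_def openin_open_Int\<close>)
    ultimately show ?thesis using u(2) HN by simp
  qed
  have "(\<lambda>n. ennreal ((1 + inverse (of_nat (Suc n)))\<^sup>2 * N H)) \<longlonglongrightarrow> ennreal ((1 + 0)\<^sup>2 * N H)"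
    by (intro tendsto_ennrealI tendsto_intros LIMSEQ_inverse_real_of_nat)
  then have "capacity \<omega> {\<zeta>} \<le> ennreal ((1 + 0)\<^sup>2 * N H)"
    by (rule tendsto_lowerbound) (auto intro!: always_eventually le)
  then show ?thesis by simp
qed

lemma capacity_le_1: "norm \<zeta> = 1 \<Longrightarrow> capacity \<omega> {\<zeta>} \<le> 1"
  using capacity_le[of \<zeta> "\<lambda>z. 1"] by (auto simp: N_one)

text \<open>Replacing \<open>f\<close> by the minimum of \<open>cmod f\<close> and 1 gives a
  boundary function equal to 1 almost everywhere on an arc around \<zeta>, and its Poisson extension
  therefore tends to 1 at \<zeta>.\<close>

lemma near_minimizer:
  assumes dw: "douglas_weight \<omega>" and \<zeta>: "norm \<zeta> = 1" and less: "capacity \<omega> {\<zeta>} < A"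
  obtains e where "e \<in> \<D>" "Im (e 0) = 0" "ennreal (N e) < A"
    "((\<lambda>z. Re (e z)) \<longlongrightarrow> 1) (at \<zeta> within unit_disk)"
proof -
  obtain U where U: "openin (top_of_set unit_circle) U" "\<zeta> \<in> U" "open_capacity \<omega> U < A"
    using less unfolding capacity_def INF_less_iff by auto
  obtain f where f: "f \<in> harmonic_dirichlet_space \<omega>" "AE \<xi> in circle_measure. \<xi> \<in> U \<longrightarrow> 1 \<le> cmod (f \<xi>)"
      "harmonic_norm_sq \<omega> f < A"
    using U(3) unfolding open_capacity_def INF_less_iff by auto
  have fL: "f \<in> L2_circle" using f(1) by (simp add: harmonic_dirichlet_space_def)
  then have fm [measurable]: "f \<in> borel_measurable circle_measure" by (simp add: L2_circle_def)
  define g where "g \<xi> = min (cmod (f \<xi>)) 1" for \<xi>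
  have gm: "g \<in> borel_measurable circle_measure" unfolding g_def by measurable
  have g01: "0 \<le> g \<xi>" "g \<xi> \<le> 1" for \<xi> by (auto simp: g_def)
  have g2: "integrable circle_measure (\<lambda>\<xi>. (g \<xi>)\<^sup>2)"
    by (rule integrable_circle_bounded[where B = 1]) (use gm g01 in \<open>auto intro!: power_le_one\<close>)
  note g = gm g2
  have en: "energy \<omega> (\<lambda>\<xi>. of_real (g \<xi>)) \<le> energy \<omega> f"
  proof (rule douglas_contraction[OF dw fL L2_circle_of_real(1)[OF g]])
    fix \<xi> \<eta>
    have "\<bar>g \<xi> - g \<eta>\<bar> \<le> \<bar>cmod (f \<xi>) - cmod (f \<eta>)\<bar>" by (auto simp: g_def min_def)
    also have "\<dots> \<le> cmod (f \<xi> - f \<eta>)" by (rule norm_triangle_ineq3)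
    finally show "cmod (complex_of_real (g \<xi>) - complex_of_real (g \<eta>)) \<le> cmod (f \<xi> - f \<eta>)"
      by (simp flip: of_real_diff)
  qed
  have "(\<integral>\<^sup>+\<xi>. ennreal ((cmod (complex_of_real (g \<xi>)))\<^sup>2) \<partial>circle_measure) \<le>
      (\<integral>\<^sup>+\<xi>. ennreal ((cmod (f \<xi>))\<^sup>2) \<partial>circle_measure)"
    by (rule nn_integral_mono) (use g01 in \<open>auto intro!: ennreal_leI power_mono simp: g_def\<close>)
  then have "harmonic_norm_sq \<omega> (\<lambda>\<xi>. of_real (g \<xi>)) \<le> harmonic_norm_sq \<omega> f"
    unfolding harmonic_norm_sq_def by (intro add_mono en)
  with f(3) have less: "harmonic_norm_sq \<omega> (\<lambda>\<xi>. of_real (g \<xi>)) < A" by simp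
  have fin: "energy \<omega> (\<lambda>\<xi>. of_real (g \<xi>)) < \<infinity>"
    using en f(1) by (auto simp: harmonic_dirichlet_space_def intro: le_less_trans)
  obtain T where T: "open T" "U = unit_circle \<inter> T" using U(1) by (auto simp: openin_open)
  with U(2) obtain \<delta> where \<delta>: "\<delta> > 0" "ball \<zeta> \<delta> \<subseteq> T" by (auto simp: open_contains_ball)
  have ae: "AE \<xi> in circle_measure. dist \<zeta> \<xi> < \<delta> \<longrightarrow> g \<xi> = 1"
    using f(2) AE_space[of circle_measure]
    by eventually_elim (use \<delta>(2) T(2) in \<open>auto simp: g_def min_def subset_iff\<close>)
  \<comment> \<open>For z within \<delta>/2 of \<zeta>, points of the circle at distance at least
    \<delta> from \<zeta> are at least \<delta>/2 away from z. There the Poisson kernel is at most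
    (1 - |z|^2) 4 / \<delta>^2.\<close>
  have bound: "1 - Re (schwarz g z) \<le> (1 - (norm z)\<^sup>2) * (4 / \<delta>\<^sup>2)" "Re (schwarz g z) \<le> 1"
    if z: "norm z < 1" "dist z \<zeta> < \<delta> / 2" for z
  proof -
    let ?P = "\<lambda>\<xi>. (1 - (norm z)\<^sup>2) / (norm (\<xi> - z))\<^sup>2"
    have iP: "integrable circle_measure ?P"
      using poisson_kernel_integrable[of z "\<lambda>_. 1"] z by simp
    have iPg: "integrable circle_measure (\<lambda>\<xi>. ?P \<xi> * g \<xi>)" by (rule poisson_kernel_integrable[OF z(1) g])
    have eq: "1 - Re (schwarz g z) = (\<integral>\<xi>. ?P \<xi> - ?P \<xi> * g \<xi> \<partial>circle_measure)"
      using iP iPg by (simp only: Bochner_Integration.integral_diff Re_schwarz[OF g z(1)] poisson_kernel_integral[OF z(1)])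
    have "(\<integral>\<xi>. ?P \<xi> - ?P \<xi> * g \<xi> \<partial>circle_measure) \<le> (\<integral>\<xi>. (1 - (norm z)\<^sup>2) * (4 / \<delta>\<^sup>2) \<partial>circle_measure)"
    proof (rule integral_mono_AE)
      show "AE \<xi> in circle_measure. ?P \<xi> - ?P \<xi> * g \<xi> \<le> (1 - (norm z)\<^sup>2) * (4 / \<delta>\<^sup>2)"
        using ae
      proof eventually_elim
        case (elim \<xi>)
        have z2: "0 \<le> 1 - (norm z)\<^sup>2" using z by (simp add: power_le_one)
        show ?case
        proof (cases "dist \<zeta> \<xi> < \<delta>")
          case True
          with elim have "?P \<xi> - ?P \<xi> * g \<xi> = 0" by simp
          also have "0 \<le> (1 - (norm z)\<^sup>2) * (4 / \<delta>\<^sup>2)" using z2 by (intro mult_nonneg_nonneg) auto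
          finally show ?thesis .
        next
          case False
          have "\<delta> / 2 \<le> norm (\<xi> - z)"
            using False z(2) dist_triangle[of \<zeta> \<xi> z] by (simp add: dist_norm norm_minus_commute)
          then have "(\<delta> / 2)\<^sup>2 \<le> (norm (\<xi> - z))\<^sup>2" using \<delta>(1) by (intro power_mono) auto
          then have "?P \<xi> \<le> (1 - (norm z)\<^sup>2) / (\<delta> / 2)\<^sup>2"
            using z2 \<delta>(1) by (intro divide_left_mono) (auto intro!: mult_pos_pos intro: less_le_trans[of 0 "(\<delta>/2)\<^sup>2"])
          also have "\<dots> = (1 - (norm z)\<^sup>2) * (4 / \<delta>\<^sup>2)" by (simp add: power_divide)
          finally have "?P \<xi> \<le> (1 - (norm z)\<^sup>2) * (4 / \<delta>\<^sup>2)" .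
          moreover have "0 \<le> ?P \<xi> * g \<xi>" by (intro mult_nonneg_nonneg poisson_kernel_nonneg z g01)
          ultimately show ?thesis by linarith
        qed
      qed
    qed (use iP iPg in auto)
    also have "\<dots> = (1 - (norm z)\<^sup>2) * (4 / \<delta>\<^sup>2)" by (simp add: measure_circle)
    finally show "1 - Re (schwarz g z) \<le> (1 - (norm z)\<^sup>2) * (4 / \<delta>\<^sup>2)" using eq by simp
    have "0 \<le> (\<integral>\<xi>. ?P \<xi> - ?P \<xi> * g \<xi> \<partial>circle_measure)"
    proof (intro integral_nonneg_AE AE_I2)
      fix \<xi>
      have "?P \<xi> * g \<xi> \<le> ?P \<xi> * 1" by (intro mult_left_mono poisson_kernel_nonneg z g01)
      then show "0 \<le> ?P \<xi> - ?P \<xi> * g \<xi>" by simp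
    qed
    with eq show "Re (schwarz g z) \<le> 1" by simp
  qed
  have "((\<lambda>z. Re (schwarz g z)) \<longlongrightarrow> 1) (at \<zeta> within unit_disk)"
  proof (rule tendsto_sandwich)
    have ev: "\<forall>\<^sub>F z in at \<zeta> within unit_disk. norm z < 1 \<and> dist z \<zeta> < \<delta> / 2"
      unfolding eventually_at using \<delta>(1) by (intro exI[of _ "\<delta> / 2"]) auto
    show "\<forall>\<^sub>F z in at \<zeta> within unit_disk. 1 - (1 - (norm z)\<^sup>2) * (4 / \<delta>\<^sup>2) \<le> Re (schwarz g z)"
      using ev by eventually_elim (use bound(1) in \<open>fastforce simp: algebra_simps\<close>)
    show "\<forall>\<^sub>F z in at \<zeta> within unit_disk. Re (schwarz g z) \<le> 1"
      using ev by eventually_elim (use bound(2) in auto)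
    have "((\<lambda>z. 1 - (1 - (norm z)\<^sup>2) * (4 / \<delta>\<^sup>2)) \<longlongrightarrow> 1 - (1 - (norm \<zeta>)\<^sup>2) * (4 / \<delta>\<^sup>2)) (at \<zeta> within unit_disk)"
      by (intro tendsto_intros)
    then show "((\<lambda>z. 1 - (1 - (norm z)\<^sup>2) * (4 / \<delta>\<^sup>2)) \<longlongrightarrow> 1) (at \<zeta> within unit_disk)"
      using \<zeta> by simp
  qed simp
  with that[OF schwarz_in_D(1,2)[OF g fin]] schwarz_in_D(3)[OF g fin] less show thesis
    by (meson le_less_trans)
qed

end

subsection \<open>Harnack's inequality along a radius\<close>

text \<open>Schwarz's lemma for a Cayley transform of \<open>F \<circ> m\<close>, where
  \<open>m\<close> is the disk automorphism sending 0 to \<open>a\<close>. The derivative of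
  \<open>m\<close> supplies 1 - |a|^2 and that of the Cayley transform the denominator 2 Re
  F(a).\<close>

lemma schwarz_pick_halfplane_pos:
  assumes F: "F holomorphic_on unit_disk" and pos: "\<And>z. norm z < 1 \<Longrightarrow> 0 < Re (F z)"
    and a: "norm a < 1"
  shows "norm (deriv F a) * (1 - (norm a)\<^sup>2) \<le> 2 * Re (F a)"
proof -
  define m where "m z = (z + a) / (1 + cnj a * z)" for z
  have nz: "1 + cnj a * z \<noteq> 0" if "norm z < 1" for z
  proof
    assume "1 + cnj a * z = 0"
    then have "norm (cnj a * z) = 1" by (metis add_eq_0_iff norm_minus_cancel norm_one)
    moreover have "norm a * norm z < 1"
      using that a mult_strict_mono'[of "norm a" 1 "norm z" 1] by simp
    ultimately show False by (simp add: norm_mult)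
  qed
  have m_disk: "norm (m z) < 1" if z: "norm z < 1" for z
  proof -
    have "(norm (1 + cnj a * z))\<^sup>2 - (norm (z + a))\<^sup>2 = (1 - (norm a)\<^sup>2) * (1 - (norm z)\<^sup>2)"
      unfolding cmod_power2 by (simp add: algebra_simps power2_eq_square)
    also have "\<dots> > 0" using a z by (intro mult_pos_pos) (auto simp: power_less_one_iff abs_square_less_1)
    finally have "norm (z + a) < norm (1 + cnj a * z)"
      by (intro power2_less_imp_less[of "norm (z + a)"]) auto
    then show ?thesis using nz[OF z] by (simp add: m_def norm_divide divide_less_eq)
  qed
  have m_deriv: "(m has_field_derivative (1 - a * cnj a)) (at 0)"
    unfolding m_def by (auto intro!: derivative_eq_intros)
  have m_hol: "m holomorphic_on unit_disk"
    unfolding m_def by (intro holomorphic_intros) (use nz in auto)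
  define \<phi> where "\<phi> z = (F (m z) - F a) / (F (m z) + cnj (F a))" for z
  have Fnz: "F (m z) + cnj (F a) \<noteq> 0" if "norm z < 1" for z
    using pos[OF m_disk[OF that]] pos[OF a] by (auto simp: complex_eq_iff)
  have Fm: "(F \<circ> m) holomorphic_on unit_disk"
    by (rule holomorphic_on_compose_gen[OF m_hol F]) (use m_disk in auto)
  have hol: "\<phi> holomorphic_on unit_disk"
    unfolding \<phi>_def using Fm Fnz by (intro holomorphic_intros) (auto simp: o_def)
  have lt: "norm (\<phi> z) < 1" if z: "norm z < 1" for z
  proof -
    let ?x = "F (m z)" and ?y = "F a"
    have "(norm (x + cnj y))\<^sup>2 - (norm (x - y))\<^sup>2 = 4 * (Re x * Re y)" for x y
      unfolding cmod_power2 by (simp add: algebra_simps power2_eq_square)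
    from this[of ?x ?y] have "(norm (?x - ?y))\<^sup>2 < (norm (?x + cnj ?y))\<^sup>2"
      using mult_pos_pos[OF pos[OF m_disk[OF z]] pos[OF a]] by linarith
    then have "norm (?x - ?y) < norm (?x + cnj ?y)"
      by (rule power2_less_imp_less) simp
    then show ?thesis using Fnz[OF z] by (simp add: \<phi>_def norm_divide divide_less_eq)
  qed
  have m0: "m 0 = a" by (simp add: m_def)
  have phi0: "\<phi> 0 = 0" by (simp add: \<phi>_def m0)
  have "norm (deriv \<phi> 0) \<le> 1"
    using Schwarz_Lemma(2)[OF hol phi0 lt, of 0] by simp
  have dF: "(F has_field_derivative deriv F a) (at (m 0))"
    unfolding m0 using F a by (auto intro: holomorphic_derivI)
  have dFm: "((\<lambda>z. F (m z)) has_field_derivative (deriv F a * (1 - a * cnj a))) (at 0)"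
    using DERIV_chain2[OF dF m_deriv] .
  have re: "F a + cnj (F a) = of_real (2 * Re (F a))" by (simp add: complex_add_cnj)
  have "(\<phi> has_field_derivative
      ((deriv F a * (1 - a * cnj a)) * (F a + cnj (F a)) - (F a - F a) * (deriv F a * (1 - a * cnj a)))
       / ((F a + cnj (F a)) * (F a + cnj (F a)))) (at 0)"
    unfolding \<phi>_def
    by (rule derivative_eq_intros dFm | use m0 Fnz[of 0] in simp)+
  then have "deriv \<phi> 0 = ((deriv F a * (1 - a * cnj a)) * (F a + cnj (F a)) - (F a - F a) * (deriv F a * (1 - a * cnj a)))
       / ((F a + cnj (F a)) * (F a + cnj (F a)))"
    by (rule DERIV_imp_deriv)
  also have "\<dots> = (deriv F a * (1 - a * cnj a)) / of_real (2 * Re (F a))"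
  proof -
    have "(x * c - (y - y) * x) / (c * c) = x / c" if "c \<noteq> 0" for x y c :: complex
      using that by simp
    then show ?thesis unfolding re by this (use pos[OF a] in simp)
  qed
  also have "1 - a * cnj a = of_real (1 - (norm a)\<^sup>2)" using complex_norm_square[of a] by simp
  finally have "norm (deriv \<phi> 0) = norm (deriv F a) * \<bar>1 - (norm a)\<^sup>2\<bar> / \<bar>2 * Re (F a)\<bar>"
    by (simp only: norm_divide norm_mult norm_of_real)
  with \<open>norm (deriv \<phi> 0) \<le> 1\<close> show ?thesis
    using pos[OF a] a by (simp add: divide_le_eq abs_of_nonneg power_le_one)
qed

lemma schwarz_pick_halfplane:
  assumes F: "F holomorphic_on unit_disk" and nn: "\<And>z. norm z < 1 \<Longrightarrow> 0 \<le> Re (F z)"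
    and a: "norm a < 1"
  shows "norm (deriv F a) * (1 - (norm a)\<^sup>2) \<le> 2 * Re (F a)"
proof (rule field_le_epsilon)
  fix \<epsilon> :: real assume \<epsilon>: "0 < \<epsilon>"
  \<comment> \<open>The shift restores strict positivity and raises the right-hand side by exactly
    \<epsilon>.\<close>
  let ?G = "\<lambda>z. F z + of_real (\<epsilon> / 2)"
  have "norm (deriv ?G a) * (1 - (norm a)\<^sup>2) \<le> 2 * Re (?G a)"
    by (rule schwarz_pick_halfplane_pos[OF _ _ a]) (use F nn \<epsilon> in \<open>auto intro!: holomorphic_intros add_nonneg_pos simp del: of_real_divide\<close>)
  moreover have "deriv ?G a = deriv F a"
    using F a by (subst deriv_add) (auto intro: holomorphic_on_imp_differentiable_at)
  ultimately show "norm (deriv F a) * (1 - (norm a)\<^sup>2) \<le> 2 * Re (F a) + \<epsilon>" by simp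
qed

text \<open>Trades the hyperbolic factor 1 - s^2 for a logarithm, because ratios of logarithms are
  unchanged by k-th roots. The difference of the two sides vanishes at 1 and is
  nonincreasing.\<close>

lemma neg_mult_ln_le:
  assumes "0 < s" "s < (1::real)"
  shows "- 2 * s * ln s \<le> 1 - s\<^sup>2"
proof -
  define f where "f x = 1 - x\<^sup>2 + 2 * x * ln x" for x :: real
  have "f 1 \<le> f s"
  proof (rule DERIV_nonpos_imp_nonincreasing[where f = f and a = s and b = 1])
    fix x assume x: "s \<le> x" "x \<le> 1"
    then have "(f has_real_derivative (2 * ln x + 2 - 2 * x)) (at x)"
      unfolding f_def using assms by (auto intro!: derivative_eq_intros)
    moreover have "ln x \<le> x - 1" using x assms by (intro ln_le_minus_one) simp
    ultimately show "\<exists>y. (f has_real_derivative y) (at x) \<and> y \<le> 0"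
      by (intro exI[of _ "2 * ln x + 2 - 2 * x"]) auto
  qed (use assms in simp)
  then show ?thesis by (simp add: f_def)
qed

lemma Re_radial_derivative:
  assumes F: "F holomorphic_on unit_disk" and \<zeta>: "norm \<zeta> = 1" and s: "0 \<le> s" "s < 1"
  shows "((\<lambda>s. Re (F (of_real s * \<zeta>))) has_real_derivative Re (\<zeta> * deriv F (of_real s * \<zeta>))) (at s)"
proof -
  have "(F has_field_derivative deriv F (of_real s * \<zeta>)) (at (of_real s * \<zeta>))"
    using F \<zeta> s by (intro holomorphic_derivI[of _ unit_disk]) (auto simp: norm_mult)
  moreover have "((\<lambda>w. w * \<zeta>) has_field_derivative \<zeta>) (at (of_real s))"
    by (auto intro!: derivative_eq_intros)
  ultimately have "((\<lambda>w. F (w * \<zeta>)) has_field_derivative (deriv F (of_real s * \<zeta>) * \<zeta>)) (at (of_real s))"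
    by (rule DERIV_chain2)
  from has_vector_derivative_real_field[OF this]
  have "((\<lambda>s. F (of_real s * \<zeta>)) has_vector_derivative (deriv F (of_real s * \<zeta>) * \<zeta>)) (at s)" .
  from bounded_linear.has_vector_derivative[OF bounded_linear_Re this]
  show ?thesis by (simp add: has_real_derivative_iff_has_vector_derivative mult.commute)
qed

text \<open>Along a radius a nonnegative harmonic function \<open>u\<close> satisfies Harnack's inequality in the form
  that \<open>u / (- ln s)\<close> increases and \<open>u \<cdot> (- ln s)\<close> decreases.\<close>

lemma harnack_radius:
  assumes F: "F holomorphic_on unit_disk" and nn: "\<And>z. norm z < 1 \<Longrightarrow> 0 \<le> Re (F z)"
    and \<zeta>: "norm \<zeta> = 1" and s: "0 < s1" "s1 \<le> s" "s \<le> s2" "s1 \<le> r" "r \<le> s2" "s2 < 1"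
  shows "(ln s2 / ln s1) * Re (F (of_real r * \<zeta>)) \<le> Re (F (of_real s * \<zeta>))"
proof -
  define U where "U s = Re (F (of_real s * \<zeta>))" for s
  define U' where "U' s = Re (\<zeta> * deriv F (of_real s * \<zeta>))" for s
  have DU: "(U has_real_derivative U' x) (at x)" if "0 < x" "x < 1" for x
    unfolding U_def U'_def using Re_radial_derivative[OF F \<zeta>, of x] that by auto
  have U0: "0 \<le> U x" if "0 < x" "x < 1" for x
    unfolding U_def using that \<zeta> by (intro nn) (simp add: norm_mult)
  have lnneg: "ln x < 0" if "0 < x" "x < 1" for x :: real using that by simp
  \<comment> \<open>Where \<open>U\<close> is positive this says that ln U has derivative at most 1
    in modulus with respect to ln (- ln x), from which both monotonicities follow.\<close>
  have key: "\<bar>U' x\<bar> * (- ln x) \<le> U x / x" if x: "0 < x" "x < 1" for x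
  proof -
    have "\<bar>U' x\<bar> \<le> norm (deriv F (of_real x * \<zeta>))"
      unfolding U'_def using abs_Re_le_cmod[of "\<zeta> * deriv F (of_real x * \<zeta>)"] \<zeta> by (simp add: norm_mult)
    moreover have "norm (deriv F (of_real x * \<zeta>)) * (1 - x\<^sup>2) \<le> 2 * U x"
      using schwarz_pick_halfplane[OF F nn, of "of_real x * \<zeta>"] x \<zeta> by (simp add: norm_mult U_def)
    moreover have "0 < 1 - x\<^sup>2" using x by (simp add: abs_square_less_1)
    ultimately have "\<bar>U' x\<bar> * (1 - x\<^sup>2) \<le> 2 * U x"
      by (meson less_imp_le mult_right_mono order_trans)
    moreover have "\<bar>U' x\<bar> * (- 2 * x * ln x) \<le> \<bar>U' x\<bar> * (1 - x\<^sup>2)"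
      by (intro mult_left_mono neg_mult_ln_le x) simp
    ultimately have "\<bar>U' x\<bar> * (- 2 * x * ln x) \<le> 2 * U x" by linarith
    then show ?thesis using x by (simp add: field_simps)
  qed
  show ?thesis
  proof (cases "r \<le> s")
    case True
    have "U r / (- ln r) \<le> U s / (- ln s)"
    proof (rule DERIV_nonneg_imp_nondecreasing[OF True])
      fix x assume "r \<le> x" "x \<le> s"
      then have x: "0 < x" "x < 1" using s by auto
      have "((\<lambda>x. U x / (- ln x)) has_real_derivative (U' x * (- ln x) + U x / x) / (ln x)\<^sup>2) (at x)"
        by (rule derivative_eq_intros DU x refl | use x lnneg[OF x] in \<open>simp add: power2_eq_square field_simps\<close>)+
      moreover have "0 \<le> U' x * (- ln x) + U x / x"
      proof -
        have "- (\<bar>U' x\<bar> * (- ln x)) \<le> U' x * (- ln x)"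
          using mult_right_mono[of "- \<bar>U' x\<bar>" "U' x" "- ln x"] lnneg[OF x] by simp
        with key[OF x] show ?thesis by linarith
      qed
      ultimately show "\<exists>y. ((\<lambda>x. U x / (- ln x)) has_real_derivative y) (at x) \<and> 0 \<le> y"
        by (intro exI conjI) auto
    qed
    then have "U r * (ln s / ln r) \<le> U s"
      using lnneg[of s] lnneg[of r] s True by (simp add: field_simps)
    moreover have "ln s2 / ln s1 \<le> ln s / ln r"
    proof -
      have "ln s2 / ln s1 = (- ln s2) / (- ln s1)" by simp
      also have "\<dots> \<le> (- ln s) / (- ln r)" using s lnneg by (intro frac_le) auto
      finally show ?thesis by simp
    qed
    then have "(ln s2 / ln s1) * U r \<le> U r * (ln s / ln r)"
      using U0[of r] s by (subst mult.commute) (intro mult_left_mono, auto)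
    ultimately show ?thesis by (simp add: U_def)
  next
    case False
    then have le: "s \<le> r" by simp
    have "U r * (- ln r) \<le> U s * (- ln s)"
    proof (rule DERIV_nonpos_imp_nonincreasing[OF le])
      fix x assume "s \<le> x" "x \<le> r"
      then have x: "0 < x" "x < 1" using s by auto
      have "((\<lambda>x. U x * (- ln x)) has_real_derivative (U' x * (- ln x) - U x / x)) (at x)"
        by (rule derivative_eq_intros DU x refl | use x in simp)+
      moreover have "U' x * (- ln x) \<le> \<bar>U' x\<bar> * (- ln x)"
        using lnneg[OF x] by (intro mult_right_mono) auto
      then have "U' x * (- ln x) - U x / x \<le> 0" using key[OF x] by linarith
      ultimately show "\<exists>y. ((\<lambda>x. U x * (- ln x)) has_real_derivative y) (at x) \<and> y \<le> 0"
        by (intro exI conjI) auto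
    qed
    then have "U r * (ln r / ln s) \<le> U s"
      using lnneg[of s] lnneg[of r] s le by (simp add: field_simps)
    moreover have "ln s2 / ln s1 \<le> ln r / ln s"
    proof -
      have "ln s2 / ln s1 = (- ln s2) / (- ln s1)" by simp
      also have "\<dots> \<le> (- ln r) / (- ln s)" using s lnneg by (intro frac_le) auto
      finally show ?thesis by simp
    qed
    then have "(ln s2 / ln s1) * U r \<le> U r * (ln r / ln s)"
      using U0[of r] s by (subst mult.commute) (intro mult_left_mono, auto)
    ultimately show ?thesis by (simp add: U_def)
  qed
qed

subsection \<open>The kernel function and its modifications\<close>

context dirichlet_weight
begin

text \<open>Pointwise domination does not compare individual coefficients, so the H^2 parts are
  compared through mean squares over circles.\<close>

lemma D_dominated:
  assumes F: "F \<in> \<D>" and G: "G holomorphic_on unit_disk"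
    and le: "\<And>z. norm z < 1 \<Longrightarrow> norm (G z) \<le> norm (F z)"
    and le': "\<And>z. norm z < 1 \<Longrightarrow> norm (deriv G z) \<le> norm (deriv F z)"
  shows "G \<in> \<D>" "nsq G \<le> nsq F"
proof -
  have w: "(norm (deriv G z))\<^sup>2 * \<omega> z \<le> (norm (deriv F z))\<^sup>2 * \<omega> z" if "norm z < 1" for z
    using le'[OF that] weight_nonneg[OF that] by (intro mult_right_mono power_mono) auto
  show D: "G \<in> \<D>" by (rule D_I[OF G D_integrable[OF F] w])
  have "wint G \<le> wint F"
    unfolding wint_def by (intro integral_mono D_integrable D F) (use w in auto)
  moreover have "coeff_norm_sq G \<le> coeff_norm_sq F"
  proof (rule coeff_norm_sq_bound(2)[OF G])
    fix r :: real assume r: "0 \<le> r" "r < 1"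
    have "(\<integral>\<xi>. (norm (G (of_real r * \<xi>)))\<^sup>2 \<partial>circle_measure) \<le> (\<integral>\<xi>. (norm (F (of_real r * \<xi>)))\<^sup>2 \<partial>circle_measure)"
      by (intro integral_mono integrable_dilate_norm G D_hol[OF F] r power_mono le) (use r in \<open>auto simp: norm_mult\<close>)
    also have "\<dots> \<le> coeff_norm_sq F" by (rule dilate_norm_le[OF D_hol[OF F] D_coeff[OF F] r])
    finally show "(\<integral>\<xi>. (norm (G (of_real r * \<xi>)))\<^sup>2 \<partial>circle_measure) \<le> coeff_norm_sq F" .
  qed
  ultimately show "nsq G \<le> nsq F" by (simp add: nsq_def)
qed

lemma ip_one:
  assumes "f \<in> \<D>"
  shows "ip f (\<lambda>z. 1) = f 0"
proof -
  have "taylor_coeff (\<lambda>z. 1) = (\<lambda>n. if n = 0 then 1 else 0)"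
    by (rule taylor_coeff_unique) (use sums_single[of 0 "\<lambda>_. 1::complex"] in \<open>simp add: if_distrib[of "\<lambda>x. x * _"] cong: if_cong\<close>)
  then have "ip f (\<lambda>z. 1) = (\<Sum>n. taylor_coeff f n * cnj (if n = 0 then 1 else 0))"
    by (subst ip_eq[OF assms D_const]) simp
  also have "\<dots> = f 0" by (subst suminf_finite[of "{0}"]) auto
  finally show ?thesis .
qed

abbreviation \<kappa> :: "complex \<Rightarrow> real" where
  "\<kappa> w \<equiv> 2 * Re (dirichlet_kernel \<omega> w w) - 1"

text \<open>As \<open>k 0 = 1\<close>, pairing \<open>k\<close> with H gives (Re H(w) + Re H(0)) /
  2, and pairing the constant 1 gives Re H(0); hence 2 k - 1 represents Re H(w). Taking H = F
  identifies \<open>N F\<close>.\<close>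

lemma kernel_function:
  assumes w: "norm w < 1"
  obtains F where "F \<in> \<D>" "Im (F 0) = 0" "N F = \<kappa> w"
    "Re (F w) = \<kappa> w" "\<And>H. H \<in> \<D> \<Longrightarrow> br F H = Re (H w)"
proof -
  define k where "k z = dirichlet_kernel \<omega> z w" for z
  have k: "k \<in> \<D>" and rep: "\<And>h. h \<in> \<D> \<Longrightarrow> ip h k = h w"
    using is_dirichlet_kernel w unfolding is_dirichlet_kernel_def k_def by auto
  have one: "(\<lambda>z. 1) \<in> \<D>" by (rule D_const)
  have k0: "k 0 = 1"
    using rep[OF one] ip_cnj[OF k one] ip_one[OF k] by (metis complex_cnj_cnj complex_cnj_one)
  define F where "F z = of_real (-1) * 1 + of_real 2 * k z" for z
  have m1: "(\<lambda>z. of_real (-1) * 1) \<in> \<D>" by (rule D_const)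
  have k2: "(\<lambda>z. of_real 2 * k z) \<in> \<D>" by (rule D_scale[OF k])
  have FD: "F \<in> \<D>" unfolding F_def by (rule D_add[OF m1 k2])
  have brF: "br F H = Re (H w)" if H: "H \<in> \<D>" for H
  proof -
    have "br F H = br (\<lambda>z. of_real (-1) * 1) H + br (\<lambda>z. of_real 2 * k z) H"
      unfolding F_def by (rule br_add_left[OF m1 k2 H])
    also have "br (\<lambda>z. of_real (-1) * 1) H = - br (\<lambda>z. 1) H"
      using br_scale_left[OF one H, of "-1"] by simp
    also have "br (\<lambda>z. of_real 2 * k z) H = 2 * br k H" by (rule br_scale_left[OF k H])
    also have "br (\<lambda>z. 1) H = Re (H 0)" using ip_one[OF H] ip_cnj[OF H one] by (simp add: br_def)
    also have "br k H = (Re (H w) + Re (H 0)) / 2" using rep[OF H] ip_cnj[OF H k] by (simp add: br_def k0)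
    finally show ?thesis by (simp add: field_simps)
  qed
  have Fw: "Re (F w) = 2 * Re (k w) - 1" by (simp add: F_def)
  have NF: "N F = 2 * Re (k w) - 1" using br_self[OF FD] brF[OF FD] Fw by simp
  show thesis
    by (rule that[OF FD _ NF[unfolded k_def] Fw[unfolded k_def] brF]) (simp add: F_def k0)
qed

lemma eval_le_kernel:
  assumes w: "norm w < 1" and H: "H \<in> \<D>"
  shows "\<bar>Re (H w)\<bar> \<le> sqrt (\<kappa> w) * sqrt (N H)"
proof -
  obtain F where F: "F \<in> \<D>" "Im (F 0) = 0" "N F = \<kappa> w"
    "Re (F w) = \<kappa> w" "\<And>H. H \<in> \<D> \<Longrightarrow> br F H = Re (H w)"
    by (rule kernel_function[OF w]) (rule that)
  show ?thesis
    using br_cauchy_schwarz[OF F(1) H] F(5)[OF H] F(3) by simp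
qed

lemma kernel_ge_1:
  assumes w: "norm w < 1"
  shows "1 \<le> \<kappa> w"
proof -
  have "1 \<le> sqrt (\<kappa> w)"
    using eval_le_kernel[OF w D_const[of 1]] by (simp add: N_one)
  then show ?thesis by simp
qed

text \<open>Taking absolute values on the boundary raises the Poisson integral at \<open>w\<close>
  without raising the norm. Positivity is what Harnack's inequality and the monotonicity along the
  radius rest on.\<close>

lemma ex_positive_function:
  assumes dw: "douglas_weight \<omega>" and w: "norm w < 1"
  obtains F where "F \<in> \<D>" "Im (F 0) = 0" "\<And>z. norm z < 1 \<Longrightarrow> 0 \<le> Re (F z)"
    "N F \<le> \<kappa> w" "\<kappa> w \<le> Re (F w)"
proof -
  obtain K where K: "K \<in> \<D>" "Im (K 0) = 0" "N K = \<kappa> w"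
    "Re (K w) = \<kappa> w" "\<And>H. H \<in> \<D> \<Longrightarrow> br K H = Re (H w)"
    by (rule kernel_function[OF w]) (rule that)
  obtain u r where um: "u \<in> borel_measurable circle_measure" "integrable circle_measure (\<lambda>\<xi>. (u \<xi>)\<^sup>2)"
    and u: "(\<lambda>\<xi>. of_real (u \<xi>)) \<in> harmonic_dirichlet_space \<omega>"
      "harmonic_norm_sq \<omega> (\<lambda>\<xi>. of_real (u \<xi>)) \<le> ennreal (N K)"
    and up: "\<And>z. norm z < 1 \<Longrightarrow> poisson (\<lambda>\<xi>. of_real (u \<xi>)) z = of_real (Re (K z))"
    and "\<And>n. 0 \<le> r n" "\<And>n. r n < 1" "r \<longlonglongrightarrow> 1"
      "AE \<xi> in circle_measure. (\<lambda>n. Re (K (of_real (r n) * \<xi>))) \<longlonglongrightarrow> u \<xi>"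
    by (rule ex_boundary_D[OF K(1,2)]) (rule that)
  define g where "g \<xi> = \<bar>u \<xi>\<bar>" for \<xi>
  have g: "g \<in> borel_measurable circle_measure" "integrable circle_measure (\<lambda>\<xi>. (g \<xi>)\<^sup>2)"
    unfolding g_def using um by simp_all
  have en: "energy \<omega> (\<lambda>\<xi>. of_real (g \<xi>)) \<le> energy \<omega> (\<lambda>\<xi>. of_real (u \<xi>))"
  proof (rule douglas_contraction[OF dw L2_circle_of_real(1)[OF um] L2_circle_of_real(1)[OF g]])
    show "norm (complex_of_real (g \<xi>) - of_real (g \<eta>)) \<le> norm (complex_of_real (u \<xi>) - of_real (u \<eta>))" for \<xi> \<eta>
      by (simp add: g_def flip: of_real_diff)
  qed
  have fin: "energy \<omega> (\<lambda>\<xi>. of_real (g \<xi>)) < \<infinity>"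
    using en u(1) by (auto simp: harmonic_dirichlet_space_def intro: le_less_trans)
  have "ennreal (N (schwarz g)) \<le> harmonic_norm_sq \<omega> (\<lambda>\<xi>. of_real (g \<xi>))"
    by (rule schwarz_in_D(3)[OF g fin])
  also have "\<dots> \<le> harmonic_norm_sq \<omega> (\<lambda>\<xi>. of_real (u \<xi>))"
    unfolding harmonic_norm_sq_def by (intro add_mono en) (simp add: g_def)
  also have "\<dots> \<le> ennreal (N K)" by (rule u(2))
  finally have "N (schwarz g) \<le> N K" using N_nonneg[OF K(1)] by simp
  moreover have "Re (schwarz u w) \<le> Re (schwarz g w)"
    by (rule Re_schwarz_mono[OF um g w]) (simp add: g_def)
  moreover have "Re (schwarz u w) = Re (K w)"
    using schwarz_integral(2)[OF um w] up[OF w] by simp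
  moreover have "0 \<le> Re (schwarz g z)" if "norm z < 1" for z
    by (rule Re_schwarz_nonneg[OF g that]) (simp add: g_def)
  ultimately show thesis
    using that[OF schwarz_in_D(1,2)[OF g fin]] K(3,4) by simp
qed

text \<open>The truncation is \<open>F / (1 + \<delta> F)\<close>, which keeps \<open>Re F \<ge> 0\<close>, is bounded by \<open>1 / \<delta>\<close> and satisfies
  \<open>|(F / (1 + \<delta> F))'| \<le> |F'|\<close>.\<close>

lemma ex_bounded_positive_function:
  assumes dw: "douglas_weight \<omega>" and w: "norm w < 1" and \<epsilon>: "0 < \<epsilon>"
  obtains F M where "F \<in> \<D>" "Im (F 0) = 0" "\<And>z. norm z < 1 \<Longrightarrow> 0 \<le> Re (F z)"
    "\<And>z. norm z < 1 \<Longrightarrow> norm (F z) \<le> M"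
    "N F \<le> \<kappa> w" "\<kappa> w - \<epsilon> \<le> Re (F w)"
proof -
  obtain F where F: "F \<in> \<D>" and F0: "Im (F 0) = 0" and nn: "\<And>z. norm z < 1 \<Longrightarrow> 0 \<le> Re (F z)"
    and NF: "N F \<le> \<kappa> w" and Fw: "\<kappa> w \<le> Re (F w)"
    by (rule ex_positive_function[OF dw w]) (rule that)
  have "((\<lambda>\<delta>. Re (F w / (1 + of_real \<delta> * F w))) \<longlongrightarrow> Re (F w / (1 + of_real 0 * F w))) (at_right (0::real))"
    by (intro tendsto_intros) simp
  then have "\<forall>\<^sub>F \<delta> in at_right (0::real). Re (F w) - \<epsilon> < Re (F w / (1 + of_real \<delta> * F w))"
    by (intro order_tendstoD(1)) (use \<epsilon> in auto)
  moreover have "\<forall>\<^sub>F \<delta> in at_right (0::real). 0 < \<delta>" by (rule eventually_at_right_less)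
  ultimately have "\<forall>\<^sub>F \<delta> in at_right (0::real). 0 < \<delta> \<and> Re (F w) - \<epsilon> < Re (F w / (1 + of_real \<delta> * F w))"
    by eventually_elim auto
  from eventually_happens'[OF _ this] obtain \<delta> :: real
    where \<delta>: "0 < \<delta>" "Re (F w) - \<epsilon> < Re (F w / (1 + of_real \<delta> * F w))" by auto
  define G where "G z = F z / (1 + of_real \<delta> * F z)" for z
  have den: "1 \<le> norm (1 + of_real \<delta> * F z)" "norm (of_real \<delta> * F z) \<le> norm (1 + of_real \<delta> * F z)" if "norm z < 1" for z
  proof -
    have "0 \<le> \<delta> * Re (F z)" using nn[OF that] \<delta> by simp
    then show "1 \<le> norm (1 + of_real \<delta> * F z)"
      using complex_Re_le_cmod[of "1 + of_real \<delta> * F z"] by simp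
    have "(norm (1 + x))\<^sup>2 = 1 + 2 * Re x + (norm x)\<^sup>2" for x
      unfolding cmod_power2 by (simp add: power2_eq_square algebra_simps)
    from this[of "of_real \<delta> * F z"]
    have "(norm (of_real \<delta> * F z))\<^sup>2 \<le> (norm (1 + of_real \<delta> * F z))\<^sup>2"
      using \<open>0 \<le> \<delta> * Re (F z)\<close> by simp
    then show "norm (of_real \<delta> * F z) \<le> norm (1 + of_real \<delta> * F z)"
      by (rule power2_le_imp_le) simp
  qed
  have nz: "1 + of_real \<delta> * F z \<noteq> 0" if "norm z < 1" for z
    using den(1)[OF that] by auto
  have G_hol: "G holomorphic_on unit_disk"
    unfolding G_def using nz by (intro holomorphic_intros D_hol[OF F]) auto
  have G_le: "norm (G z) \<le> norm (F z)" if "norm z < 1" for z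
    unfolding G_def norm_divide using den(1)[OF that] by (intro divide_le_eq[THEN iffD2]) (auto intro: mult_left_le[of 1 "norm (F z)", simplified] simp: mult_le_cancel_left1)
  have G_deriv: "norm (deriv G z) \<le> norm (deriv F z)" if z: "norm z < 1" for z
  proof -
    have "(F has_field_derivative deriv F z) (at z)"
      using D_hol[OF F] z by (auto intro: holomorphic_derivI)
    then have "(G has_field_derivative deriv F z / (1 + of_real \<delta> * F z)\<^sup>2) (at z)"
      unfolding G_def using nz[OF z]
      by (auto intro!: derivative_eq_intros simp: field_simps power2_eq_square)
    then have "norm (deriv G z) = norm (deriv F z) / (norm (1 + of_real \<delta> * F z))\<^sup>2"
      by (simp add: DERIV_imp_deriv norm_divide norm_power)
    also have "\<dots> \<le> norm (deriv F z) / 1"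
      using den(1)[OF z] by (intro divide_left_mono one_le_power) auto
    finally show ?thesis by simp
  qed
  note D = D_dominated[OF F G_hol G_le G_deriv]
  have F0': "F 0 = of_real (Re (F 0))" using F0 by (simp add: complex_eq_iff)
  have G0: "Im (G 0) = 0"
  proof -
    have "G 0 = of_real (Re (F 0) / (1 + \<delta> * Re (F 0)))"
      unfolding G_def by (subst (1 2) F0') simp
    then show ?thesis by simp
  qed
  have "\<bar>Re (G 0)\<bar> \<le> norm (F 0)" using abs_Re_le_cmod[of "G 0"] G_le[of 0] by simp
  also have "norm (F 0) = \<bar>Re (F 0)\<bar>" by (subst F0') simp
  finally have "(Re (G 0))\<^sup>2 \<le> (Re (F 0))\<^sup>2" by (simp add: abs_le_square_iff)
  then have NG: "N G \<le> N F" using D(2) by (simp add: N_def)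
  have Gb: "norm (G z) \<le> 1 / \<delta>" if z: "norm z < 1" for z
  proof -
    have "\<delta> * norm (F z) \<le> norm (1 + of_real \<delta> * F z)"
      using den(2)[OF z] \<delta>(1) by (simp add: norm_mult)
    then have "norm (F z) \<le> norm (1 + of_real \<delta> * F z) / \<delta>"
      using \<delta>(1) by (simp add: pos_le_divide_eq mult.commute)
    moreover have "0 < norm (1 + of_real \<delta> * F z)" using den(1)[OF z] by linarith
    ultimately show ?thesis
      by (simp add: G_def norm_divide pos_divide_le_eq)
  qed
  have Gnn: "0 \<le> Re (G z)" if z: "norm z < 1" for z
  proof -
    have "Re (G z) = Re (F z * cnj (1 + of_real \<delta> * F z)) / (norm (1 + of_real \<delta> * F z))\<^sup>2"
      unfolding G_def by (subst complex_div_cnj) (simp add: Re_divide_of_real[symmetric] del: of_real_power)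
    moreover have "Re (x * cnj (1 + of_real \<delta> * x)) = Re x + \<delta> * (norm x)\<^sup>2" for x
      unfolding cmod_power2 by (simp add: power2_eq_square algebra_simps)
    ultimately show ?thesis using nn[OF z] \<delta>(1) by simp
  qed
  show thesis
  proof (rule that[OF D(1) G0 Gnn Gb])
    show "N G \<le> \<kappa> w" using NG NF by simp
    show "\<kappa> w - \<epsilon> \<le> Re (G w)" using Fw \<delta>(2) by (simp add: G_def)
  qed
qed


section \<open>Damped primitives and their pairing with a fixed function\<close>

lemma D_sum:
  assumes "finite S" "\<And>i. i \<in> S \<Longrightarrow> f i \<in> \<D>"
  shows "(\<lambda>z. \<Sum>i\<in>S. of_real (c i) * f i z) \<in> \<D>"
    and "h \<in> \<D> \<Longrightarrow> br (\<lambda>z. \<Sum>i\<in>S. of_real (c i) * f i z) h = (\<Sum>i\<in>S. c i * br (f i) h)"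
    and "sqrt (N (\<lambda>z. \<Sum>i\<in>S. of_real (c i) * f i z)) \<le> (\<Sum>i\<in>S. \<bar>c i\<bar> * sqrt (N (f i)))"
proof -
  have "(\<lambda>z. \<Sum>i\<in>S. of_real (c i) * f i z) \<in> \<D> \<and>
    (h \<in> \<D> \<longrightarrow> br (\<lambda>z. \<Sum>i\<in>S. of_real (c i) * f i z) h = (\<Sum>i\<in>S. c i * br (f i) h)) \<and>
    sqrt (N (\<lambda>z. \<Sum>i\<in>S. of_real (c i) * f i z)) \<le> (\<Sum>i\<in>S. \<bar>c i\<bar> * sqrt (N (f i)))" for h
    using assms
  proof (induction S rule: finite_induct)
    case empty
    have z: "(\<lambda>z. 0) \<in> \<D>" by (rule D_const)
    have "br (\<lambda>z. 0) h = 0" if "h \<in> \<D>" for h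
      using br_scale_left[OF z that, of 0] by simp
    with z br_self[OF z] show ?case by simp
  next
    case (insert i S)
    let ?g = "\<lambda>z. \<Sum>i\<in>S. of_real (c i) * f i z"
    have fi: "f i \<in> \<D>" and g: "?g \<in> \<D>" using insert by auto
    have cf: "(\<lambda>z. of_real (c i) * f i z) \<in> \<D>" by (rule D_scale[OF fi])
    have eq: "(\<lambda>z. \<Sum>i\<in>insert i S. of_real (c i) * f i z) = (\<lambda>z. ?g z + of_real (c i) * f i z)"
      using insert by (simp add: fun_eq_iff add.commute)
    have "sqrt (N (\<lambda>z. ?g z + of_real (c i) * f i z)) \<le> sqrt (N ?g) + \<bar>c i\<bar> * sqrt (N (f i))"
      by (rule sqrt_N_triangle[OF g fi])
    moreover have "br (\<lambda>z. ?g z + of_real (c i) * f i z) h = br ?g h + c i * br (f i) h" if "h \<in> \<D>"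
      by (simp only: br_add_left[OF g cf that] br_scale_left[OF fi that])
    ultimately show ?case
      unfolding eq using insert D_add[OF g cf] by auto
  qed
  then show "(\<lambda>z. \<Sum>i\<in>S. of_real (c i) * f i z) \<in> \<D>"
    "h \<in> \<D> \<Longrightarrow> br (\<lambda>z. \<Sum>i\<in>S. of_real (c i) * f i z) h = (\<Sum>i\<in>S. c i * br (f i) h)"
    "sqrt (N (\<lambda>z. \<Sum>i\<in>S. of_real (c i) * f i z)) \<le> (\<Sum>i\<in>S. \<bar>c i\<bar> * sqrt (N (f i)))"
    by blast+
qed

text \<open>The share of the squared norm of \<open>e\<close> that meets a primitive of (a z)^m F'
  vanishing at 0: such a primitive has no coefficients below m, and the factor |z|^m of its
  derivative is moved over to the derivative of \<open>e\<close>.\<close>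

definition tail :: "(complex \<Rightarrow> complex) \<Rightarrow> nat \<Rightarrow> real" where
  "tail e m = (\<Sum>n. (norm (taylor_coeff e (n + m)))\<^sup>2) +
     (\<integral>z. (norm z ^ m * norm (deriv e z))\<^sup>2 * \<omega> z \<partial>disk_measure)"

lemma tail_integrand_le:
  assumes z: "norm z < 1"
  shows "norm ((norm z ^ m * norm (deriv e z))\<^sup>2 * \<omega> z) \<le> (norm (deriv e z))\<^sup>2 * \<omega> z"
proof -
  have "norm z ^ m * norm (deriv e z) \<le> norm (deriv e z)"
    using z by (intro mult_left_le_one_le power_le_one) auto
  then have "(norm z ^ m * norm (deriv e z))\<^sup>2 \<le> (norm (deriv e z))\<^sup>2"
    by (intro power_mono) auto
  then show ?thesis
    using weight_nonneg[OF z] by (simp add: abs_mult mult_right_mono)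
qed

lemma tail_integrable:
  assumes "e \<in> \<D>"
  shows "integrable disk_measure (\<lambda>z. (norm z ^ m * norm (deriv e z))\<^sup>2 * \<omega> z)"
proof (rule Bochner_Integration.integrable_bound[OF D_integrable[OF assms]])
  have [measurable]: "(\<lambda>z. norm z) \<in> borel_measurable disk_measure"
    by (intro borel_measurable_disk_continuous continuous_intros)
  show "(\<lambda>z. (norm z ^ m * norm (deriv e z))\<^sup>2 * \<omega> z) \<in> borel_measurable disk_measure"
    using assms by measurable
  show "AE z in disk_measure. norm ((norm z ^ m * norm (deriv e z))\<^sup>2 * \<omega> z) \<le> norm ((norm (deriv e z))\<^sup>2 * \<omega> z)"
  proof (rule AE_I2)
    fix z assume "z \<in> space disk_measure"
    then have "norm z < 1" by simp
    from tail_integrand_le[OF this] show "norm ((norm z ^ m * norm (deriv e z))\<^sup>2 * \<omega> z) \<le> norm ((norm (deriv e z))\<^sup>2 * \<omega> z)"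
      by (rule order_trans) (unfold real_norm_def, rule abs_ge_self)
  qed
qed

lemma tail_tendsto_0:
  assumes e: "e \<in> \<D>"
  shows "tail e \<longlonglongrightarrow> 0"
proof -
  have "(\<lambda>m. \<Sum>n. (norm (taylor_coeff e (n + m)))\<^sup>2) \<longlonglongrightarrow> 0"
    by (rule suminf_exist_split2[OF D_coeff[OF e]])
  moreover have "(\<lambda>m. \<integral>z. (norm z ^ m * norm (deriv e z))\<^sup>2 * \<omega> z \<partial>disk_measure) \<longlonglongrightarrow> (\<integral>z. 0 \<partial>disk_measure)"
  proof (rule integral_dominated_convergence[OF _ _ D_integrable[OF e]])
    show "(\<lambda>z. (norm z ^ m * norm (deriv e z))\<^sup>2 * \<omega> z) \<in> borel_measurable disk_measure" for m
      by (rule borel_measurable_integrable[OF tail_integrable[OF e]])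
    show "AE z in disk_measure. (\<lambda>m. (norm z ^ m * norm (deriv e z))\<^sup>2 * \<omega> z) \<longlonglongrightarrow> 0"
    proof (rule AE_I2)
      fix z assume "z \<in> space disk_measure"
      then have "(\<lambda>m. (norm z ^ m * norm (deriv e z))\<^sup>2 * \<omega> z) \<longlonglongrightarrow> (0 * norm (deriv e z))\<^sup>2 * \<omega> z"
        by (intro tendsto_intros LIMSEQ_realpow_zero) auto
      then show "(\<lambda>m. (norm z ^ m * norm (deriv e z))\<^sup>2 * \<omega> z) \<longlonglongrightarrow> 0" by simp
    qed
    show "AE z in disk_measure. norm ((norm z ^ m * norm (deriv e z))\<^sup>2 * \<omega> z) \<le> (norm (deriv e z))\<^sup>2 * \<omega> z" for m
      by (rule AE_I2) (use tail_integrand_le in simp)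
  qed auto
  ultimately have "(\<lambda>m. (\<Sum>n. (norm (taylor_coeff e (n + m)))\<^sup>2) +
     (\<integral>z. (norm z ^ m * norm (deriv e z))\<^sup>2 * \<omega> z \<partial>disk_measure)) \<longlonglongrightarrow> 0 + (\<integral>z. 0 \<partial>disk_measure)"
    by (rule tendsto_add)
  then show ?thesis by (simp add: tail_def[abs_def])
qed

text \<open>The operator \<open>f \<mapsto> \<integral> (a z)\<^sup>m f' dz\<close> with \<open>|a| = 1\<close> contracts the norm, because the weight of the
  energy lives on the disk and the \<open>n\<close>-th coefficient is multiplied by \<open>n / (n + m)\<close>.\<close>

lemma ex_damped_primitive:
  assumes F: "F \<in> \<D>" and a: "norm a = 1"
  obtains g where "g \<in> \<D>" "g 0 = 0" "\<And>z. norm z < 1 \<Longrightarrow> (g has_field_derivative (a * z) ^ m * deriv F z) (at z)"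
    "N g \<le> N F" "\<And>e. e \<in> \<D> \<Longrightarrow> \<bar>br e g\<bar> \<le> sqrt (tail e m) * sqrt (N F)"
proof -
  have dF: "deriv F holomorphic_on unit_disk" by (intro holomorphic_deriv D_hol[OF F]) simp
  have "(\<lambda>z. (a * z) ^ m * deriv F z) holomorphic_on unit_disk"
    by (intro holomorphic_intros dF)
  then obtain g0 where g0: "\<And>z. z \<in> unit_disk \<Longrightarrow> (g0 has_field_derivative (a * z) ^ m * deriv F z) (at z within unit_disk)"
    by (rule holomorphic_convex_primitive'[OF convex_ball open_ball]) (rule that)
  define g where "g z = g0 z - g0 0" for z
  have dg: "(g has_field_derivative (a * z) ^ m * deriv F z) (at z)" if "norm z < 1" for z
  proof -
    have "(g0 has_field_derivative (a * z) ^ m * deriv F z) (at z)"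
      using g0[of z] that by (simp add: at_within_open[of z unit_disk])
    from DERIV_diff[OF this DERIV_const[of "g0 0"]] show ?thesis by (simp add: g_def[abs_def])
  qed
  have derivg: "deriv g z = (a * z) ^ m * deriv F z" if "norm z < 1" for z
    by (rule DERIV_imp_deriv[OF dg[OF that]])
  have g_hol: "g holomorphic_on unit_disk"
    unfolding holomorphic_on_open[OF open_ball] by (intro ballI exI, rule dg) simp
  have norm_derivg: "norm (deriv g z) = norm z ^ m * norm (deriv F z)" if "norm z < 1" for z
    using a by (simp add: derivg[OF that] norm_mult norm_power)
  have norm_derivg_le: "norm (deriv g z) \<le> norm (deriv F z)" if "norm z < 1" for z
    unfolding norm_derivg[OF that] using that by (intro mult_left_le_one_le power_le_one) auto
  have wle: "(norm (deriv g z))\<^sup>2 * \<omega> z \<le> (norm (deriv F z))\<^sup>2 * \<omega> z" if "norm z < 1" for z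
    using norm_derivg_le[OF that] weight_nonneg[OF that] by (intro mult_right_mono power_mono) auto
  have gD: "g \<in> \<D>" by (rule D_I[OF g_hol D_integrable[OF F] wle])
  have wint_le: "wint g \<le> wint F"
    unfolding wint_def by (intro integral_mono D_integrable gD F) (use wle in auto)
  define c where "c n = (if n < m then 0 else a ^ m * taylor_coeff (deriv F) (n - m))" for n
  have "(\<lambda>n. c n * z ^ n) sums deriv g z" if z: "norm z < 1" for z
  proof -
    have "(\<lambda>n. (a * z) ^ m * (taylor_coeff (deriv F) n * z ^ n)) sums deriv g z"
      unfolding derivg[OF z] by (intro sums_mult taylor_sums dF z)
    moreover have "(\<lambda>n. (a * z) ^ m * (taylor_coeff (deriv F) n * z ^ n)) = (\<lambda>n. c (n + m) * z ^ (n + m))"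
      by (auto simp: c_def power_mult_distrib power_add mult_ac)
    ultimately have "(\<lambda>n. c (n + m) * z ^ (n + m)) sums (deriv g z - (\<Sum>i<m. c i * z ^ i))"
      by (simp add: c_def)
    then show ?thesis by (simp only: sums_iff_shift[of "\<lambda>n. c n * z ^ n" m]) (simp add: sums_iff_shift[symmetric] c_def)
  qed
  then have tc: "taylor_coeff (deriv g) = c" by (rule taylor_coeff_unique(1))
  have coeff_le: "norm (taylor_coeff g (n + m)) \<le> norm (taylor_coeff F n)" for n
  proof (cases n)
    case 0
    show ?thesis
    proof (cases m)
      case 0
      with \<open>n = 0\<close> show ?thesis by (simp add: g_def)
    next
      case (Suc m')
      then have "of_nat (Suc m') * taylor_coeff g (Suc m') = 0"
        using fun_cong[OF tc, of m'] by (simp add: taylor_coeff_deriv c_def)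
      with Suc \<open>n = 0\<close> show ?thesis by (simp del: of_nat_Suc)
    qed
  next
    case (Suc n')
    have "of_nat (Suc (n' + m)) * taylor_coeff g (Suc (n' + m)) = a ^ m * (of_nat (Suc n') * taylor_coeff F (Suc n'))"
      using fun_cong[OF tc, of "n' + m"] by (simp add: taylor_coeff_deriv c_def del: of_nat_Suc)
    then have "norm (of_nat (Suc (n' + m)) * taylor_coeff g (Suc (n' + m))) = norm (a ^ m * (of_nat (Suc n') * taylor_coeff F (Suc n')))"
      by simp
    then have eq: "real (Suc (n' + m)) * norm (taylor_coeff g (Suc (n' + m))) = real (Suc n') * norm (taylor_coeff F (Suc n'))"
      using a by (simp add: norm_mult norm_power del: of_nat_Suc)
    also have "\<dots> \<le> real (Suc (n' + m)) * norm (taylor_coeff F (Suc n'))"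
      by (intro mult_right_mono) auto
    finally show ?thesis using Suc by (simp del: of_nat_Suc)
  qed
  have coeff_0: "taylor_coeff g i = 0" if "i < m" for i
  proof (cases i)
    case 0
    then show ?thesis by (simp add: g_def)
  next
    case (Suc i')
    then have "of_nat (Suc i') * taylor_coeff g (Suc i') = 0"
      using fun_cong[OF tc, of i'] that by (simp add: taylor_coeff_deriv c_def)
    with Suc show ?thesis by (simp del: of_nat_Suc)
  qed
  have cns_g: "coeff_norm_sq g = (\<Sum>n. (norm (taylor_coeff g (n + m)))\<^sup>2)"
    unfolding coeff_norm_sq_def
    by (subst suminf_split_initial_segment[OF D_coeff[OF gD], of m]) (simp add: coeff_0)
  have cns_le: "coeff_norm_sq g \<le> coeff_norm_sq F"
    unfolding cns_g unfolding coeff_norm_sq_def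
    by (intro suminf_le power_mono coeff_le D_coeff F summable_ignore_initial_segment gD) auto
  have nsq_le: "nsq g \<le> nsq F" using wint_le cns_le by (simp add: nsq_def)
  have g00: "g 0 = 0" by (simp add: g_def)
  have NgF: "N g \<le> N F" using add_increasing2[OF zero_le_power2 nsq_le] by (simp add: N_def g00)
  have "\<bar>br e g\<bar> \<le> sqrt (tail e m) * sqrt (N F)" if e: "e \<in> \<D>" for e
  proof -
    let ?p = "Re (ip e g)"
    have se: "summable (\<lambda>n. (norm (taylor_coeff e (n + m)))\<^sup>2)" "summable (\<lambda>n. (norm (taylor_coeff g (n + m)))\<^sup>2)"
      by (intro summable_ignore_initial_segment D_coeff e gD)+
    have elem: "2 * t * Re (x * cnj y) \<le> (norm x)\<^sup>2 + t\<^sup>2 * (norm y)\<^sup>2" for t :: real and x y :: complex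
    proof -
      have "0 \<le> (norm (x - of_real t * y))\<^sup>2" by simp
      also have "\<dots> = (norm x)\<^sup>2 + t\<^sup>2 * (norm y)\<^sup>2 - 2 * t * Re (x * cnj y)"
        unfolding cmod_power2 by (simp add: power2_eq_square algebra_simps)
      finally show ?thesis by linarith
    qed
    have tail_nn: "0 \<le> tail e m"
      unfolding tail_def by (intro add_nonneg_nonneg suminf_nonneg se integral_nonneg_AE AE_I2) (auto simp: weight_nonneg)
    \<comment> \<open>Coefficients and energies are estimated together as one quadratic in
      \<open>t\<close>, so that the discriminant yields the product of \<open>tail e m\<close> and
      \<open>nsq F\<close>.\<close>
    have "(- ?p)\<^sup>2 \<le> tail e m * nsq F"
    proof (rule nonneg_quadratic_imp_discriminant)
      fix t :: real
      have "(\<Sum>n. taylor_coeff e n * cnj (taylor_coeff g n)) = (\<Sum>n. taylor_coeff e (n + m) * cnj (taylor_coeff g (n + m)))"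
        by (subst suminf_split_initial_segment[OF D_coeff_mixed[OF e gD], of m]) (simp add: coeff_0)
      moreover have sm: "summable (\<lambda>n. taylor_coeff e (n + m) * cnj (taylor_coeff g (n + m)))"
        by (rule summable_ignore_initial_segment[OF D_coeff_mixed[OF e gD]])
      ultimately have "2 * t * Re (\<Sum>n. taylor_coeff e n * cnj (taylor_coeff g n)) =
          (\<Sum>n. 2 * t * Re (taylor_coeff e (n + m) * cnj (taylor_coeff g (n + m))))"
        using suminf_mult[OF summable_Re[OF sm], of "2 * t"] Re_suminf[OF sm] by simp
      also have "\<dots> \<le> (\<Sum>n. (norm (taylor_coeff e (n + m)))\<^sup>2 + t\<^sup>2 * (norm (taylor_coeff g (n + m)))\<^sup>2)"
        by (intro suminf_le elem summable_add summable_mult se summable_Re sm)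
      also have "\<dots> = (\<Sum>n. (norm (taylor_coeff e (n + m)))\<^sup>2) + t\<^sup>2 * coeff_norm_sq g"
        unfolding cns_g using suminf_add[OF se(1) summable_mult[OF se(2), of "t\<^sup>2"]] suminf_mult[OF se(2), of "t\<^sup>2"] by simp
      finally have 1: "2 * t * Re (\<Sum>n. taylor_coeff e n * cnj (taylor_coeff g n)) \<le>
          (\<Sum>n. (norm (taylor_coeff e (n + m)))\<^sup>2) + t\<^sup>2 * coeff_norm_sq g" .
      have "2 * t * Re (\<integral>z. deriv e z * cnj (deriv g z) * of_real (\<omega> z) \<partial>disk_measure) =
        (\<integral>z. 2 * t * Re (deriv e z * cnj (deriv g z) * of_real (\<omega> z)) \<partial>disk_measure)"
        using integral_Re[OF D_mixed_integrable[OF e gD]] by simp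
      also have "\<dots> \<le> (\<integral>z. (norm z ^ m * norm (deriv e z))\<^sup>2 * \<omega> z + t\<^sup>2 * ((norm (deriv F z))\<^sup>2 * \<omega> z) \<partial>disk_measure)"
      proof (rule integral_mono)
        show "integrable disk_measure (\<lambda>z. 2 * t * Re (deriv e z * cnj (deriv g z) * of_real (\<omega> z)))"
          by (intro integrable_mult_right integrable_Re D_mixed_integrable e gD)
        show "integrable disk_measure (\<lambda>z. (norm z ^ m * norm (deriv e z))\<^sup>2 * \<omega> z + t\<^sup>2 * ((norm (deriv F z))\<^sup>2 * \<omega> z))"
          by (intro Bochner_Integration.integrable_add integrable_mult_right tail_integrable e D_integrable F)
        fix z assume "z \<in> space disk_measure"
        then have z: "norm z < 1" by simp
        \<comment> \<open>The factor (a z)^m is taken from the derivative of \<open>g\<close> to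
          that of \<open>e\<close> before estimating, which leaves the undamped derivative of
          \<open>F\<close>.\<close>
        have "2 * t * Re ((deriv e z * cnj ((a * z) ^ m)) * cnj (deriv F z)) \<le>
          (norm (deriv e z * cnj ((a * z) ^ m)))\<^sup>2 + t\<^sup>2 * (norm (deriv F z))\<^sup>2"
          by (rule elem)
        also have "norm (deriv e z * cnj ((a * z) ^ m)) = norm z ^ m * norm (deriv e z)"
          unfolding norm_mult complex_mod_cnj norm_power using a by simp
        also have "(deriv e z * cnj ((a * z) ^ m)) * cnj (deriv F z) = deriv e z * cnj (deriv g z)"
          unfolding derivg[OF z] complex_cnj_mult by (simp only: mult.assoc)
        finally have "2 * t * Re (deriv e z * cnj (deriv g z)) \<le> (norm z ^ m * norm (deriv e z))\<^sup>2 + t\<^sup>2 * (norm (deriv F z))\<^sup>2" .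
        from mult_right_mono[OF this weight_nonneg[OF z]] have
          le: "2 * t * Re (deriv e z * cnj (deriv g z)) * \<omega> z \<le>
            ((norm z ^ m * norm (deriv e z))\<^sup>2 + t\<^sup>2 * (norm (deriv F z))\<^sup>2) * \<omega> z" .
        have "Re (deriv e z * cnj (deriv g z) * of_real (\<omega> z)) = Re (deriv e z * cnj (deriv g z)) * \<omega> z"
          by simp
        with le show "2 * t * Re (deriv e z * cnj (deriv g z) * of_real (\<omega> z)) \<le>
          (norm z ^ m * norm (deriv e z))\<^sup>2 * \<omega> z + t\<^sup>2 * ((norm (deriv F z))\<^sup>2 * \<omega> z)"
          by (simp only: distrib_right mult.assoc)
      qed
      also have "\<dots> = (\<integral>z. (norm z ^ m * norm (deriv e z))\<^sup>2 * \<omega> z \<partial>disk_measure) + t\<^sup>2 * wint F"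
        unfolding wint_def using tail_integrable[OF e] D_integrable[OF F] by simp
      finally have "2 * t * ?p \<le> tail e m + t\<^sup>2 * coeff_norm_sq g + t\<^sup>2 * wint F"
        using 1 by (simp add: ip_eq[OF e gD] tail_def distrib_left)
      moreover have "t\<^sup>2 * coeff_norm_sq g \<le> t\<^sup>2 * coeff_norm_sq F"
        by (intro mult_left_mono cns_le) simp
      ultimately show "0 \<le> tail e m + 2 * t * (- ?p) + t\<^sup>2 * nsq F"
        by (simp add: nsq_def distrib_left)
    qed (rule nsq_nonneg[OF F])
    also have "\<dots> \<le> tail e m * (2 * N F)"
      by (intro mult_left_mono tail_nn) (simp add: N_def)
    finally have "\<bar>?p\<bar> \<le> sqrt (tail e m * (2 * N F))"
      by (intro real_le_rsqrt) simp
    \<comment> \<open>The factor 2 under the root is enlarged to 4; the resulting 2 cancels against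
      the 1/2 in \<open>br\<close>.\<close>
    also have "\<dots> \<le> sqrt (2\<^sup>2 * (tail e m * N F))"
      using tail_nn N_nonneg[OF F] by (intro real_sqrt_le_mono) simp
    also have "\<dots> = 2 * (sqrt (tail e m) * sqrt (N F))" by (simp add: real_sqrt_mult)
    finally show ?thesis by (simp add: br_def g00)
  qed
  with that[OF gD g00 dg NgF] show thesis by blast
qed

end

section \<open>Modified functions with a limit at the boundary point\<close>

lemma eventually_radius: "\<forall>\<^sub>F r::real in at_left 1. 0 < r \<and> r < 1"
  using eventually_at_left_real[of 0 1] by simp

lemma filterlim_radius:
  assumes "norm \<zeta> = 1"
  shows "filterlim (\<lambda>s. of_real s * \<zeta>) (at \<zeta> within unit_disk) (at_left (1::real))"
proof -
  have "((\<lambda>s. of_real s * \<zeta>) \<longlongrightarrow> of_real 1 * \<zeta>) (at_left (1::real))"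
    by (intro tendsto_intros)
  moreover have "\<zeta> \<noteq> 0" using assms by auto
  ultimately show ?thesis
    unfolding filterlim_at using eventually_radius assms
    by (auto elim!: eventually_mono simp: norm_mult)
qed

context dirichlet_weight
begin

text \<open>The binomial expansion of the factor writes \<open>G\<close> as \<open>F\<close> plus b
  damped primitives with coefficients of total size 2^b - 1, whence both factors 2^b. Boundedness of
  \<open>F\<close> serves the existence of the limit; the estimates are free of \<open>M\<close>, so
  the truncation level can be arbitrary.\<close>

lemma ex_continuous_transfer:
  assumes F: "F \<in> \<D>" "Im (F 0) = 0" and nn: "\<And>z. norm z < 1 \<Longrightarrow> 0 \<le> Re (F z)"
    and bd: "\<And>z. norm z < 1 \<Longrightarrow> norm (F z) \<le> M"
    and \<zeta>: "norm \<zeta> = 1" and k: "k \<ge> 1" and b: "b \<ge> 1"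
    and e: "e \<in> \<D>" and \<sigma>: "\<And>m. m \<ge> k \<Longrightarrow> sqrt (tail e m) \<le> \<sigma>"
    and s12: "0 < s1" "s1 < s2" "s2 < 1" and \<mu>: "\<And>s. s1 \<le> s \<Longrightarrow> s \<le> s2 \<Longrightarrow> \<mu> \<le> Re (F (of_real s * \<zeta>))"
  obtains G c where "G \<in> \<D>" "Im (G 0) = 0" "sqrt (N G) \<le> 2 ^ b * sqrt (N F)"
    "\<bar>br G e - br F e\<bar> \<le> 2 ^ b * \<sigma> * sqrt (N F)"
    "((\<lambda>z. Re (G z)) \<longlongrightarrow> c) (at \<zeta> within unit_disk)"
    "\<mu> * ((1 - s1 ^ k) ^ b - (1 - s2 ^ k) ^ b) \<le> c"
proof -
  define a where "a = cnj \<zeta>"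
  have a: "norm a = 1" by (simp add: a_def \<zeta>)
  have a\<zeta>: "a * \<zeta> = 1" using complex_norm_square[of \<zeta>] \<zeta> by (simp add: a_def mult.commute)
  have "\<forall>i. \<exists>g. g \<in> \<D> \<and> g 0 = 0 \<and> (\<forall>z. norm z < 1 \<longrightarrow> (g has_field_derivative (a * z) ^ (k * i) * deriv F z) (at z)) \<and>
    N g \<le> N F \<and> (\<forall>e\<in>\<D>. \<bar>br e g\<bar> \<le> sqrt (tail e (k * i)) * sqrt (N F))"
  proof
    fix i
    obtain g where "g \<in> \<D>" "g 0 = 0" "\<And>z. norm z < 1 \<Longrightarrow> (g has_field_derivative (a * z) ^ (k * i) * deriv F z) (at z)"
      "N g \<le> N F" "\<And>e. e \<in> \<D> \<Longrightarrow> \<bar>br e g\<bar> \<le> sqrt (tail e (k * i)) * sqrt (N F)"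
      by (rule ex_damped_primitive[OF F(1) a]) (rule that)
    then show "\<exists>g. g \<in> \<D> \<and> g 0 = 0 \<and> (\<forall>z. norm z < 1 \<longrightarrow> (g has_field_derivative (a * z) ^ (k * i) * deriv F z) (at z)) \<and>
      N g \<le> N F \<and> (\<forall>e\<in>\<D>. \<bar>br e g\<bar> \<le> sqrt (tail e (k * i)) * sqrt (N F))" by blast
  qed
  from choice[OF this] obtain g where g: "\<And>i. g i \<in> \<D>" "\<And>i. g i 0 = 0"
    and dg: "\<And>i z. norm z < 1 \<Longrightarrow> (g i has_field_derivative (a * z) ^ (k * i) * deriv F z) (at z)"
    and Ng: "\<And>i. N (g i) \<le> N F"
    and brg: "\<And>i e. e \<in> \<D> \<Longrightarrow> \<bar>br e (g i)\<bar> \<le> sqrt (tail e (k * i)) * sqrt (N F)"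
    by blast
  define \<beta> :: "nat \<Rightarrow> real" where "\<beta> i = (-1) ^ i * real (b choose i)" for i
  define S where "S z = (\<Sum>i\<in>{1..b}. of_real (\<beta> i) * g i z)" for z
  define G where "G z = F z + of_real 1 * S z" for z
  define B where "B z = (1 - (a * z) ^ k) ^ b" for z
  define B' where "B' z = of_nat b * (1 - (a * z) ^ k) ^ (b - 1) * (- (of_nat k * (a * z) ^ (k - 1) * a))" for z
  have beta_sum: "(\<Sum>i\<in>{1..b}. \<bar>\<beta> i\<bar>) = 2 ^ b - 1"
  proof -
    have "(\<Sum>i\<in>{1..b}. \<bar>\<beta> i\<bar>) = (\<Sum>i\<in>{1..b}. real (b choose i))"
      by (simp add: \<beta>_def abs_mult)
    also have "\<dots> = (\<Sum>i\<in>{0..b}. real (b choose i)) - 1"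
      by (simp add: sum.atLeast_Suc_atMost[of 0 b])
    also have "(\<Sum>i\<in>{0..b}. real (b choose i)) = 2 ^ b"
      using choose_row_sum[of b] by (simp add: atLeast0AtMost flip: of_nat_sum)
    finally show ?thesis .
  qed
  have B_expand: "1 + (\<Sum>i\<in>{1..b}. of_real (\<beta> i) * (a * z) ^ (k * i)) = B z" for z
  proof -
    have "B z = (- ((a * z) ^ k) + 1) ^ b" by (simp add: B_def)
    also have "\<dots> = (\<Sum>i\<le>b. of_nat (b choose i) * (- ((a * z) ^ k)) ^ i * 1 ^ (b - i))"
      by (rule binomial_ring)
    also have "\<dots> = (\<Sum>i\<in>{0..b}. of_real (\<beta> i) * (a * z) ^ (k * i))"
    proof (rule sum.cong)
      fix i
      have "(- ((a * z) ^ k)) ^ i = (-1) ^ i * (a * z) ^ (k * i)"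
        by (subst power_minus) (simp add: power_mult)
      then show "of_nat (b choose i) * (- ((a * z) ^ k)) ^ i * 1 ^ (b - i) = of_real (\<beta> i) * (a * z) ^ (k * i)"
        by (simp add: \<beta>_def)
    qed auto
    also have "\<dots> = 1 + (\<Sum>i\<in>{1..b}. of_real (\<beta> i) * (a * z) ^ (k * i))"
      by (simp add: sum.atLeast_Suc_atMost[of 0 b] \<beta>_def)
    finally show ?thesis by simp
  qed
  have SD: "S \<in> \<D>" unfolding S_def[abs_def] by (rule D_sum(1)) (auto intro: g)
  have GD: "G \<in> \<D>" unfolding G_def[abs_def] by (intro D_add F D_scale SD)
  have dF: "(F has_field_derivative deriv F z) (at z)" if "norm z < 1" for z
    using D_hol[OF F(1)] that by (auto intro: holomorphic_derivI)
  have dG: "(G has_field_derivative B z * deriv F z) (at z)" if z: "norm z < 1" for z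
  proof -
    have "(S has_field_derivative (\<Sum>i\<in>{1..b}. of_real (\<beta> i) * ((a * z) ^ (k * i) * deriv F z))) (at z)"
      unfolding S_def[abs_def] by (intro DERIV_sum DERIV_cmult dg z)
    then have "((\<lambda>z. F z + S z) has_field_derivative
        (deriv F z + (\<Sum>i\<in>{1..b}. of_real (\<beta> i) * ((a * z) ^ (k * i) * deriv F z)))) (at z)"
      by (intro DERIV_add dF z)
    moreover have "deriv F z + (\<Sum>i\<in>{1..b}. of_real (\<beta> i) * ((a * z) ^ (k * i) * deriv F z)) = B z * deriv F z"
      unfolding B_expand[symmetric] by (simp add: distrib_right sum_distrib_right mult.assoc)
    ultimately show ?thesis by (simp add: G_def[abs_def])
  qed
  have dB: "(B has_field_derivative B' z) (at z)" for z
    unfolding B_def[abs_def] B'_def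
    by (rule derivative_eq_intros refl | simp)+
  \<comment> \<open>At \<zeta> the product \<open>B z * F z\<close> tends to 0 because
    \<open>F\<close> is bounded and \<open>B\<close> vanishes there, so the limit of
    \<open>G\<close> is minus that of \<open>P\<close>, which is Lipschitz.\<close>
  define P where "P z = B z * F z - G z" for z
  have dP: "(P has_field_derivative B' z * F z) (at z)" if z: "norm z < 1" for z
  proof -
    have "(P has_field_derivative (B' z * F z + deriv F z * B z - B z * deriv F z)) (at z)"
      unfolding P_def[abs_def] by (intro DERIV_diff DERIV_mult dB dF dG z)
    then show ?thesis by (simp add: mult.commute)
  qed
  have P_hol: "P holomorphic_on unit_disk"
    unfolding holomorphic_on_open[OF open_ball] by (intro ballI exI, rule dP) simp
  have az: "norm (a * z) < 1" if "norm z < 1" for z using a that by (simp add: norm_mult)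
  have M0: "0 \<le> M" using order_trans[OF norm_ge_zero bd[of 0]] by simp
  have B'_bd: "norm (B' z) \<le> real b * 2 ^ (b - 1) * real k" if z: "norm z < 1" for z
  proof -
    have 1: "norm (1 - (a * z) ^ k) \<le> 2"
    proof -
      have "norm (1 - (a * z) ^ k) \<le> norm (1::complex) + norm ((a * z) ^ k)" by (rule norm_triangle_ineq4)
      also have "norm ((a * z) ^ k) \<le> 1" unfolding norm_power using az[OF z] by (intro power_le_one) auto
      finally show ?thesis by simp
    qed
    have "norm (B' z) = real b * norm (1 - (a * z) ^ k) ^ (b - 1) * (real k * norm (a * z) ^ (k - 1))"
      unfolding B'_def norm_mult norm_power norm_minus_cancel norm_of_nat a by simp
    also have "\<dots> \<le> real b * 2 ^ (b - 1) * (real k * 1)"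
      using az[OF z] 1 by (intro mult_mono power_mono power_le_one) auto
    finally show ?thesis by simp
  qed
  define C where "C = real b * 2 ^ (b - 1) * real k * M"
  have "C-lipschitz_on unit_disk P"
  proof (rule lipschitz_onI)
    show "0 \<le> C" using M0 by (simp add: C_def)
    fix x y assume xy: "x \<in> unit_disk" "y \<in> unit_disk"
    have "norm (P x - P y) \<le> C * norm (x - y)"
    proof (rule field_differentiable_bound[OF convex_ball _ _ xy])
      fix z assume "z \<in> unit_disk"
      then have z: "norm z < 1" by simp
      show "(P has_field_derivative B' z * F z) (at z within unit_disk)"
        by (rule has_field_derivative_at_within[OF dP[OF z]])
      show "norm (B' z * F z) \<le> C"
        unfolding norm_mult C_def by (intro mult_mono B'_bd bd z) auto
    qed
    then show "dist (P x) (P y) \<le> C * dist x y" by (simp add: dist_norm)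
  qed
  then have "uniformly_continuous_on unit_disk P" by (rule lipschitz_on_uniformly_continuous)
  moreover have "\<zeta> \<in> closure unit_disk" using \<zeta> by (simp add: closure_ball)
  ultimately obtain l where l: "(P \<longlongrightarrow> l) (at \<zeta> within unit_disk)"
    by (rule uniformly_continuous_on_extension_at_closure)
  have B\<zeta>: "B \<zeta> = 0" using b k by (simp add: B_def a\<zeta>)
  have BF: "((\<lambda>z. B z * F z) \<longlongrightarrow> 0) (at \<zeta> within unit_disk)"
  proof (rule Lim_null_comparison)
    show "\<forall>\<^sub>F z in at \<zeta> within unit_disk. norm (B z * F z) \<le> norm (B z) * M"
      unfolding eventually_at by (intro exI[of _ 1]) (auto simp: norm_mult intro!: mult_left_mono bd)
    have "isCont B \<zeta>" using dB by (rule DERIV_isCont)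
    then have "(B \<longlongrightarrow> 0) (at \<zeta> within unit_disk)"
      using B\<zeta> by (metis continuous_at_imp_continuous_at_within continuous_within)
    then have "((\<lambda>z. norm (B z) * M) \<longlongrightarrow> norm (0::complex) * M) (at \<zeta> within unit_disk)"
      by (intro tendsto_intros)
    then show "((\<lambda>z. norm (B z) * M) \<longlongrightarrow> 0) (at \<zeta> within unit_disk)" by simp
  qed
  define c where "c = - Re l"
  have G_lim: "((\<lambda>z. Re (G z)) \<longlongrightarrow> c) (at \<zeta> within unit_disk)"
  proof -
    have "((\<lambda>z. Re (B z * F z - P z)) \<longlongrightarrow> Re (0 - l)) (at \<zeta> within unit_disk)"
      by (intro tendsto_intros BF l)
    then show ?thesis by (simp add: P_def c_def)
  qed
  define \<phi> where "\<phi> s = - Re (P (of_real s * \<zeta>))" for s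
  \<comment> \<open>The derivative of 1 - (1 - s^k)^b, hence a probability density on [0, 1). The
    limit \<open>c\<close> is the average of \<open>U\<close> against it, and only the part over
    [s1, s2] is kept for the lower bound.\<close>
  define q where "q s = real b * real k * s ^ (k - 1) * (1 - s ^ k) ^ (b - 1)" for s :: real
  define U where "U s = Re (F (of_real s * \<zeta>))" for s
  have U0: "0 \<le> U s" if "0 \<le> s" "s < 1" for s
    unfolding U_def by (rule nn) (use that \<zeta> in \<open>simp add: norm_mult\<close>)
  have q0: "0 \<le> q s" if "0 \<le> s" "s < 1" for s
    unfolding q_def using that by (intro mult_nonneg_nonneg zero_le_power) (auto simp: power_le_one)
  have d\<phi>: "(\<phi> has_real_derivative q s * U s) (at s)" if s: "0 \<le> s" "s < 1" for s
  proof -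
    have ns: "norm (of_real s * \<zeta>) < 1" using s \<zeta> by (simp add: norm_mult)
    have as: "a * (of_real s * \<zeta>) = of_real s" using a\<zeta> by (metis mult.left_commute mult.right_neutral)
    have "\<zeta> * deriv P (of_real s * \<zeta>) = of_real (- q s) * F (of_real s * \<zeta>)"
    proof -
      have "\<zeta> * deriv P (of_real s * \<zeta>) = \<zeta> * (B' (of_real s * \<zeta>) * F (of_real s * \<zeta>))"
        using DERIV_imp_deriv[OF dP[OF ns]] by simp
      also have "\<dots> = (- (of_nat b * (1 - of_real s ^ k) ^ (b - 1) * (of_nat k * of_real s ^ (k - 1)))) * (a * \<zeta>) * F (of_real s * \<zeta>)"
        unfolding B'_def as by (simp add: mult_ac)
      also have "\<dots> = of_real (- q s) * F (of_real s * \<zeta>)"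
        unfolding a\<zeta> q_def by (simp add: mult_ac)
      finally show ?thesis .
    qed
    then have re: "Re (\<zeta> * deriv P (of_real s * \<zeta>)) = - (q s * U s)" by (simp add: U_def)
    show ?thesis
      using DERIV_minus[OF Re_radial_derivative[OF P_hol \<zeta> s]] unfolding re \<phi>_def[abs_def] by simp
  qed
  have mono: "\<phi> x \<le> \<phi> y" if "0 \<le> x" "x \<le> y" "y < 1" for x y
    by (rule DERIV_nonneg_imp_nondecreasing[OF that(2)])
      (use that in \<open>auto intro!: exI conjI d\<phi> mult_nonneg_nonneg q0 U0\<close>)
  \<comment> \<open>\<open>k \<ge> 1\<close> gives \<open>B 0 = 1\<close>, and
    \<open>G 0 = F 0\<close> since the damped primitives vanish at 0.\<close>
  have \<phi>0: "\<phi> 0 = 0" using k by (simp add: \<phi>_def P_def B_def G_def S_def g power_0_left)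
  have "\<phi> s1 + \<mu> * (1 - s1 ^ k) ^ b \<le> \<phi> s2 + \<mu> * (1 - s2 ^ k) ^ b"
  proof (rule DERIV_nonneg_imp_nondecreasing[where f = "\<lambda>s. \<phi> s + \<mu> * (1 - s ^ k) ^ b"])
    fix s assume s: "s1 \<le> s" "s \<le> s2"
    then have s': "0 \<le> s" "s < 1" using s12 by auto
    have "((\<lambda>s. (1 - s ^ k) ^ b) has_real_derivative - q s) (at s)"
      unfolding q_def by (rule derivative_eq_intros refl | simp)+
    then have "((\<lambda>s. \<phi> s + \<mu> * (1 - s ^ k) ^ b) has_real_derivative (q s * U s + \<mu> * - q s)) (at s)"
      by (intro DERIV_add d\<phi> s' DERIV_cmult)
    moreover have "0 \<le> q s * U s + \<mu> * - q s"
      using mult_left_mono[OF \<mu>[OF s] q0[OF s']] by (simp add: U_def mult.commute)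
    ultimately show "\<exists>y. ((\<lambda>s. \<phi> s + \<mu> * (1 - s ^ k) ^ b) has_real_derivative y) (at s) \<and> 0 \<le> y" by blast
  qed (use s12 in simp)
  with mono[of 0 s1] \<phi>0 s12 have \<phi>s2: "\<mu> * ((1 - s1 ^ k) ^ b - (1 - s2 ^ k) ^ b) \<le> \<phi> s2"
    by (simp add: algebra_simps)
  have "(\<phi> \<longlongrightarrow> c) (at_left 1)"
  proof -
    from filterlim_compose[OF l filterlim_radius[OF \<zeta>]]
    have "((\<lambda>s. P (of_real s * \<zeta>)) \<longlongrightarrow> l) (at_left 1)" .
    then show ?thesis unfolding \<phi>_def c_def by (intro tendsto_intros)
  qed
  then have "\<phi> s2 \<le> c"
  proof (rule tendsto_lowerbound)
    have "\<forall>\<^sub>F s in at_left 1. s2 \<le> s \<and> s < 1"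
      using eventually_at_left_real[OF s12(3)] by eventually_elim auto
    then show "\<forall>\<^sub>F s in at_left 1. \<phi> s2 \<le> \<phi> s"
      by eventually_elim (use mono s12 in auto)
  qed simp
  with \<phi>s2 have c_ge: "\<mu> * ((1 - s1 ^ k) ^ b - (1 - s2 ^ k) ^ b) \<le> c" by simp
  have X0: "0 \<le> sqrt (N F)" using N_nonneg[OF F(1)] by simp
  have NG: "sqrt (N G) \<le> 2 ^ b * sqrt (N F)"
  proof -
    have "sqrt (N S) \<le> (\<Sum>i\<in>{1..b}. \<bar>\<beta> i\<bar> * sqrt (N (g i)))"
      unfolding S_def[abs_def] by (rule D_sum(3)) (auto intro: g)
    also have "\<dots> \<le> (\<Sum>i\<in>{1..b}. \<bar>\<beta> i\<bar> * sqrt (N F))"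
      by (intro sum_mono mult_left_mono real_sqrt_le_mono Ng) auto
    also have "\<dots> = (2 ^ b - 1) * sqrt (N F)" unfolding sum_distrib_right[symmetric] beta_sum ..
    finally have "sqrt (N S) \<le> (2 ^ b - 1) * sqrt (N F)" .
    moreover have "sqrt (N G) \<le> sqrt (N F) + \<bar>1\<bar> * sqrt (N S)"
      unfolding G_def[abs_def] by (rule sqrt_N_triangle[OF F(1) SD])
    ultimately show ?thesis by (simp add: algebra_simps)
  qed
  have \<sigma>0: "0 \<le> \<sigma>"
  proof -
    have "0 \<le> tail e k"
      unfolding tail_def
      by (intro add_nonneg_nonneg suminf_nonneg summable_ignore_initial_segment D_coeff e integral_nonneg_AE AE_I2)
        (auto simp: weight_nonneg)
    with \<sigma>[of k] show ?thesis by (meson order_refl order_trans real_sqrt_ge_zero)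
  qed
  have brG: "\<bar>br G e - br F e\<bar> \<le> 2 ^ b * \<sigma> * sqrt (N F)"
  proof -
    have S1: "(\<lambda>z. of_real 1 * S z) \<in> \<D>" by (rule D_scale[OF SD])
    have "br G e = br F e + 1 * br S e"
      unfolding G_def[abs_def] by (simp only: br_add_left[OF F(1) S1 e] br_scale_left[OF SD e])
    then have "br G e - br F e = (\<Sum>i\<in>{1..b}. \<beta> i * br (g i) e)"
      unfolding S_def[abs_def] using D_sum(2)[of "{1..b}" g e \<beta>] g(1) e by simp
    also have "\<bar>\<dots>\<bar> \<le> (\<Sum>i\<in>{1..b}. \<bar>\<beta> i * br (g i) e\<bar>)" by (rule sum_abs)
    also have "\<dots> \<le> (\<Sum>i\<in>{1..b}. \<bar>\<beta> i\<bar> * (\<sigma> * sqrt (N F)))"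
    proof (rule sum_mono)
      fix i assume "i \<in> {1..b}"
      then have "k \<le> k * i" by simp
      have "\<bar>br (g i) e\<bar> \<le> sqrt (tail e (k * i)) * sqrt (N F)"
        unfolding br_commute[OF g(1) e] by (rule brg[OF e])
      also have "\<dots> \<le> \<sigma> * sqrt (N F)"
        by (intro mult_right_mono \<sigma> X0 \<open>k \<le> k * i\<close>)
      finally show "\<bar>\<beta> i * br (g i) e\<bar> \<le> \<bar>\<beta> i\<bar> * (\<sigma> * sqrt (N F))"
        unfolding abs_mult by (intro mult_left_mono) auto
    qed
    also have "\<dots> = (2 ^ b - 1) * (\<sigma> * sqrt (N F))" unfolding sum_distrib_right[symmetric] beta_sum ..
    also have "\<dots> \<le> 2 ^ b * (\<sigma> * sqrt (N F))"
      by (intro mult_right_mono mult_nonneg_nonneg \<sigma>0 X0) simp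
    finally show ?thesis by (simp add: mult.assoc)
  qed
  have "Im (G 0) = 0" by (simp add: G_def S_def g F)
  with GD NG brG G_lim c_ge show thesis using that by blast
qed

end

subsection \<open>Radial limit of the kernel\<close>

text \<open>In y = s^k the density b (1 - y)^(b-1) lives at scale 1/b. With b = n the window from 1
  / (n ln n) to ln n / n catches almost all of its mass, since the two powers behave like exp (- 1 /
  ln n) and 1 / n, while both logarithms are asymptotic to - ln n.\<close>

lemma ex_sharp_cutoff:
  assumes \<eta>: "0 < \<eta>"
  obtains b :: nat and y1 y2 :: real where "1 \<le> b" "0 < y1" "y1 < y2" "y2 < 1"
    "1 - \<eta> \<le> (1 - y1) ^ b - (1 - y2) ^ b" "1 - \<eta> \<le> ln y2 / ln y1"
proof -
  let ?y1 = "\<lambda>n::nat. 1 / (real n * ln (real n))" and ?y2 = "\<lambda>n::nat. ln (real n) / real n"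
  have "(\<lambda>n. (1 - ?y1 n) ^ n - (1 - ?y2 n) ^ n) \<longlonglongrightarrow> 1"
    by real_asymp
  then have 1: "\<forall>\<^sub>F n in sequentially. 1 - \<eta> < (1 - ?y1 n) ^ n - (1 - ?y2 n) ^ n"
    by (rule order_tendstoD(1)) (use \<eta> in simp)
  have "(\<lambda>n. ln (?y2 n) / ln (?y1 n)) \<longlonglongrightarrow> 1"
    by real_asymp
  then have 2: "\<forall>\<^sub>F n in sequentially. 1 - \<eta> < ln (?y2 n) / ln (?y1 n)"
    by (rule order_tendstoD(1)) (use \<eta> in simp)
  have 3: "\<forall>\<^sub>F n in sequentially. 0 < ?y1 n" "\<forall>\<^sub>F n in sequentially. ?y1 n < ?y2 n"
    "\<forall>\<^sub>F n in sequentially. ?y2 n < 1"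
    by real_asymp+
  have "\<forall>\<^sub>F n in sequentially. 1 \<le> n \<and> 0 < ?y1 n \<and> ?y1 n < ?y2 n \<and> ?y2 n < 1 \<and>
      1 - \<eta> < (1 - ?y1 n) ^ n - (1 - ?y2 n) ^ n \<and> 1 - \<eta> < ln (?y2 n) / ln (?y1 n)"
    using 1 2 3 eventually_ge_at_top[of 1] by eventually_elim auto
  then obtain n where "1 \<le> n \<and> 0 < ?y1 n \<and> ?y1 n < ?y2 n \<and> ?y2 n < 1 \<and>
      1 - \<eta> < (1 - ?y1 n) ^ n - (1 - ?y2 n) ^ n \<and> 1 - \<eta> < ln (?y2 n) / ln (?y1 n)"
    by (auto dest!: eventually_happens)
  then show thesis by (intro that[of n "?y1 n" "?y2 n"]) auto
qed

context dirichlet_weight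
begin

section \<open>Two-sided bounds for the kernel near the boundary point\<close>

lemma kernel_lower:
  assumes dw: "douglas_weight \<omega>" and \<zeta>: "norm \<zeta> = 1" and cap: "capacity \<omega> {\<zeta>} = ennreal C" "0 \<le> C"
    and \<epsilon>: "0 < \<epsilon>" and \<eta>: "0 < \<eta>"
  shows "\<forall>\<^sub>F r in at_left 1. 1 - \<eta> \<le> sqrt (\<kappa> (of_real r * \<zeta>)) * sqrt (C + \<epsilon>)"
proof -
  have "capacity \<omega> {\<zeta>} < ennreal (C + \<epsilon>)"
    unfolding cap using cap(2) \<epsilon> by (simp add: ennreal_less_iff)
  then obtain e where e: "e \<in> \<D>" "Im (e 0) = 0" "ennreal (N e) < ennreal (C + \<epsilon>)"
    "((\<lambda>z. Re (e z)) \<longlongrightarrow> 1) (at \<zeta> within unit_disk)"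
    by (rule near_minimizer[OF dw \<zeta>]) (rule that)
  have Ne: "N e \<le> C + \<epsilon>" using e(3) cap(2) \<epsilon> N_nonneg[OF e(1)]
    by (simp add: ennreal_less_iff del: ennreal_plus)
  from filterlim_compose[OF e(4) filterlim_radius[OF \<zeta>]] have "((\<lambda>s. Re (e (of_real s * \<zeta>))) \<longlongrightarrow> 1) (at_left 1)" .
  then have "\<forall>\<^sub>F r in at_left 1. 1 - \<eta> < Re (e (of_real r * \<zeta>))"
    by (rule order_tendstoD(1)) (use \<eta> in simp)
  then show ?thesis
    using eventually_radius
  proof eventually_elim
    case (elim r)
    then have w: "norm (of_real r * \<zeta>) < 1" using \<zeta> by (simp add: norm_mult)
    have "1 - \<eta> \<le> \<bar>Re (e (of_real r * \<zeta>))\<bar>" using elim by simp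
    also have "\<dots> \<le> sqrt (\<kappa> (of_real r * \<zeta>)) * sqrt (N e)" by (rule eval_le_kernel[OF w e(1)])
    also have "\<dots> \<le> sqrt (\<kappa> (of_real r * \<zeta>)) * sqrt (C + \<epsilon>)"
      using kernel_ge_1[OF w] Ne by (intro mult_left_mono real_sqrt_le_mono) auto
    finally show ?case .
  qed
qed

text \<open>The order of choices matters: \<open>b\<close>, \<open>y1\<close>, \<open>y2\<close>
  come from \<eta>; then \<sigma>, which absorbs 2^b; then the near-minimiser \<open>e\<close> and
  the threshold \<open>k0\<close>; then the radius \<open>r\<close>, which fixes \<open>k\<close>;
  and finally \<epsilon> with its function \<open>F\<close>.\<close>

lemma kernel_upper:
  assumes dw: "douglas_weight \<omega>" and \<zeta>: "norm \<zeta> = 1" and cap: "capacity \<omega> {\<zeta>} = ennreal C" "0 < C"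
    and \<eta>: "0 < \<eta>" "\<eta> < 1"
  shows "\<forall>\<^sub>F r in at_left 1. (1 - \<eta>) ^ 3 * sqrt C * sqrt (\<kappa> (of_real r * \<zeta>)) \<le> 1 + \<eta>"
proof -
  obtain b :: nat and y1 y2 :: real where b: "1 \<le> b" and y: "0 < y1" "y1 < y2" "y2 < 1"
    and yb: "1 - \<eta> \<le> (1 - y1) ^ b - (1 - y2) ^ b" and yl: "1 - \<eta> \<le> ln y2 / ln y1"
    by (rule ex_sharp_cutoff[OF \<eta>(1)]) (rule that)
  \<comment> \<open>Two errors of size 2^b \<sigma> X arise, one from replacing \<open>F\<close> by
    \<open>G\<close> in the pairing and one from near-minimality. This \<sigma> makes their sum
    \<eta> sqrt C X.\<close>
  define \<sigma> where "\<sigma> = \<eta> * sqrt C / 2 ^ (b + 1)"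
  have \<sigma>: "0 < \<sigma>" using \<eta> cap by (simp add: \<sigma>_def)
  have \<sigma>_eq: "2 ^ (b + 1) * \<sigma> = \<eta> * sqrt C" by (simp add: \<sigma>_def)
  have \<sigma>_le: "\<sigma> \<le> \<eta> * sqrt C"
  proof -
    have "1 * \<sigma> \<le> 2 ^ (b + 1) * \<sigma>" using \<sigma> by (intro mult_right_mono one_le_power) auto
    then show ?thesis using \<sigma>_eq by simp
  qed
  have "capacity \<omega> {\<zeta>} < ennreal (C + \<sigma>\<^sup>2)"
    unfolding cap using cap(2) \<sigma> by (simp add: ennreal_less_iff)
  then obtain e where e: "e \<in> \<D>" "Im (e 0) = 0" "ennreal (N e) < ennreal (C + \<sigma>\<^sup>2)"
    and e_lim: "((\<lambda>z. Re (e z)) \<longlongrightarrow> 1) (at \<zeta> within unit_disk)"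
    by (rule near_minimizer[OF dw \<zeta>]) (rule that)
  define n where "n = N e"
  have n_less: "n < C + \<sigma>\<^sup>2" using e(3) cap(2) N_nonneg[OF e(1)]
    by (simp add: n_def ennreal_less_iff del: ennreal_plus)
  have C_le: "C \<le> N H" if "H \<in> \<D>" "Im (H 0) = 0" "((\<lambda>z. Re (H z)) \<longlongrightarrow> 1) (at \<zeta> within unit_disk)" for H
    using capacity_le[OF \<zeta> that] cap N_nonneg[OF that(1)] by simp
  have n_ge: "C \<le> n" unfolding n_def by (rule C_le[OF e(1,2) e_lim])
  have "\<forall>\<^sub>F m in sequentially. tail e m < \<sigma>\<^sup>2"
    by (rule order_tendstoD(2)[OF tail_tendsto_0[OF e(1)]]) (use \<sigma> in simp)
  then obtain k0 where k0: "\<And>m. m \<ge> k0 \<Longrightarrow> tail e m < \<sigma>\<^sup>2" by (auto simp: eventually_sequentially)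
  have tail_le: "sqrt (tail e m) \<le> \<sigma>" if "m \<ge> k0" for m
    using k0[OF that] \<sigma> by (intro real_le_lsqrt) auto
  have "((\<lambda>r::real. r ^ k0) \<longlongrightarrow> 1 ^ k0) (at_left 1)" by (intro tendsto_intros)
  then have "\<forall>\<^sub>F r::real in at_left 1. y2 < r ^ k0"
    by (rule order_tendstoD(1)) (use y in simp)
  moreover have "\<forall>\<^sub>F r::real in at_left 1. y1 / y2 < r"
    using eventually_at_left_real[of "y1 / y2" 1] y by (auto elim: eventually_mono)
  ultimately show ?thesis
    using eventually_radius
  proof eventually_elim
    case (elim r)
    define w where "w = of_real r * \<zeta>"
    have w: "norm w < 1" using elim \<zeta> by (simp add: w_def norm_mult)
    have K1: "1 \<le> \<kappa> w" by (rule kernel_ge_1[OF w])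
    have "\<exists>k. r ^ k < y2" using elim y by (intro real_arch_pow_inv) auto
    then have ex: "\<exists>k. r ^ k \<le> y2" by (auto intro: less_imp_le)
    \<comment> \<open>Minimality gives r^k \<ge> r y2 \<ge> y1, so \<open>r\<close> lies between the
      k-th roots of \<open>y1\<close> and \<open>y2\<close>; and \<open>y2 < r ^ k0\<close> forces k
      > k0, where the tails of \<open>e\<close> are small.\<close>
    define k where "k = (LEAST k. r ^ k \<le> y2)"
    have rk: "r ^ k \<le> y2" unfolding k_def using ex by (rule LeastI_ex)
    have kk0: "k0 < k"
    proof (rule ccontr)
      assume "\<not> k0 < k"
      then have "r ^ k0 \<le> r ^ k" using elim by (intro power_decreasing) auto
      with rk elim show False by simp
    qed
    then have k: "1 \<le> k" by simp
    have "\<not> r ^ (k - 1) \<le> y2" unfolding k_def using k by (intro not_less_Least) (simp add: k_def)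
    then have "r * y2 \<le> r * r ^ (k - 1)" using elim by (intro mult_left_mono) auto
    also have "\<dots> = r ^ k" using k by (simp flip: power_Suc)
    finally have rk1: "y1 \<le> r ^ k" using elim y by (simp add: field_simps)
    define s1 where "s1 = root k y1"
    define s2 where "s2 = root k y2"
    have s1k: "s1 ^ k = y1" and s2k: "s2 ^ k = y2" using k y by (simp_all add: s1_def s2_def real_root_pow_pos2)
    have s: "0 < s1" "s1 < s2" "s2 < 1" using k y by (simp_all add: s1_def s2_def)
    have rr: "root k (r ^ k) = r" using k elim by (intro real_root_power_cancel) auto
    have s1r: "s1 \<le> r" using real_root_le_mono[OF _ rk1, of k] k rr by (simp add: s1_def)
    have rs2: "r \<le> s2" using real_root_le_mono[OF _ rk, of k] k rr by (simp add: s2_def)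
    define \<tau> where "\<tau> = ln s2 / ln s1"
    have \<tau>: "1 - \<eta> \<le> \<tau>"
      using yl k y by (simp add: \<tau>_def s1_def s2_def ln_root)
    have key: "(1 - \<eta>) ^ 3 * sqrt C * (\<kappa> w - \<epsilon>) \<le> (1 + \<eta>) * sqrt (\<kappa> w)" if \<epsilon>: "0 < \<epsilon>" "\<epsilon> < 1" for \<epsilon>
    proof -
      obtain F M where F: "F \<in> \<D>" "Im (F 0) = 0" and nn: "\<And>z. norm z < 1 \<Longrightarrow> 0 \<le> Re (F z)"
        and bd: "\<And>z. norm z < 1 \<Longrightarrow> norm (F z) \<le> M" and NF: "N F \<le> \<kappa> w" and Fw: "\<kappa> w - \<epsilon> \<le> Re (F w)"
        by (rule ex_bounded_positive_function[OF dw w \<epsilon>(1)]) (rule that)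
      define X where "X = sqrt (N F)"
      have X0: "0 \<le> X" using N_nonneg[OF F(1)] by (simp add: X_def)
      obtain G c where G: "G \<in> \<D>" "Im (G 0) = 0" "sqrt (N G) \<le> 2 ^ b * sqrt (N F)"
        "\<bar>br G e - br F e\<bar> \<le> 2 ^ b * \<sigma> * sqrt (N F)"
        "((\<lambda>z. Re (G z)) \<longlongrightarrow> c) (at \<zeta> within unit_disk)"
        "(\<tau> * Re (F w)) * ((1 - s1 ^ k) ^ b - (1 - s2 ^ k) ^ b) \<le> c"
      proof (rule ex_continuous_transfer[OF F nn bd \<zeta> k b e(1) _ s, where \<mu> = "\<tau> * Re (F w)"])
        show "sqrt (tail e m) \<le> \<sigma>" if "k \<le> m" for m using that kk0 by (intro tail_le) simp
        show "\<tau> * Re (F w) \<le> Re (F (of_real s * \<zeta>))" if "s1 \<le> s" "s \<le> s2" for s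
          unfolding \<tau>_def w_def
          by (rule harnack_radius[OF D_hol[OF F(1)] nn \<zeta> s(1) that s1r rs2 s(3)])
      qed (simp, simp, rule that)
      \<comment> \<open>One factor \<open>1 - \<eta>\<close> is Harnack's constant, the other the
        mass of the density over the window. The third one in \<open>key\<close> arises when
        \<open>sqrt n - \<sigma>\<close> is replaced by
        \<open>(1 - \<eta>) * sqrt C\<close>.\<close>
      have c_ge: "(1 - \<eta>) ^ 2 * (\<kappa> w - \<epsilon>) \<le> c"
      proof -
        have "(1 - \<eta>) * (\<kappa> w - \<epsilon>) \<le> \<tau> * Re (F w)"
          using \<tau> Fw \<eta> K1 \<epsilon> by (intro mult_mono) auto
        then have "((1 - \<eta>) * (\<kappa> w - \<epsilon>)) * (1 - \<eta>) \<le> (\<tau> * Re (F w)) * ((1 - s1 ^ k) ^ b - (1 - s2 ^ k) ^ b)"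
        proof (rule mult_mono)
          show "0 \<le> \<tau> * Re (F w)" using \<tau> Fw \<eta> K1 \<epsilon> by (intro mult_nonneg_nonneg) auto
        qed (use yb \<eta> in \<open>auto simp: s1k s2k\<close>)
        with G(6) show ?thesis by (simp add: power2_eq_square mult_ac)
      qed
      have c0: "0 \<le> c" using c_ge K1 \<epsilon> by (intro order_trans[OF _ c_ge] mult_nonneg_nonneg) auto
      \<comment> \<open>Re h tends to 0 at \<zeta>, so \<open>e\<close> plus any real multiple of
        \<open>h\<close> still has limit 1 and its \<open>N\<close> is at least \<open>C\<close>.
        The discriminant lemma then makes \<open>h\<close> nearly orthogonal to \<open>e\<close>,
        that is, \<open>br G e\<close> is nearly \<open>c * n\<close>.\<close>
      define h where "h z = G z + of_real (- c) * e z" for z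
      have hD: "h \<in> \<D>" unfolding h_def[abs_def] by (intro D_add D_scale G e)
      have ce: "(\<lambda>z. of_real (- c) * e z) \<in> \<D>" by (rule D_scale[OF e(1)])
      have brh: "br h e = br G e - c * n"
        unfolding h_def[abs_def] br_add_left[OF G(1) ce e(1)] br_scale_left[OF e(1) e(1)]
        by (simp add: n_def br_self[OF e(1)])
      have "(br h e)\<^sup>2 \<le> (n - C) * N h"
      proof (rule nonneg_quadratic_imp_discriminant)
        fix t :: real
        let ?H = "\<lambda>z. e z + of_real t * h z"
        have "((\<lambda>z. Re (e z) + t * (Re (G z) - c * Re (e z))) \<longlongrightarrow> 1 + t * (c - c * 1)) (at \<zeta> within unit_disk)"
          by (intro tendsto_intros e_lim G)
        then have "((\<lambda>z. Re (?H z)) \<longlongrightarrow> 1) (at \<zeta> within unit_disk)"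
          by (simp add: h_def)
        moreover have "?H \<in> \<D>" by (intro D_add D_scale e hD)
        moreover have "Im (?H 0) = 0" by (simp add: h_def e G)
        ultimately have "C \<le> N ?H" by (intro C_le)
        then show "0 \<le> (n - C) + 2 * t * br h e + t\<^sup>2 * N h"
          by (simp add: N_add_scale[OF e(1) hD] n_def)
      qed (rule N_nonneg[OF hD])
      also have "\<dots> \<le> \<sigma>\<^sup>2 * N h"
        using n_less N_nonneg[OF hD] by (intro mult_right_mono) auto
      finally have "\<bar>br h e\<bar> \<le> sqrt (\<sigma>\<^sup>2 * N h)" by (intro real_le_rsqrt) simp
      also have "\<dots> = \<sigma> * sqrt (N h)" using \<sigma> by (simp add: real_sqrt_mult)
      also have "\<dots> \<le> \<sigma> * (2 ^ b * X + c * sqrt n)"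
      proof -
        have "sqrt (N h) \<le> sqrt (N G) + \<bar>- c\<bar> * sqrt (N e)"
          unfolding h_def[abs_def] by (rule sqrt_N_triangle[OF G(1) e(1)])
        with G(3) c0 have "sqrt (N h) \<le> 2 ^ b * X + c * sqrt n" by (simp add: X_def n_def)
        then show ?thesis using \<sigma> by (intro mult_left_mono) auto
      qed
      finally have 1: "c * n \<le> br G e + \<sigma> * (2 ^ b * X + c * sqrt n)" using brh by linarith
      have "br G e \<le> br F e + 2 ^ b * \<sigma> * X" using G(4) by (simp add: X_def abs_le_iff)
      also have "br F e \<le> X * sqrt n"
        using br_cauchy_schwarz[OF F(1) e(1)] by (simp add: X_def n_def abs_le_iff)
      finally have 2: "br G e \<le> X * sqrt n + 2 ^ b * \<sigma> * X" by simp
      have n0: "0 < sqrt n" using n_ge cap(2) by simp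
      have nn': "n = sqrt n * sqrt n" using n0 by simp
      have "c * n \<le> X * sqrt n + 2 ^ b * \<sigma> * X + \<sigma> * (2 ^ b * X + c * sqrt n)" using 1 2 by linarith
      then have "c * (sqrt n * (sqrt n - \<sigma>)) \<le> X * (sqrt n + 2 ^ (b + 1) * \<sigma>)"
        by (subst (asm) nn') (simp add: algebra_simps)
      also have "\<dots> \<le> X * (sqrt n + \<eta> * sqrt n)"
        unfolding \<sigma>_eq using n_ge \<eta> X0 by (intro mult_left_mono add_left_mono real_sqrt_le_mono) auto
      finally have "sqrt n * (c * (sqrt n - \<sigma>)) \<le> sqrt n * (X * (1 + \<eta>))" by (simp add: algebra_simps)
      then have 3: "c * (sqrt n - \<sigma>) \<le> X * (1 + \<eta>)" using n0 by simp
      have "(1 - \<eta>) * sqrt C \<le> sqrt n - \<sigma>"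
      proof -
        have "sqrt C \<le> sqrt n" using n_ge by simp
        with \<sigma>_le show ?thesis by (simp add: algebra_simps del: real_sqrt_le_iff)
      qed
      then have "((1 - \<eta>) ^ 2 * (\<kappa> w - \<epsilon>)) * ((1 - \<eta>) * sqrt C) \<le> c * (sqrt n - \<sigma>)"
        using c_ge c0 \<eta> cap(2) by (intro mult_mono) auto
      also note 3
      also have "X * (1 + \<eta>) \<le> sqrt (\<kappa> w) * (1 + \<eta>)"
        using NF \<eta> by (intro mult_right_mono) (auto simp: X_def)
      finally show ?thesis by (simp add: power3_eq_cube power2_eq_square mult_ac)
    qed
    \<comment> \<open>\<open>F\<close> depends on \<epsilon>, but the inequality \<open>key\<close>
      no longer mentions it, so \<epsilon> may tend to 0.\<close>
    have "(1 - \<eta>) ^ 3 * sqrt C * \<kappa> w \<le> (1 + \<eta>) * sqrt (\<kappa> w)"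
    proof (rule tendsto_upperbound)
      show "((\<lambda>\<epsilon>. (1 - \<eta>) ^ 3 * sqrt C * (\<kappa> w - \<epsilon>)) \<longlongrightarrow> (1 - \<eta>) ^ 3 * sqrt C * \<kappa> w) (at_right 0)"
        by (auto intro!: tendsto_eq_intros)
      show "\<forall>\<^sub>F \<epsilon> in at_right 0. (1 - \<eta>) ^ 3 * sqrt C * (\<kappa> w - \<epsilon>) \<le> (1 + \<eta>) * sqrt (\<kappa> w)"
        using eventually_at_right_real[of 0 1] by (auto elim!: eventually_mono intro: key)
    qed simp
    then have "sqrt (\<kappa> w) * ((1 - \<eta>) ^ 3 * sqrt C * sqrt (\<kappa> w)) \<le> sqrt (\<kappa> w) * (1 + \<eta>)"
      using K1 by (simp add: mult_ac flip: real_sqrt_mult)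
    moreover have "0 < sqrt (\<kappa> w)" using K1 by simp
    ultimately have "(1 - \<eta>) ^ 3 * sqrt C * sqrt (\<kappa> w) \<le> 1 + \<eta>"
      by (simp only: mult_le_cancel_left_pos)
    then show ?case by (simp add: w_def)
  qed
qed

lemma kernel_limit_zero:
  assumes dw: "douglas_weight \<omega>" and \<zeta>: "norm \<zeta> = 1" and cap: "capacity \<omega> {\<zeta>} = 0"
  shows "filterlim (\<lambda>r. \<kappa> (of_real r * \<zeta>)) at_top (at_left 1)"
  unfolding filterlim_at_top
proof
  fix Z :: real
  \<comment> \<open>Raising Z to at least 1 makes 1 / (4 Y) a legitimate tolerance; with 1/2 on the
    left, squaring turns the lower bound into 1/4 \<le> \<kappa> / (4 Y).\<close>
  define Y where "Y = max Z 1"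
  have Y: "0 < Y" "Z \<le> Y" by (auto simp: Y_def)
  have "\<forall>\<^sub>F r in at_left 1. 1 - 1 / 2 \<le> sqrt (\<kappa> (of_real r * \<zeta>)) * sqrt (0 + 1 / (4 * Y))"
    by (rule kernel_lower[OF dw \<zeta>]) (use cap Y in auto)
  then show "\<forall>\<^sub>F r in at_left 1. Z \<le> \<kappa> (of_real r * \<zeta>)"
    using eventually_radius
  proof eventually_elim
    case (elim r)
    then have w: "norm (of_real r * \<zeta>) < 1" using \<zeta> by (simp add: norm_mult)
    have "1 / 2 \<le> sqrt (\<kappa> (of_real r * \<zeta>) * (1 / (4 * Y)))" using elim(1) unfolding real_sqrt_mult by simp
    then have "(1 / 2)\<^sup>2 \<le> \<kappa> (of_real r * \<zeta>) * (1 / (4 * Y))"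
      using kernel_ge_1[OF w] Y by (intro sqrt_ge_absD) auto
    then have "Y \<le> \<kappa> (of_real r * \<zeta>)" using Y by (simp add: field_simps power2_eq_square)
    with Y show ?case by simp
  qed
qed

lemma kernel_limit_pos:
  assumes dw: "douglas_weight \<omega>" and \<zeta>: "norm \<zeta> = 1" and cap: "capacity \<omega> {\<zeta>} = ennreal C" "0 < C"
  shows "((\<lambda>r. \<kappa> (of_real r * \<zeta>)) \<longlongrightarrow> 1 / C) (at_left 1)"
proof -
  let ?f = "\<lambda>r. sqrt C * sqrt (\<kappa> (of_real r * \<zeta>))"
  have ev\<eta>: "\<forall>\<^sub>F \<eta>::real in at_right 0. 0 < \<eta> \<and> \<eta> < 1"
    using eventually_at_right_real[of 0 1] by simp
  have lim: "(?f \<longlongrightarrow> 1) (at_left 1)"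
  proof (rule order_tendstoI)
    fix x :: real assume x: "x < 1"
    have "((\<lambda>\<eta>::real. (1 - \<eta>) / (1 + \<eta>)) \<longlongrightarrow> (1 - 0) / (1 + 0)) (at_right 0)"
      by (intro tendsto_intros) simp
    then have "\<forall>\<^sub>F \<eta>::real in at_right 0. x < (1 - \<eta>) / (1 + \<eta>)"
      by (rule order_tendstoD(1)) (use x in simp)
    with ev\<eta> have "\<forall>\<^sub>F \<eta>::real in at_right 0. (0 < \<eta> \<and> \<eta> < 1) \<and> x < (1 - \<eta>) / (1 + \<eta>)"
      by (rule eventually_conj)
    from eventually_happens'[OF _ this] obtain \<eta> :: real
      where \<eta>: "0 < \<eta>" "\<eta> < 1" "x < (1 - \<eta>) / (1 + \<eta>)" by auto
    \<comment> \<open>The tolerance is chosen so that the square root of its sum with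
      \<open>C\<close> is \<open>(1 + \<eta>) * sqrt C\<close>.\<close>
    have eq: "C + C * ((1 + \<eta>)\<^sup>2 - 1) = C * (1 + \<eta>)\<^sup>2" by (simp add: algebra_simps)
    have "\<forall>\<^sub>F r in at_left 1. 1 - \<eta> \<le> sqrt (\<kappa> (of_real r * \<zeta>)) * sqrt (C + C * ((1 + \<eta>)\<^sup>2 - 1))"
      by (rule kernel_lower[OF dw \<zeta> cap(1)]) (use cap(2) \<eta> in \<open>auto simp: power2_eq_square algebra_simps add_pos_pos\<close>)
    then show "\<forall>\<^sub>F r in at_left 1. x < ?f r"
    proof eventually_elim
      case (elim r)
      then have "1 - \<eta> \<le> ?f r * (1 + \<eta>)"
        unfolding eq real_sqrt_mult using \<eta> by (simp add: mult_ac)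
      then have "(1 - \<eta>) / (1 + \<eta>) \<le> ?f r" using \<eta> by (simp add: pos_divide_le_eq)
      with \<eta>(3) show ?case by linarith
    qed
  next
    fix x :: real assume x: "1 < x"
    have "((\<lambda>\<eta>::real. (1 + \<eta>) / (1 - \<eta>) ^ 3) \<longlongrightarrow> (1 + 0) / (1 - 0) ^ 3) (at_right 0)"
      by (intro tendsto_intros) simp
    then have "\<forall>\<^sub>F \<eta>::real in at_right 0. (1 + \<eta>) / (1 - \<eta>) ^ 3 < x"
      by (rule order_tendstoD(2)) (use x in simp)
    with ev\<eta> have "\<forall>\<^sub>F \<eta>::real in at_right 0. (0 < \<eta> \<and> \<eta> < 1) \<and> (1 + \<eta>) / (1 - \<eta>) ^ 3 < x"
      by (rule eventually_conj)
    from eventually_happens'[OF _ this] obtain \<eta> :: real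
      where \<eta>: "0 < \<eta>" "\<eta> < 1" "(1 + \<eta>) / (1 - \<eta>) ^ 3 < x" by auto
    have "\<forall>\<^sub>F r in at_left 1. (1 - \<eta>) ^ 3 * sqrt C * sqrt (\<kappa> (of_real r * \<zeta>)) \<le> 1 + \<eta>"
      by (rule kernel_upper[OF dw \<zeta> cap \<eta>(1,2)])
    then show "\<forall>\<^sub>F r in at_left 1. ?f r < x"
    proof eventually_elim
      case (elim r)
      have "0 < (1 - \<eta>) ^ 3" using \<eta> by simp
      then have "?f r \<le> (1 + \<eta>) / (1 - \<eta>) ^ 3" using elim by (simp add: pos_le_divide_eq mult_ac)
      with \<eta>(3) show ?case by linarith
    qed
  qed
  then have "((\<lambda>r. (?f r)\<^sup>2 / C) \<longlongrightarrow> 1\<^sup>2 / C) (at_left 1)"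
    using cap(2) by (intro tendsto_intros) auto
  moreover have "\<forall>\<^sub>F r in at_left 1. (?f r)\<^sup>2 / C = \<kappa> (of_real r * \<zeta>)"
    using eventually_radius
  proof eventually_elim
    case (elim r)
    then have w: "norm (of_real r * \<zeta>) < 1" using \<zeta> by (simp add: norm_mult)
    show ?case using kernel_ge_1[OF w] cap(2) by (simp add: power_mult_distrib)
  qed
  ultimately show ?thesis by (auto intro: Lim_transform_eventually)
qed

end

theorem theorem3p5:
  fixes \<omega> :: "complex \<Rightarrow> real" and \<zeta> :: complex
  assumes "douglas_weight \<omega>"
    and "dirichlet_space \<omega> \<subseteq> hardy_space"
    and "\<zeta> \<in> unit_circle"
  shows "capacity \<omega> {\<zeta>} = 1 / (2 * kernel_boundary_value \<omega> \<zeta> - 1) \<and>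
    (capacity \<omega> {\<zeta>} = 0 \<longleftrightarrow> kernel_boundary_value \<omega> \<zeta> = \<infinity>)"
proof -
  interpret dirichlet_weight \<omega>
    using assms by unfold_locales (auto simp: douglas_weight_def)
  have \<zeta>: "norm \<zeta> = 1" using assms by simp
  \<comment> \<open>The constant 1 is a competitor of norm 1, so the capacity is a real
    number.\<close>
  have "capacity \<omega> {\<zeta>} \<noteq> \<infinity>" using capacity_le_1[OF \<zeta>] by (auto simp: top_unique)
  then obtain C where C: "capacity \<omega> {\<zeta>} = ennreal C" "0 \<le> C"
    by (cases "capacity \<omega> {\<zeta>}") auto
  show ?thesis
  proof (cases "C = 0")
    case True
    then have cap: "capacity \<omega> {\<zeta>} = 0" using C by simp
    have "filterlim (\<lambda>r. (1/2) * (1 + \<kappa> (of_real r * \<zeta>))) at_top (at_left 1)"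
      by (intro filterlim_tendsto_pos_mult_at_top[OF tendsto_const] filterlim_tendsto_add_at_top[OF tendsto_const]
          kernel_limit_zero[OF assms(1) \<zeta> cap]) simp
    then have "((\<lambda>r. ennreal (Re (dirichlet_kernel \<omega> (of_real r * \<zeta>) (of_real r * \<zeta>)))) \<longlongrightarrow> \<infinity>) (at_left 1)"
      by (simp add: ennreal_tendsto_top_eq_at_top)
    then have "kernel_boundary_value \<omega> \<zeta> = \<infinity>"
      unfolding kernel_boundary_value_def by (intro tendsto_Lim) auto
    \<comment> \<open>In \<open>ennreal\<close>, infinity minus 1 is infinity and 1 divided by
      infinity is 0.\<close>
    with cap show ?thesis by (simp add: ennreal_mult_top ennreal_top_minus)
  next
    case False
    with C have C0: "0 < C" by simp
    have "((\<lambda>r. ennreal ((1 + \<kappa> (of_real r * \<zeta>)) / 2)) \<longlongrightarrow> ennreal ((1 + 1 / C) / 2)) (at_left 1)"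
      by (intro tendsto_ennrealI tendsto_intros kernel_limit_pos[OF assms(1) \<zeta> C(1) C0]) simp
    then have "((\<lambda>r. ennreal (Re (dirichlet_kernel \<omega> (of_real r * \<zeta>) (of_real r * \<zeta>)))) \<longlongrightarrow> ennreal ((1 + 1 / C) / 2)) (at_left 1)"
      by simp
    then have k: "kernel_boundary_value \<omega> \<zeta> = ennreal ((1 + 1 / C) / 2)"
      unfolding kernel_boundary_value_def by (intro tendsto_Lim) auto
    have "2 * ennreal ((1 + 1 / C) / 2) = ennreal (1 + 1 / C)"
    proof -
      have "2 * ennreal ((1 + 1 / C) / 2) = ennreal (2 * ((1 + 1 / C) / 2))"
        using C0 by (subst ennreal_mult) (auto simp del: ennreal_plus)
      also have "2 * ((1 + 1 / C) / 2) = 1 + 1 / C" by (simp add: field_simps)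
      finally show ?thesis .
    qed
    \<comment> \<open>Subtraction in \<open>ennreal\<close> is truncated at 0, which is harmless
      here because 1 + 1 / C exceeds 1.\<close>
    then have "2 * kernel_boundary_value \<omega> \<zeta> - 1 = ennreal (1 / C)"
      unfolding k using C0 by (simp flip: ennreal_1 add: ennreal_minus del: ennreal_plus)
    then have "1 / (2 * kernel_boundary_value \<omega> \<zeta> - 1) = ennreal C"
      using C0 by (simp add: divide_ennreal flip: ennreal_1)
    with C C0 k show ?thesis by simp
  qed
qed

end
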